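(* Let $d,m\ge1$ and let $\mathbf{X}_i=(X_i^{(1)},\ldots,X_i^{(d)})$, $i=1,2,\ldots$, be i.i.d. random vectors in $\mathbb{R}^d$. Let $F_j$ be the distribution function of $X_1^{(j)}$, assumed continuous for $1\le j\le d$, and let $F_{j,k}$ be the joint distribution function of $(X_1^{(j)},X_1^{(k)})$. Let $\phi_1,\ldots,\phi_m:\mathbb{R}^d\to\mathbb{R}$ be measurable functions, each of which satisfies conditions (C1), (C2), (C3) and (C4) listed in the context (with $\phi=\phi_r$), and suppose that for each $r$ the function $x\mapsto\phi_r\bigl(F_1^{-1}(x),\ldots,F_d^{-1}(x)\bigr)$ is Riemann integrable on $(0,1)$. For $1\le r\le m$ define $$T_n(\phi_r)=\sum_{i=1}^n\phi_r\bigl(X_{n:i}^{(1)},\ldots,X_{n:i}^{(d)}\bigr),\qquad\bar\gamma_r=E\,\phi_r\bigl(F_1^{-1}(U),F_2^{-1}(U),\ldots,F_d^{-1}(U)\bigr),$$ where $U$ is uniformly distributed on $(0,1)$. Then, as $n\to\infty$, $$\frac{1}{\sqrt n}\bigl(T_n(\phi_1),\ldots,T_n(\phi_m)\bigr)-\sqrt n\,(\bar\gamma_1,\ldots,\bar\gamma_m)\longrightarrow N(0,\Sigma)\quad\text{in distribution},$$ where the $(r,s)$th element $\sigma_{r,s}$ of $\Sigma$ is given by $$\sigma_{r,s}=\sum_{j=1}^d\int_0^1\!\!\int_0^yx(1-y)\bigl(\psi_j(x;r)\psi_j(y;s)+\psi_j(x;s)\psi_j(y;r)\bigr)\,dx\,dy$$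 $$\qquad+\sum_{1\le j<k\le d}\int_0^1\!\!\int_0^1\bigl(G_{j,k}(x,y)-xy\bigr)\bigl(\psi_j(x;r)\psi_k(y;s)+\psi_j(x;s)\psi_k(y;r)\bigr)\,dx\,dy,$$ with $G_{j,k}(x,y)=F_{j,k}\bigl(F_j^{-1}(x),F_k^{-1}(y)\bigr)$ and $\psi_j(x;r)$ the partial derivative of $\phi_r\bigl(F_1^{-1}(x_1),\ldots,F_d^{-1}(x_d)\bigr)$ with respect to $x_j$ evaluated at $x_1=\cdots=x_d=x$.
   Context: Notation. $X_{n:i}^{(j)}$ is the $i$th order statistic ($i$th smallest value) of $X_1^{(j)},\ldots,X_n^{(j)}$. For a distribution function $F$ and $0<t<1$, $F^{-1}(t)=\inf\{x:F(x)\ge t\}$. Put $\mu_{n:i}=i/(n+1)$. For a measurable $\phi:\mathbb{R}^d\to\mathbb{R}$, $0<x,x_1,\ldots,x_d<1$, $\mathbf{x}=(x_1,\ldots,x_d)$, $1\le j,k\le d$: $$\psi(\mathbf{x})=\phi\bigl(F_1^{-1}(x_1),\ldots,F_d^{-1}(x_d)\bigr),\quad\gamma(x)=\psi(x,\ldots,x),\quad\psi_j(x)=\frac{\partial\psi(\mathbf{x})}{\partial x_j}\Big|_{(x,\ldots,x)},$$ $$\psi_{j,k}(\mathbf{x})=\frac{\partial^2\psi(\mathbf{x})}{\partial x_j\,\partial x_k},\quad\tilde\psi_{j,k}(x)=\psi_{j,k}(x,\ldots,x).$$ The partial derivatives occurring in the conditions below are understood to exist at the diagonal points $(x,\ldots,x)$,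 $0<x<1$. Conditions on $\phi$. (C1) $\psi$ is continuous at every point $(u,\ldots,u)$ with $0<u<1$ ($\psi$ need not be bounded). (C2) There exist $K$ and $c_0>0$ such that $|\psi(x_1,\ldots,x_d)|\le K\bigl(1+\sum_{j=1}^d|\gamma(x_j)|\bigr)$ for $(x_1,\ldots,x_d)\in(0,c_0)^d\cup(1-c_0,1)^d$. (C3) For $1\le j,k\le d$, as $n\to\infty$, $$\frac1n\sum_{i=1}^n\bigl(\mu_{n:i}(1-\mu_{n:i})\bigr)^{3/2}(\psi_j(\mu_{n:i}))^2\longrightarrow\int_0^1\bigl(x(1-x)\bigr)^{3/2}(\psi_j(x))^2\,dx<\infty$$ and $$\frac1n\sum_{i=1}^n\bigl(\mu_{n:i}(1-\mu_{n:i})\bigr)^{3/2}|\tilde\psi_{j,k}(\mu_{n:i})|\longrightarrow\int_0^1\bigl(x(1-x)\bigr)^{3/2}|\tilde\psi_{j,k}(x)|\,dx<\infty.$$ (C4) For all large $M$ there exist $K=K(M)\ge1$ and $\delta>0$ such that $$|\psi(\mathbf{y})-\psi(\mathbf{x})-\langle\mathbf{y}-\mathbf{x},\nabla\psi(\mathbf{x})\rangle|\le K\sum_{j,k=1}^d|(y_j-x)(y_k-x)|\bigl(1+|\psi_{j,k}(\mathbf{x})|\bigr)$$ whenever $\mathbf{x}=(x,\ldots,x)\in(0,1)^d$ and $\mathbf{y}=(y_1,\ldots,y_d)\in(0,1)^d$ satisfy $\|\mathbf{y}-\mathbf{x}\|_{\ell_1}<\delta$ and $\min_{1\le j\le d}y_j(1-y_j)>x(1-x)/M$.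 Here $\|\mathbf{y}\|_{\ell_1}=|y_1|+\cdots+|y_d|$ and $\nabla\psi(\mathbf{x})$ is the gradient of $\psi$ at $\mathbf{x}$. *)

theory Defs
  imports "HOL-Probability.Probability"
begin

section \<open>Quantiles and order statistics\<close>

text \<open>Used only for arguments strictly between 0 and 1, where the infimum of a distribution
  function's superlevel set is attained.\<close>

definition quantile :: "(real \<Rightarrow> real) \<Rightarrow> real \<Rightarrow> real" where
  "quantile F t = Inf {x. F x \<ge> t}"

text \<open>The \<open>i\<close>th smallest (\<open>1 \<le> i \<le> n\<close>) of the \<open>n\<close> values \<open>x 0, \<dots>, x (n - 1)\<close>.\<close>

definition order_stat :: "(nat \<Rightarrow> real) \<Rightarrow> nat \<Rightarrow> nat \<Rightarrow> real" where
  "order_stat x n i = sort (map x [0..<n]) ! (i - 1)"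

definition T_stat :: "(nat \<Rightarrow> real ^ 'd) \<Rightarrow> nat \<Rightarrow> (real ^ 'd \<Rightarrow> real) \<Rightarrow> real" where
  "T_stat x n \<phi> = (\<Sum>i=1..n. \<phi> (\<chi> j. order_stat (\<lambda>l. x l $ j) n i))"

definition joint_cdf :: "'a measure \<Rightarrow> ('a \<Rightarrow> real ^ 'd) \<Rightarrow> 'd \<Rightarrow> 'd \<Rightarrow> real \<Rightarrow> real \<Rightarrow> real" where
  "joint_cdf M Y j k x y = measure M {\<omega> \<in> space M. Y \<omega> $ j \<le> x \<and> Y \<omega> $ k \<le> y}"


section \<open>Partial derivatives\<close>

definition partial_deriv :: "'d \<Rightarrow> (real ^ 'd \<Rightarrow> real) \<Rightarrow> real ^ 'd \<Rightarrow> real" where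
  "partial_deriv j f x = deriv (\<lambda>h. f (x + h *\<^sub>R axis j 1)) 0"

definition has_partial_deriv :: "'d \<Rightarrow> (real ^ 'd \<Rightarrow> real) \<Rightarrow> real ^ 'd \<Rightarrow> bool" where
  "has_partial_deriv j f x \<longleftrightarrow> (\<lambda>h. f (x + h *\<^sub>R axis j 1)) differentiable (at 0)"

text \<open>Existence of the second partial derivative at the single point \<open>x\<close>: the inner derivative has
  to exist on a segment through \<open>x\<close> in the direction of the outer one, and nowhere else.\<close>

definition has_partial_deriv2 :: "'d \<Rightarrow> 'd \<Rightarrow> (real ^ 'd \<Rightarrow> real) \<Rightarrow> real ^ 'd \<Rightarrow> bool" where
  "has_partial_deriv2 j k f x \<longleftrightarrow>
     (\<forall>\<^sub>F h in nhds 0. has_partial_deriv k f (x + h *\<^sub>R axis j 1)) \<and>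
     has_partial_deriv j (partial_deriv k f) x"


section \<open>The function \<open>\<psi>\<close> and its derivatives on the diagonal\<close>

definition diag :: "real \<Rightarrow> real ^ 'd" where
  "diag x = (\<chi> j. x)"

definition \<psi> :: "('d \<Rightarrow> real \<Rightarrow> real) \<Rightarrow> (real ^ 'd \<Rightarrow> real) \<Rightarrow> real ^ 'd \<Rightarrow> real" where
  "\<psi> F \<phi> x = \<phi> (\<chi> j. quantile (F j) (x $ j))"

definition \<gamma> :: "('d \<Rightarrow> real \<Rightarrow> real) \<Rightarrow> (real ^ 'd \<Rightarrow> real) \<Rightarrow> real \<Rightarrow> real" where
  "\<gamma> F \<phi> x = \<psi> F \<phi> (diag x)"

definition \<psi>1 :: "('d \<Rightarrow> real \<Rightarrow> real) \<Rightarrow> (real ^ 'd \<Rightarrow> real) \<Rightarrow> 'd \<Rightarrow> real \<Rightarrow> real" where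
  "\<psi>1 F \<phi> j x = partial_deriv j (\<psi> F \<phi>) (diag x)"

definition \<psi>2 :: "('d \<Rightarrow> real \<Rightarrow> real) \<Rightarrow> (real ^ 'd \<Rightarrow> real) \<Rightarrow> 'd \<Rightarrow> 'd \<Rightarrow> real \<Rightarrow> real" where
  "\<psi>2 F \<phi> j k x = partial_deriv j (partial_deriv k (\<psi> F \<phi>)) (diag x)"

definition \<gamma>_bar :: "('d \<Rightarrow> real \<Rightarrow> real) \<Rightarrow> (real ^ 'd \<Rightarrow> real) \<Rightarrow> real" where
  "\<gamma>_bar F \<phi> = (LINT u|uniform_measure lborel {0<..<1}. \<gamma> F \<phi> u)"


section \<open>Riemann integrability on the open unit interval\<close>

text \<open>The classical mesh definition: a Henstock--Kurzweil integral with a constant gauge.\<close>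

definition has_riemann_integral :: "(real \<Rightarrow> real) \<Rightarrow> real \<Rightarrow> real \<Rightarrow> real \<Rightarrow> bool" where
  "has_riemann_integral f I a b \<longleftrightarrow>
     (\<forall>e>0. \<exists>d>0. \<forall>p. p tagged_division_of {a..b} \<and> (\<lambda>x. ball x d) fine p \<longrightarrow>
        \<bar>(\<Sum>(x, k)\<in>p. measure lborel k * f x) - I\<bar> < e)"

text \<open>Since \<open>\<gamma>\<close> may be unbounded near 0 and 1, integrability on \<open>(0,1)\<close> is meant in the improper
  sense. This includes every function whose extension to \<open>[0,1]\<close> is properly Riemann integrable.\<close>

definition riemann_integrable_01 :: "(real \<Rightarrow> real) \<Rightarrow> bool" where
  "riemann_integrable_01 f \<longleftrightarrow>
     (\<exists>J L. (\<forall>a b. 0 < a \<and> a < b \<and> b < 1 \<longrightarrow> has_riemann_integral f (J a b) a b) \<and>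
            ((\<lambda>(a, b). J a b) \<longlongrightarrow> L) (at_right 0 \<times>\<^sub>F at_left 1))"


section \<open>The conditions on \<open>\<phi>\<close>\<close>

definition diag_partials_exist :: "('d::finite \<Rightarrow> real \<Rightarrow> real) \<Rightarrow> (real ^ 'd \<Rightarrow> real) \<Rightarrow> bool" where
  "diag_partials_exist F \<phi> \<longleftrightarrow>
     (\<forall>x j k. 0 < x \<and> x < 1 \<longrightarrow>
        has_partial_deriv j (\<psi> F \<phi>) (diag x) \<and> has_partial_deriv2 j k (\<psi> F \<phi>) (diag x))"

definition C1 :: "('d::finite \<Rightarrow> real \<Rightarrow> real) \<Rightarrow> (real ^ 'd \<Rightarrow> real) \<Rightarrow> bool" where
  "C1 F \<phi> \<longleftrightarrow> (\<forall>u. 0 < u \<and> u < 1 \<longrightarrow> isCont (\<psi> F \<phi>) (diag u))"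

definition C2 :: "('d::finite \<Rightarrow> real \<Rightarrow> real) \<Rightarrow> (real ^ 'd \<Rightarrow> real) \<Rightarrow> bool" where
  "C2 F \<phi> \<longleftrightarrow>
     (\<exists>K c\<^sub>0. c\<^sub>0 > 0 \<and>
        (\<forall>x. (\<forall>j. 0 < x $ j \<and> x $ j < c\<^sub>0) \<or> (\<forall>j. 1 - c\<^sub>0 < x $ j \<and> x $ j < 1) \<longrightarrow>
           \<bar>\<psi> F \<phi> x\<bar> \<le> K * (1 + (\<Sum>j\<in>UNIV. \<bar>\<gamma> F \<phi> (x $ j)\<bar>))))"

definition \<mu> :: "nat \<Rightarrow> nat \<Rightarrow> real" where
  "\<mu> n i = real i / (real n + 1)"

definition C3_for :: "(real \<Rightarrow> real) \<Rightarrow> bool" where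
  "C3_for h \<longleftrightarrow>
     set_integrable lborel {0<..<1} (\<lambda>x. (x * (1 - x)) powr (3 / 2) * h x) \<and>
     (\<lambda>n. 1 / real n * (\<Sum>i=1..n. (\<mu> n i * (1 - \<mu> n i)) powr (3 / 2) * h (\<mu> n i)))
       \<longlonglongrightarrow> (LINT x:{0<..<1}|lborel. (x * (1 - x)) powr (3 / 2) * h x)"

definition C3 :: "('d::finite \<Rightarrow> real \<Rightarrow> real) \<Rightarrow> (real ^ 'd \<Rightarrow> real) \<Rightarrow> bool" where
  "C3 F \<phi> \<longleftrightarrow>
     (\<forall>j k. C3_for (\<lambda>x. (\<psi>1 F \<phi> j x)\<^sup>2) \<and> C3_for (\<lambda>x. \<bar>\<psi>2 F \<phi> j k x\<bar>))"

definition C4 :: "('d::finite \<Rightarrow> real \<Rightarrow> real) \<Rightarrow> (real ^ 'd \<Rightarrow> real) \<Rightarrow> bool" where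
  "C4 F \<phi> \<longleftrightarrow>
     (\<exists>M\<^sub>0::real. \<forall>M\<ge>M\<^sub>0. \<exists>K\<ge>1. \<exists>\<delta>>0. \<forall>x y.
        0 < x \<and> x < 1 \<and> (\<forall>j. 0 < y $ j \<and> y $ j < 1) \<and>
        (\<Sum>j\<in>UNIV. \<bar>y $ j - x\<bar>) < \<delta> \<and>
        (MIN j. y $ j * (1 - y $ j)) > x * (1 - x) / M \<longrightarrow>
        \<bar>\<psi> F \<phi> y - \<psi> F \<phi> (diag x) - (y - diag x) \<bullet> (\<chi> j. \<psi>1 F \<phi> j x)\<bar>
          \<le> K * (\<Sum>j\<in>UNIV. \<Sum>k\<in>UNIV.
                   \<bar>(y $ j - x) * (y $ k - x)\<bar> * (1 + \<bar>\<psi>2 F \<phi> j k x\<bar>)))"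


section \<open>The limit law\<close>

text \<open>Characteristic-function definition, so that singular \<open>\<Sigma>\<close> is allowed; positive semidefiniteness
  of \<open>\<Sigma>\<close> follows from the existence of \<open>\<nu>\<close>.\<close>

definition multivariate_normal :: "real ^ 'm \<Rightarrow> real ^ 'm ^ 'm \<Rightarrow> (real ^ 'm) measure \<Rightarrow> bool" where
  "multivariate_normal m \<Sigma> \<nu> \<longleftrightarrow>
     prob_space \<nu> \<and> sets \<nu> = sets borel \<and> transpose \<Sigma> = \<Sigma> \<and>
     (\<forall>t. (CLINT x|\<nu>. iexp (t \<bullet> x)) =
            exp (\<i> * complex_of_real (t \<bullet> m) - complex_of_real (t \<bullet> (\<Sigma> *v t)) / 2))"

definition converges_in_distribution ::
  "'a measure \<Rightarrow> (nat \<Rightarrow> 'a \<Rightarrow> 'b::euclidean_space) \<Rightarrow> 'b measure \<Rightarrow> bool" where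
  "converges_in_distribution M Z \<nu> \<longleftrightarrow>
     (\<forall>n. Z n \<in> borel_measurable M) \<and>
     (\<forall>f :: 'b \<Rightarrow> real. continuous_on UNIV f \<and> bounded (range f) \<longrightarrow>
        (\<lambda>n. LINT \<omega>|M. f (Z n \<omega>)) \<longlonglongrightarrow> (LINT x|\<nu>. f x))"

text \<open>\<open>p r j\<close> stands for \<open>\<psi>\<^sub>j(\<cdot>; r)\<close> and \<open>G j k\<close> for \<open>G\<^sub>j\<^sub>,\<^sub>k\<close>. The linear order on the coordinate type is
  needed only to write the sum over \<open>j < k\<close>; every finite type can be given one.\<close>

definition \<sigma> ::
  "('d::{finite,linorder} \<Rightarrow> 'd \<Rightarrow> real \<Rightarrow> real \<Rightarrow> real) \<Rightarrow> ('m \<Rightarrow> 'd \<Rightarrow> real \<Rightarrow> real) \<Rightarrow>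
   'm \<Rightarrow> 'm \<Rightarrow> real" where
  "\<sigma> G p r s =
     (\<Sum>j\<in>UNIV. LINT y:{0<..<1}|lborel. LINT x:{0<..<y}|lborel.
        x * (1 - y) * (p r j x * p s j y + p s j x * p r j y)) +
     (\<Sum>(j, k)\<in>{(j, k). j < k}. LINT y:{0<..<1}|lborel. LINT x:{0<..<1}|lborel.
        (G j k x y - x * y) * (p r j x * p s k y + p s j x * p r k y))"

end

theory Submission
  imports Defs
begin

text \<open>
  The statistic is additive up to a negligible error, and an additive function of order
  statistics is a sum over the sample, to which the central limit theorem applies.

  Write \<open>U j l = F j (X l $ j)\<close>. These are uniform for each coordinate \<open>j\<close>, and almost surely the
  order statistics of \<open>X\<close> are the quantiles of those of \<open>U\<close>; hence the statistic is the sum of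
  \<open>\<psi>\<close> over the vectors of uniform order statistics, which lie close to the diagonal.
  Let \<open>q = \<Sum>\<^sub>j\<^sub>k (1 + \<bar>\<psi>2 j k\<bar>)\<close>. Condition C4 bounds the error of the first-order expansion of
  \<open>\<psi>\<close> at the diagonal point over \<open>x\<close> by \<open>q x\<close> times a square. Comparing the expansions at two
  neighbouring diagonal points gives \<open>\<bar>\<psi>1 j b - \<psi>1 j a\<bar> \<le> K \<integral>\<^sub>a\<^sup>b q\<close> (\<open>partials_increment\<close>): the
  first partials are continuous along the diagonal and have primitives \<open>V j\<close>. On the diagonal
  \<open>\<psi>\<close> equals \<open>\<gamma>_bar + \<Sum>\<^sub>j V j\<close>, and off it the remainder \<open>H y = \<psi> y - \<gamma>_bar - \<Sum>\<^sub>j V j (y $ j)\<close> is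
  at most \<open>K (b - a) \<integral>\<^sub>a\<^sup>b q\<close> when all coordinates of \<open>y\<close> lie in \<open>[a, b]\<close>
  (\<open>additive_remainder_bound\<close>).

  To sum this bound over the ranks \<open>i\<close>, the sum and the integral are exchanged. A point \<open>u\<close> lies
  between the extreme coordinates of the \<open>i\<close>th vector only if \<open>i\<close> lies between two of the counts
  \<open>N j u = #{l < n. U j l \<le> u}\<close>, and these differ by \<open>O(\<surd>(n u (1 - u)))\<close> in mean. With high probability
  the interval lengths are at most \<open>C u (1 - u)\<close>, by Chernoff bounds for the extreme ranks, and
  at the same time smaller than any given \<open>\<epsilon>\<close>. Divided by \<open>\<surd>n\<close>, the sum of the remainders is then
  bounded by a variable whose mean is at most a constant times
  \<open>\<integral> q(u) (u (1 - u))\<^sup>1\<^sup>/\<^sup>2 min {C u (1 - u), \<epsilon>} du\<close>. This tends to 0 with \<open>\<epsilon>\<close> by dominated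
  convergence, because condition C3 makes \<open>(u (1 - u))\<^sup>3\<^sup>/\<^sup>2 q(u)\<close> integrable
  (\<open>additive_remainder_negligible\<close>).

  There remains the sum over the sample of \<open>\<Sum>\<^sub>j V j (U j l)\<close>. Normalised to mean 0,
  \<open>V j u = - \<integral> (1{u \<le> x} - x) \<psi>1 j x dx\<close>, and Fubini turns the covariances into the integrals that
  define \<open>\<sigma>\<close> (\<open>covariance_centred_primitives\<close>); they converge since
  \<open>\<integral> (x (1 - x))\<^sup>1\<^sup>/\<^sup>2 \<bar>\<psi>1 j x\<bar> dx\<close> is finite, again by C3 and the Cauchy--Schwarz inequality.
  The one-dimensional central limit theorem gives the limits of the characteristic functions
  (\<open>multivariate_clt_with_error\<close>). Weak convergence of vectors follows from these and tightness,
  because on a cube every continuous function is uniformly close to a bounded trigonometric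
  polynomial (\<open>weak_convergence_from_chf_tight\<close>).
\<close>

section \<open>Expansion at the diagonal\<close>

text \<open>Condition C4 with every coordinate displacement bounded by one number \<open>r\<close>
  and the second partials collected into one function \<open>q\<close>.\<close>

definition taylor_bound ::
    "(real ^ 'd \<Rightarrow> real) \<Rightarrow> ('d \<Rightarrow> real \<Rightarrow> real) \<Rightarrow> (real \<Rightarrow> real) \<Rightarrow> real \<Rightarrow> real \<Rightarrow> real \<Rightarrow> bool" where
  "taylor_bound f p q M K \<delta> \<longleftrightarrow> (\<forall>x y r.
     0 < x \<and> x < 1 \<and> (\<forall>j. 0 < y $ j \<and> y $ j < 1) \<and> (\<forall>j. \<bar>y $ j - x\<bar> \<le> r) \<and> r < \<delta> \<and>
     (\<forall>j. x * (1 - x) < M * (y $ j * (1 - y $ j))) \<longrightarrow>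
     \<bar>f y - f (diag x) - (\<Sum>j\<in>UNIV. (y $ j - x) * p j x)\<bar> \<le> K * r\<^sup>2 * q x)"

definition taylor_diag :: "(real ^ 'd \<Rightarrow> real) \<Rightarrow> ('d \<Rightarrow> real \<Rightarrow> real) \<Rightarrow> (real \<Rightarrow> real) \<Rightarrow> bool" where
  "taylor_diag f p q \<longleftrightarrow> (\<exists>M\<^sub>0. \<forall>M\<ge>M\<^sub>0. \<exists>K\<ge>0. \<exists>\<delta>>0. taylor_bound f p q M K \<delta>)"

lemma taylor_diagI_C4:
  fixes F :: "'d::finite \<Rightarrow> real \<Rightarrow> real" and \<phi> :: "real ^ 'd \<Rightarrow> real"
  assumes "C4 F \<phi>"
  shows "taylor_diag (\<psi> F \<phi>) (\<psi>1 F \<phi>) (\<lambda>x. \<Sum>j\<in>UNIV. \<Sum>k\<in>UNIV. 1 + \<bar>\<psi>2 F \<phi> j k x\<bar>)"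
proof -
  define C4_bound where "C4_bound M K \<delta> \<longleftrightarrow> (\<forall>x y.
      0 < x \<and> x < 1 \<and> (\<forall>j. 0 < y $ j \<and> y $ j < 1) \<and> (\<Sum>j\<in>UNIV. \<bar>y $ j - x\<bar>) < \<delta> \<and>
      (MIN j. y $ j * (1 - y $ j)) > x * (1 - x) / M \<longrightarrow>
      \<bar>\<psi> F \<phi> y - \<psi> F \<phi> (diag x) - (y - diag x) \<bullet> (\<chi> j. \<psi>1 F \<phi> j x)\<bar>
        \<le> K * (\<Sum>j\<in>UNIV. \<Sum>k\<in>UNIV. \<bar>(y $ j - x) * (y $ k - x)\<bar> * (1 + \<bar>\<psi>2 F \<phi> j k x\<bar>)))" for M K \<delta>
  obtain M0 where M0: "\<forall>M\<ge>M0. \<exists>K\<ge>1. \<exists>\<delta>>0. C4_bound M K \<delta>"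
    using assms unfolding C4_def C4_bound_def by (rule exE)
  show ?thesis unfolding taylor_diag_def
  proof (rule exI[of _ "max M0 1"], intro allI impI)
    fix M :: real assume M: "M \<ge> max M0 1"
    then obtain K \<delta> where K: "K \<ge> 1" and \<delta>: "\<delta> > 0" and *: "C4_bound M K \<delta>"
      using M0 by auto
    let ?d = "real CARD('d)"
    have d: "?d > 0" by simp
    have "taylor_bound (\<psi> F \<phi>) (\<psi>1 F \<phi>) (\<lambda>x. \<Sum>j\<in>UNIV. \<Sum>k\<in>UNIV. 1 + \<bar>\<psi>2 F \<phi> j k x\<bar>) M K (\<delta> / ?d)"
      unfolding taylor_bound_def
    proof (intro allI impI)
      fix x r :: real and y :: "real ^ 'd"
      assume H: "0 < x \<and> x < 1 \<and> (\<forall>j. 0 < y $ j \<and> y $ j < 1) \<and> (\<forall>j. \<bar>y $ j - x\<bar> \<le> r) \<and> r < \<delta> / ?d \<and>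
        (\<forall>j. x * (1 - x) < M * (y $ j * (1 - y $ j)))"
      have "(\<Sum>j\<in>UNIV. \<bar>y $ j - x\<bar>) \<le> (\<Sum>j\<in>(UNIV::'d set). r)" by (rule sum_mono) (use H in auto)
      also have "\<dots> = ?d * r" by simp
      also have "\<dots> < \<delta>" using H d by (simp add: field_simps)
      finally have 1: "(\<Sum>j\<in>UNIV. \<bar>y $ j - x\<bar>) < \<delta>" .
      have 2: "(MIN j. y $ j * (1 - y $ j)) > x * (1 - x) / M"
      proof (rule Min_gr_iff[THEN iffD2], simp, simp, rule ballI)
        fix a assume "a \<in> range (\<lambda>j. y $ j * (1 - y $ j))"
        then show "x * (1 - x) / M < a" using H M by (auto simp: field_simps)
      qed
      have "(y - diag x) \<bullet> (\<chi> j. \<psi>1 F \<phi> j x) = (\<Sum>j\<in>UNIV. (y $ j - x) * \<psi>1 F \<phi> j x)"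
        by (simp add: inner_vec_def diag_def)
      then have "\<bar>\<psi> F \<phi> y - \<psi> F \<phi> (diag x) - (\<Sum>j\<in>UNIV. (y $ j - x) * \<psi>1 F \<phi> j x)\<bar>
          \<le> K * (\<Sum>j\<in>UNIV. \<Sum>k\<in>UNIV. \<bar>(y $ j - x) * (y $ k - x)\<bar> * (1 + \<bar>\<psi>2 F \<phi> j k x\<bar>))"
        using *[unfolded C4_bound_def, rule_format, of x y] 1 2 H by simp
      also have "\<dots> \<le> K * (\<Sum>j\<in>UNIV. \<Sum>k\<in>UNIV. r\<^sup>2 * (1 + \<bar>\<psi>2 F \<phi> j k x\<bar>))"
      proof (intro mult_left_mono sum_mono mult_right_mono)
        fix j k
        have "0 \<le> r" using H abs_ge_zero order_trans by blast
        then show "\<bar>(y $ j - x) * (y $ k - x)\<bar> \<le> r\<^sup>2"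
          unfolding abs_mult power2_eq_square using H by (intro mult_mono) auto
      qed (use K in auto)
      also have "\<dots> = K * r\<^sup>2 * (\<Sum>j\<in>UNIV. \<Sum>k\<in>UNIV. 1 + \<bar>\<psi>2 F \<phi> j k x\<bar>)"
        by (simp only: sum_distrib_left mult.assoc)
      finally show "\<bar>\<psi> F \<phi> y - \<psi> F \<phi> (diag x) - (\<Sum>j\<in>UNIV. (y $ j - x) * \<psi>1 F \<phi> j x)\<bar>
          \<le> K * r\<^sup>2 * (\<Sum>j\<in>UNIV. \<Sum>k\<in>UNIV. 1 + \<bar>\<psi>2 F \<phi> j k x\<bar>)" .
    qed
    moreover have "K \<ge> 0" "\<delta> / ?d > 0" using K \<delta> d by auto
    ultimately show "\<exists>K\<ge>0. \<exists>\<delta>>0. taylor_bound (\<psi> F \<phi>) (\<psi>1 F \<phi>) (\<lambda>x. \<Sum>j\<in>UNIV. \<Sum>k\<in>UNIV. 1 + \<bar>\<psi>2 F \<phi> j k x\<bar>) M K \<delta>"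
      by blast
  qed
qed

lemma unit_weight_lipschitz:
  fixes x y :: real
  assumes "0 \<le> x" "x \<le> 1" "0 \<le> y" "y \<le> 1"
  shows "\<bar>y * (1 - y) - x * (1 - x)\<bar> \<le> \<bar>y - x\<bar>"
proof -
  have "y * (1 - y) - x * (1 - x) = (y - x) * (1 - x - y)" by (simp add: algebra_simps)
  then have "\<bar>y * (1 - y) - x * (1 - x)\<bar> = \<bar>y - x\<bar> * \<bar>1 - x - y\<bar>" by (simp add: abs_mult)
  also have "\<dots> \<le> \<bar>y - x\<bar> * 1" using assms by (intro mult_left_mono) auto
  finally show ?thesis by simp
qed

text \<open>Points within half the weight \<open>x (1 - x)\<close> have comparable weights, so one
  pair of constants serves all expansions at small displacements, uniformly up to the ends of the
  unit interval.\<close>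

lemma taylor_diag_local:
  fixes f :: "real ^ 'd \<Rightarrow> real"
  assumes f: "taylor_diag f p q"
  obtains K \<delta> where "K \<ge> 0" "\<delta> > 0"
    "\<And>x y r. \<lbrakk>0 < x; x < 1; \<And>j. 0 < y $ j; \<And>j. y $ j < 1; \<And>j. \<bar>y $ j - x\<bar> \<le> r; r < \<delta>; 2 * r \<le> x * (1 - x)\<rbrakk>
       \<Longrightarrow> \<bar>f y - f (diag x) - (\<Sum>j\<in>UNIV. (y $ j - x) * p j x)\<bar> \<le> K * r\<^sup>2 * q x"
proof -
  obtain M0 where M0: "\<And>M. M \<ge> M0 \<Longrightarrow> \<exists>K\<ge>0. \<exists>\<delta>>0. taylor_bound f p q M K \<delta>"
    using f unfolding taylor_diag_def by blast
  define M where "M = max M0 4"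
  obtain K \<delta> where K: "K \<ge> 0" and \<delta>: "\<delta> > 0" and bound: "taylor_bound f p q M K \<delta>"
    using M0[of M] unfolding M_def by auto
  have "\<bar>f y - f (diag x) - (\<Sum>j\<in>UNIV. (y $ j - x) * p j x)\<bar> \<le> K * r\<^sup>2 * q x"
    if "0 < x" "x < 1" "\<And>j. 0 < y $ j" "\<And>j. y $ j < 1" "\<And>j. \<bar>y $ j - x\<bar> \<le> r" "r < \<delta>" "2 * r \<le> x * (1 - x)" for x y r
  proof (rule bound[unfolded taylor_bound_def, rule_format], intro conjI allI)
    fix j
    have pos: "0 < y $ j * (1 - y $ j)" using that by simp
    have "\<bar>y $ j * (1 - y $ j) - x * (1 - x)\<bar> \<le> \<bar>y $ j - x\<bar>"
      using that(1-4) by (intro unit_weight_lipschitz) (auto intro: less_imp_le)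
    then have "x * (1 - x) - y $ j * (1 - y $ j) \<le> r" using that(5)[of j] by linarith
    then have "x * (1 - x) \<le> 2 * (y $ j * (1 - y $ j))" using that(7) by linarith
    also have "\<dots> < 4 * (y $ j * (1 - y $ j))" using pos by linarith
    also have "\<dots> \<le> M * (y $ j * (1 - y $ j))" using pos unfolding M_def by (intro mult_right_mono) auto
    finally show "x * (1 - x) < M * (y $ j * (1 - y $ j))" .
  qed (use that in auto)
  with K \<delta> show thesis by (rule that)
qed

text \<open>The point \<open>diag z + h e\<^sub>j\<close> with \<open>h = \<bar>z - x\<bar>\<close>
  can be expanded from \<open>x\<close> and from \<open>z\<close>. The two values differ by
  \<open>h\<close> times the difference of the partials, up to errors of order
  \<open>h\<^sup>2\<close>.\<close>

lemma taylor_diag_partials_local: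
  fixes f :: "real ^ 'd \<Rightarrow> real"
  assumes f: "taylor_diag f p q" and q: "\<And>x. q x \<ge> 0"
  obtains K \<delta> where "K \<ge> 0" "\<delta> > 0"
    "\<And>j x z. \<lbrakk>0 < x; x < 1; 0 < z; z < 1; \<bar>z - x\<bar> < \<delta>; 4 * \<bar>z - x\<bar> \<le> x * (1 - x); 4 * \<bar>z - x\<bar> \<le> z * (1 - z)\<rbrakk>
       \<Longrightarrow> \<bar>p j z - p j x\<bar> \<le> K * \<bar>z - x\<bar> * (q x + q z)"
proof (rule taylor_diag_local[OF f])
  fix K \<delta> :: real
  assume K: "K \<ge> 0" and \<delta>: "\<delta> > 0" and *:
    "\<And>x y r. \<lbrakk>0 < x; x < 1; \<And>j. 0 < y $ j; \<And>j. y $ j < 1; \<And>j. \<bar>y $ j - x\<bar> \<le> r; r < \<delta>; 2 * r \<le> x * (1 - x)\<rbrakk>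
       \<Longrightarrow> \<bar>f y - f (diag x) - (\<Sum>j\<in>UNIV. (y $ j - x) * p j x)\<bar> \<le> K * r\<^sup>2 * q x"
  show thesis
  proof (rule that[of "5 * K" "\<delta> / 2"])
    fix j x z assume x: "0 < x" "x < 1" and z: "0 < z" "z < 1" and h: "\<bar>z - x\<bar> < \<delta> / 2"
      and hx: "4 * \<bar>z - x\<bar> \<le> x * (1 - x)" and hz: "4 * \<bar>z - x\<bar> \<le> z * (1 - z)"
    define h where "h = \<bar>z - x\<bar>"
    have h0: "h \<ge> 0" by (simp add: h_def)
    have "4 * h \<le> x * (1 - x)" "4 * h \<le> z * (1 - z)" using hx hz unfolding h_def .
    with h0 have hx2: "2 * h \<le> x * (1 - x)" and hz2: "2 * h \<le> z * (1 - z)" by linarith+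
    \<comment> \<open>The displacements from \<open>x\<close> are at most \<open>2 h\<close>, those from \<open>z\<close> at most \<open>h\<close>: \<open>4 + 1\<close> squares at \<open>x\<close>, one at \<open>z\<close>.\<close>
    define y :: "real ^ 'd" where "y = (\<chi> k. if k = j then z + h else z)"
    have "z * (1 - z) \<le> 1 - z" using z by (simp add: mult_left_le_one_le)
    then have "4 * h \<le> 1 - z" using hz unfolding h_def by (rule order_trans[rotated])
    then have zh: "z + h < 1" using z h0 by linarith
    have sx: "(\<Sum>k\<in>UNIV. (y $ k - x) * p k x) = (\<Sum>k\<in>UNIV. (z - x) * p k x) + h * p j x"
    proof -
      have "(\<Sum>k\<in>UNIV. (y $ k - x) * p k x) = (\<Sum>k\<in>UNIV. (z - x) * p k x + (if k = j then h * p k x else 0))"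
        by (intro sum.cong) (auto simp: y_def algebra_simps)
      then show ?thesis by (simp add: sum.distrib)
    qed
    have sz: "(\<Sum>k\<in>UNIV. (y $ k - z) * p k z) = h * p j z"
    proof -
      have "(\<Sum>k\<in>UNIV. (y $ k - z) * p k z) = (\<Sum>k\<in>UNIV. (if k = j then h * p k z else 0))"
        by (intro sum.cong) (auto simp: y_def algebra_simps)
      then show ?thesis by simp
    qed
    have 1: "\<bar>f y - f (diag x) - (\<Sum>k\<in>UNIV. (y $ k - x) * p k x)\<bar> \<le> K * (2 * h)\<^sup>2 * q x"
    proof (rule *)
      show "\<bar>y $ k - x\<bar> \<le> 2 * h" for k unfolding y_def h_def by auto
    qed (use x z zh h0 h hx h_def in \<open>auto simp: y_def\<close>)
    have 2: "\<bar>f (diag z) - f (diag x) - (\<Sum>k\<in>UNIV. (diag z $ k - x) * p k x)\<bar> \<le> K * h\<^sup>2 * q x"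
      by (rule *) (use x z h0 h hx2 h_def \<delta> in \<open>auto simp: diag_def\<close>)
    have 3: "\<bar>f y - f (diag z) - (\<Sum>k\<in>UNIV. (y $ k - z) * p k z)\<bar> \<le> K * h\<^sup>2 * q z"
      by (rule *) (use x z zh h0 h hz2 h_def \<delta> in \<open>auto simp: y_def\<close>)
    have "(\<Sum>k\<in>UNIV. (diag z $ k - x) * p k x) = (\<Sum>k\<in>UNIV. (z - x) * p k x)" by (simp add: diag_def)
    then have "\<bar>h * p j z - h * p j x\<bar> \<le> K * (2 * h)\<^sup>2 * q x + K * h\<^sup>2 * q x + K * h\<^sup>2 * q z"
      using 1 2 3 unfolding sx sz by linarith
    also have "\<dots> = h * (K * h * (5 * q x + q z))" by (simp add: power2_eq_square algebra_simps)
    also have "\<dots> \<le> h * (K * h * (5 * (q x + q z)))"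
      using q[of z] K h0 by (intro mult_left_mono) auto
    finally have "h * \<bar>p j z - p j x\<bar> \<le> h * (5 * K * h * (q x + q z))"
      using h0 by (simp add: abs_mult right_diff_distrib[symmetric] mult_ac)
    then show "\<bar>p j z - p j x\<bar> \<le> 5 * K * \<bar>z - x\<bar> * (q x + q z)"
      by (cases "h = 0") (use h0 h_def in auto)
  qed (use K \<delta> in auto)
qed

section \<open>Absolutely continuous partial derivatives and the additive remainder\<close>

text \<open>The factor 2 leaves room for a strict inequality, so that no case of equality has to be
  excluded.\<close>

lemma exists_le_twice_average:
  fixes q :: "real \<Rightarrow> real"
  assumes "a < b" and int: "q integrable_on {a..b}" and q: "\<And>x. q x \<ge> 1"
  obtains x where "a \<le> x" "x \<le> b" "(b - a) * q x \<le> 2 * integral {a..b} q"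
proof (rule ccontr)
  assume "\<not> thesis"
  with that have *: "(b - a) * q x > 2 * integral {a..b} q" if "x \<in> {a..b}" for x using that by force
  let ?I = "integral {a..b} q"
  have "((\<lambda>x. 2 * ?I) has_integral (b - a) * (2 * ?I)) {a..b}"
    using has_integral_const_real[of "2 * ?I" a b] \<open>a < b\<close> by simp
  moreover have "((\<lambda>x. (b - a) * q x) has_integral (b - a) * ?I) {a..b}"
    by (intro has_integral_mult_right integrable_integral int)
  ultimately have 1: "(b - a) * (2 * ?I) \<le> (b - a) * ?I"
    by (rule has_integral_le) (use * in \<open>auto intro: less_imp_le\<close>)
  have "((\<lambda>x. 1) has_integral (b - a)) {a..b}"
    using has_integral_const_real[of "1::real" a b] \<open>a < b\<close> by simp
  then have "b - a \<le> ?I"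
    by (rule has_integral_le[OF _ integrable_integral[OF int]]) (use q in auto)
  then have "0 < (b - a) * ?I" using \<open>a < b\<close> by simp
  then show False using 1 by linarith
qed

lemma integral_equidistant_cells:
  fixes q :: "real \<Rightarrow> real"
  assumes "h \<ge> 0" "q integrable_on {a..a + real n * h}"
  shows "integral {a..a + real n * h} q = (\<Sum>i<n. integral {a + real i * h..a + real (Suc i) * h} q)"
  using assms
proof (induction n)
  case (Suc n)
  have le: "a \<le> a + real n * h" "a + real n * h \<le> a + real (Suc n) * h" using Suc.prems by (auto simp: algebra_simps)
  have "q integrable_on {a..a + real n * h}"
    by (rule integrable_subinterval_real[OF Suc.prems(2)]) (use le in auto)
  with Suc le Henstock_Kurzweil_Integration.integral_combine[OF le Suc.prems(2)] show ?case by simp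
qed simp

text \<open>A function \<open>q\<close> that is only integrable may be large at given points, but
  every cell of a fine partition contains a point where it is at most twice its mean. Chaining the
  local bound through these points gives a Riemann-type sum below the integral; the end points
  contribute terms that vanish with the mesh.\<close>

lemma increment_le_integral_of_local_bound:
  fixes g q :: "real \<Rightarrow> real"
  assumes ab: "a \<le> b" and int: "q integrable_on {a..b}" and q: "\<And>x. q x \<ge> 1"
    and K: "K \<ge> 0" and \<eta>: "\<eta> > 0"
    and loc: "\<And>x z. \<lbrakk>x \<in> {a..b}; z \<in> {a..b}; \<bar>z - x\<bar> < \<eta>\<rbrakk> \<Longrightarrow> \<bar>g z - g x\<bar> \<le> K * \<bar>z - x\<bar> * (q x + q z)"
  shows "\<bar>g b - g a\<bar> \<le> 8 * K * integral {a..b} q"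
proof (cases "a = b")
  case False
  with ab have ab: "a < b" by simp
  have fin: "\<bar>g b - g a\<bar> \<le> 8 * K * integral {a..b} q + 2 * K * ((b - a) / real n) * (q a + q b)"
    if n: "n > 0" "2 * ((b - a) / real n) < \<eta>" for n
  proof -
    define h where "h = (b - a) / real n"
    have h: "h > 0" "a + real n * h = b" using ab n by (auto simp: h_def)
    have cell: "a \<le> a + real i * h" "a + real (Suc i) * h \<le> b" if "i < n" for i
    proof -
      have "real (Suc i) * h \<le> real n * h" using that h by (intro mult_right_mono) auto
      then show "a + real (Suc i) * h \<le> b" using h(2) by linarith
    qed (use h in simp)
    have "\<exists>x. a + real i * h \<le> x \<and> x \<le> a + real (Suc i) * h \<and>
        h * q x \<le> 2 * integral {a + real i * h..a + real (Suc i) * h} q" if "i < n" for i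
    proof -
      have "a + real i * h < a + real (Suc i) * h" using h by (simp add: algebra_simps)
      moreover have "q integrable_on {a + real i * h..a + real (Suc i) * h}"
        by (rule integrable_subinterval_real[OF int]) (use cell[OF that] in auto)
      ultimately obtain x where "a + real i * h \<le> x" "x \<le> a + real (Suc i) * h"
        "(a + real (Suc i) * h - (a + real i * h)) * q x \<le> 2 * integral {a + real i * h..a + real (Suc i) * h} q"
        by (rule exists_le_twice_average[where q = q]) (use q in auto)
      moreover have "a + real (Suc i) * h - (a + real i * h) = h" by (simp add: algebra_simps)
      ultimately show ?thesis by (intro exI[of _ x]) simp
    qed
    then have "\<forall>i\<in>{..<n}. \<exists>x. a + real i * h \<le> x \<and> x \<le> a + real (Suc i) * h \<and>
        h * q x \<le> 2 * integral {a + real i * h..a + real (Suc i) * h} q" by blast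
    from bchoice[OF this] obtain X where X: "\<And>i. i < n \<Longrightarrow> a + real i * h \<le> X i"
      "\<And>i. i < n \<Longrightarrow> X i \<le> a + real (Suc i) * h"
      "\<And>i. i < n \<Longrightarrow> h * q (X i) \<le> 2 * integral {a + real i * h..a + real (Suc i) * h} q"
      by blast
    \<comment> \<open>The chain \<open>a, X 0, \<dots>, X (n - 1), b\<close> has steps of length at most \<open>2 h\<close>.\<close>
    define t where "t i = (if i = 0 then a else if i \<le> n then X (i - 1) else b)" for i
    have t_in: "t i \<in> {a..b}" for i
    proof (cases "0 < i \<and> i \<le> n")
      case True
      then have i: "i - 1 < n" by linarith
      show ?thesis using X(1,2)[OF i] cell[OF i] True unfolding t_def by simp
    qed (use ab in \<open>auto simp: t_def\<close>)
    have t_step: "\<bar>t (Suc i) - t i\<bar> \<le> 2 * h" if "i \<le> n" for i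
    proof -
      consider "i = 0" | "0 < i" "i < n" | "i = n" using \<open>i \<le> n\<close> by linarith
      then show ?thesis
      proof cases
        case 1 then have "t (Suc i) = X 0" "t i = a" using n by (simp_all add: t_def)
        then show ?thesis using X(1,2)[of 0] n h(1) unfolding abs_le_iff by simp
      next
        case 2
        then have e: "real (i - 1) = real i - 1" by (simp add: of_nat_diff)
        have "a + real (i - 1) * h \<le> X (i - 1)" "X (i - 1) \<le> a + real i * h" using X(1,2)[of "i - 1"] 2 by auto
        moreover have "a + real i * h \<le> X i" "X i \<le> a + real (Suc i) * h" using X(1,2)[of i] 2 by auto
        moreover have "real (i - 1) * h = real i * h - h" "real (Suc i) * h = real i * h + h"
          unfolding e by (simp_all add: algebra_simps)
        moreover have "t (Suc i) = X i" "t i = X (i - 1)" using 2 by (simp_all add: t_def)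
        ultimately show ?thesis using h(1) unfolding abs_le_iff by linarith
      next
        case 3
        then have e: "real (n - 1) = real n - 1" using n by (simp add: of_nat_diff)
        have "a + real (n - 1) * h \<le> X (n - 1)" "X (n - 1) \<le> b" using X(1,2)[of "n - 1"] cell[of "n - 1"] n by auto
        moreover have "b = a + real (n - 1) * h + h" unfolding e h(2)[symmetric] by (simp add: algebra_simps)
        moreover have "t (Suc i) = b" "t i = X (n - 1)" using 3 n by (simp_all add: t_def)
        ultimately show ?thesis using h(1) unfolding abs_le_iff by linarith
      qed
    qed
    have "g b - g a = (\<Sum>i<Suc n. g (t (Suc i)) - g (t i))"
      by (subst sum_lessThan_telescope) (simp add: t_def)
    then have "\<bar>g b - g a\<bar> \<le> (\<Sum>i<Suc n. \<bar>g (t (Suc i)) - g (t i)\<bar>)" by (simp only: sum_abs)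
    also have "\<dots> \<le> (\<Sum>i<Suc n. K * (2 * h) * (q (t i) + q (t (Suc i))))"
    proof (rule sum_mono)
      fix i assume "i \<in> {..<Suc n}"
      then have s: "\<bar>t (Suc i) - t i\<bar> \<le> 2 * h" using t_step by simp
      have "\<bar>g (t (Suc i)) - g (t i)\<bar> \<le> K * \<bar>t (Suc i) - t i\<bar> * (q (t i) + q (t (Suc i)))"
        using loc[OF t_in[of i] t_in[of "Suc i"] order_le_less_trans[OF s]] n(2) unfolding h_def by simp
      also have "\<dots> \<le> K * (2 * h) * (q (t i) + q (t (Suc i)))"
        using s K q[of "t i"] q[of "t (Suc i)"] by (intro mult_right_mono mult_left_mono) auto
      finally show "\<bar>g (t (Suc i)) - g (t i)\<bar> \<le> K * (2 * h) * (q (t i) + q (t (Suc i)))" .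
    qed
    also have "\<dots> = K * (2 * h) * ((\<Sum>i<Suc n. q (t i)) + (\<Sum>i<Suc n. q (t (Suc i))))"
      by (simp only: sum_distrib_left[symmetric] sum.distrib)
    also have "(\<Sum>i<Suc n. q (t i)) = q a + (\<Sum>i<n. q (X i))"
      by (subst sum.lessThan_Suc_shift) (simp add: t_def)
    also have "(\<Sum>i<Suc n. q (t (Suc i))) = (\<Sum>i<n. q (X i)) + q b"
      by (simp add: t_def)
    also have "K * (2 * h) * (q a + (\<Sum>i<n. q (X i)) + ((\<Sum>i<n. q (X i)) + q b))
      = 2 * K * h * (q a + q b) + 4 * K * (\<Sum>i<n. h * q (X i))"
      by (simp add: sum_distrib_left[symmetric] algebra_simps)
    also have "\<dots> \<le> 2 * K * h * (q a + q b) + 4 * K * (\<Sum>i<n. 2 * integral {a + real i * h..a + real (Suc i) * h} q)"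
      using X(3) K by (intro add_left_mono mult_left_mono sum_mono) auto
    also have "(\<Sum>i<n. 2 * integral {a + real i * h..a + real (Suc i) * h} q) = 2 * integral {a..b} q"
      using integral_equidistant_cells[of h q a n] int h by (simp add: sum_distrib_left)
    finally show ?thesis by (simp add: h_def)
  qed
  have lim: "(\<lambda>n. 8 * K * integral {a..b} q + 2 * K * ((b - a) / real n) * (q a + q b))
      \<longlonglongrightarrow> 8 * K * integral {a..b} q + 2 * K * 0 * (q a + q b)"
    by (intro tendsto_intros lim_const_over_n)
  have "(\<lambda>n. 2 * ((b - a) / real n)) \<longlonglongrightarrow> 2 * 0" by (intro tendsto_intros lim_const_over_n)
  then have "eventually (\<lambda>n. 2 * ((b - a) / real n) < \<eta>) sequentially"
    by (rule order_tendstoD) (use \<eta> in simp)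
  then have "eventually (\<lambda>n. \<bar>g b - g a\<bar> \<le> 8 * K * integral {a..b} q + 2 * K * ((b - a) / real n) * (q a + q b)) sequentially"
    using eventually_gt_at_top[of 0] by eventually_elim (rule fin)
  from tendsto_lowerbound[OF lim this] show ?thesis by simp
qed simp

text \<open>A bound that forces \<open>H\<close> to vanish on the diagonal, in terms of an interval
  \<open>[a, b]\<close> that contains all coordinates and on which the weight \<open>x (1 -
  x)\<close> varies by at most the factor \<open>M\<close>.\<close>

definition additive_remainder :: "(real ^ 'd \<Rightarrow> real) \<Rightarrow> (real \<Rightarrow> real) \<Rightarrow> real \<Rightarrow> real \<Rightarrow> real \<Rightarrow> bool" where
  "additive_remainder H q M K \<delta> \<longleftrightarrow> (\<forall>y a b.
     0 < a \<and> a \<le> b \<and> b < 1 \<and> b - a < \<delta> \<and> (\<forall>j. a \<le> y $ j \<and> y $ j \<le> b) \<and>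
     (\<forall>x\<in>{a..b}. \<forall>u\<in>{a..b}. x * (1 - x) < M * (u * (1 - u))) \<longrightarrow>
     \<bar>H y\<bar> \<le> K * (b - a) * integral {a..b} q)"

locale diagonal_expansion =
  fixes f :: "real ^ 'd::finite \<Rightarrow> real" and p :: "'d \<Rightarrow> real \<Rightarrow> real" and q :: "real \<Rightarrow> real"
  assumes taylor: "taylor_diag f p q"
    and q_ge_1: "\<And>x. q x \<ge> 1"
    and q_integrable: "\<And>a b. 0 < a \<Longrightarrow> b < 1 \<Longrightarrow> q integrable_on {a..b}"
begin

lemma q_nonneg: "0 \<le> q x"
  using q_ge_1[of x] by linarith

lemma q_integral_nonneg: "0 < a \<Longrightarrow> b < 1 \<Longrightarrow> 0 \<le> integral {a..b} q"
  by (intro integral_nonneg q_integrable q_nonneg)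

lemma q_integral_mono: "0 < a \<Longrightarrow> b < 1 \<Longrightarrow> a \<le> a' \<Longrightarrow> b' \<le> b \<Longrightarrow> integral {a'..b'} q \<le> integral {a..b} q"
  by (intro integral_subset_le q_integrable) (auto intro: q_nonneg)

text \<open>The constant does not depend on the interval, which may come arbitrarily close to 0 and
  1.\<close>

lemma partials_increment:
  obtains K where "K \<ge> 0"
    "\<And>j a b. \<lbrakk>0 < a; a \<le> b; b < 1\<rbrakk> \<Longrightarrow> \<bar>p j b - p j a\<bar> \<le> K * integral {a..b} q"
proof -
  obtain K \<delta> where K: "K \<ge> 0" and \<delta>: "\<delta> > 0" and loc:
    "\<And>j x z. \<lbrakk>0 < x; x < 1; 0 < z; z < 1; \<bar>z - x\<bar> < \<delta>; 4 * \<bar>z - x\<bar> \<le> x * (1 - x); 4 * \<bar>z - x\<bar> \<le> z * (1 - z)\<rbrakk>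
       \<Longrightarrow> \<bar>p j z - p j x\<bar> \<le> K * \<bar>z - x\<bar> * (q x + q z)"
    using taylor_diag_partials_local[OF taylor q_nonneg] by metis
  show thesis
  proof (rule that[of "8 * K"])
    fix j :: 'd and a b :: real assume ab: "0 < a" "a \<le> b" "b < 1"
    define \<eta> where "\<eta> = min \<delta> (a * (1 - b) / 4)"
    show "\<bar>p j b - p j a\<bar> \<le> 8 * K * integral {a..b} q"
    proof (rule increment_le_integral_of_local_bound[where \<eta> = \<eta>])
      show "\<eta> > 0" using ab \<delta> by (simp add: \<eta>_def)
      fix x z assume x: "x \<in> {a..b}" and z: "z \<in> {a..b}" and xz: "\<bar>z - x\<bar> < \<eta>"
      have w: "a * (1 - b) \<le> u * (1 - u)" if "u \<in> {a..b}" for u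
        using that ab by (intro mult_mono) auto
      have "4 * \<bar>z - x\<bar> < a * (1 - b)" "\<bar>z - x\<bar> < \<delta>" using xz by (auto simp: \<eta>_def)
      with w[OF x] w[OF z] show "\<bar>p j z - p j x\<bar> \<le> K * \<bar>z - x\<bar> * (q x + q z)"
        using x z ab by (intro loc) (auto intro: less_imp_le order_trans)
    qed (use ab K q_ge_1 q_integrable in auto)
  qed (use K in auto)
qed

lemma continuous_partials: "continuous_on {0<..<1} (p j)"
proof -
  obtain K where K: "K \<ge> 0" and inc:
    "\<And>j a b. \<lbrakk>0 < a; a \<le> b; b < 1\<rbrakk> \<Longrightarrow> \<bar>p j b - p j a\<bar> \<le> K * integral {a..b} q"
    using partials_increment by metis
  have "isCont (p j) x" if x: "x \<in> {0<..<1}" for x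
  proof -
    define a b where "a = x / 2" and "b = (1 + x) / 2"
    have ab: "0 < a" "a < x" "x < b" "b < 1" using x by (auto simp: a_def b_def)
    define I where "I z = integral {a..z} q" for z
    have qi: "q integrable_on {a..b}" using ab by (intro q_integrable) auto
    have "continuous_on {a..b} I" unfolding I_def by (rule indefinite_integral_continuous_1[OF qi])
    then have I: "isCont I x" using ab continuous_on_interior[of "{a..b}" I x] by simp
    have bound: "\<bar>p j z - p j x\<bar> \<le> K * \<bar>I z - I x\<bar>" if z: "a < z" "z < b" for z
    proof -
      have *: "\<bar>p j v - p j u\<bar> \<le> K * \<bar>I v - I u\<bar>" if "a < u" "u \<le> v" "v < b" for u v
      proof -
        have "I v = I u + integral {u..v} q" unfolding I_def
          using that by (intro Henstock_Kurzweil_Integration.integral_combine[symmetric] integrable_subinterval_real[OF qi]) auto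
        moreover have "\<bar>p j v - p j u\<bar> \<le> K * integral {u..v} q" using that ab by (intro inc) auto
        moreover have "integral {u..v} q \<ge> 0" using that ab by (intro q_integral_nonneg) auto
        ultimately show ?thesis by simp
      qed
      show ?thesis
        using *[of x z] *[of z x] z ab by (cases "x \<le> z") (auto simp: abs_minus_commute)
    qed
    have "((\<lambda>z. K * \<bar>I z - I x\<bar>) \<longlongrightarrow> K * \<bar>I x - I x\<bar>) (at x)"
      using I unfolding isCont_def by (intro tendsto_intros)
    then have lim: "((\<lambda>z. K * \<bar>I z - I x\<bar>) \<longlongrightarrow> 0) (at x)" by simp
    have "((\<lambda>z. p j z - p j x) \<longlongrightarrow> 0) (at x)"
    proof (rule Lim_null_comparison[OF _ lim])
      have "eventually (\<lambda>z. z \<in> {a<..<b}) (nhds x)" using ab by (intro eventually_nhds_in_open) auto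
      then show "eventually (\<lambda>z. norm (p j z - p j x) \<le> K * \<bar>I z - I x\<bar>) (at x)"
        unfolding eventually_at_filter by (rule eventually_mono) (use bound in auto)
    qed
    then show ?thesis unfolding isCont_def by (rule LIM_zero_cancel)
  qed
  then show ?thesis by (simp add: continuous_at_imp_continuous_on)
qed

lemma partials_integrable: "0 < a \<Longrightarrow> b < 1 \<Longrightarrow> p j integrable_on {a..b}"
  by (intro integrable_continuous_interval continuous_on_subset[OF continuous_partials]) auto

lemma diagonal_derivative:
  assumes x: "0 < x" "x < 1"
  shows "((\<lambda>x. f (diag x)) has_real_derivative (\<Sum>j\<in>UNIV. p j x)) (at x)"
proof (rule taylor_diag_local[OF taylor])
  fix K \<delta> :: real
  assume K: "K \<ge> 0" and \<delta>: "\<delta> > 0" and *: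
    "\<And>x y r. \<lbrakk>0 < x; x < 1; \<And>j. 0 < y $ j; \<And>j. y $ j < 1; \<And>j. \<bar>y $ j - x\<bar> \<le> r; r < \<delta>; 2 * r \<le> x * (1 - x)\<rbrakk>
       \<Longrightarrow> \<bar>f y - f (diag x) - (\<Sum>j\<in>UNIV. (y $ j - x) * p j x)\<bar> \<le> K * r\<^sup>2 * q x"
  define D where "D = (\<Sum>j\<in>UNIV. p j x)"
  have w: "0 < x * (1 - x)" using x by simp
  define S where "S = {0<..<1} \<inter> ball x (min \<delta> (x * (1 - x) / 2))"
  have S: "open S" "x \<in> S" using x w \<delta> by (auto simp: S_def)
  have bound: "\<bar>(f (diag z) - f (diag x)) / (z - x) - D\<bar> \<le> K * \<bar>z - x\<bar> * q x" if z: "z \<in> S" "z \<noteq> x" for z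
  proof -
    have z': "0 < z" "z < 1" "\<bar>z - x\<bar> < \<delta>" "\<bar>z - x\<bar> < x * (1 - x) / 2"
      using z by (auto simp: S_def dist_real_def abs_minus_commute)
    have "\<bar>f (diag z) - f (diag x) - (\<Sum>j\<in>UNIV. (diag z $ j - x) * p j x)\<bar> \<le> K * \<bar>z - x\<bar>\<^sup>2 * q x"
      by (rule *) (use x z' in \<open>auto simp: diag_def\<close>)
    also have "(\<Sum>j\<in>UNIV. (diag z $ j - x) * p j x) = (z - x) * D"
      by (simp add: diag_def D_def sum_distrib_left)
    also have "f (diag z) - f (diag x) - (z - x) * D = (z - x) * ((f (diag z) - f (diag x)) / (z - x) - D)"
    proof -
      have "(z - x) * ((f (diag z) - f (diag x)) / (z - x)) = f (diag z) - f (diag x)" using z by simp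
      then show ?thesis by (simp only: right_diff_distrib[of "z - x" _ D])
    qed
    also have "K * \<bar>z - x\<bar>\<^sup>2 * q x = \<bar>z - x\<bar> * (K * \<bar>z - x\<bar> * q x)"
      by (simp only: power2_eq_square mult_ac)
    finally have "\<bar>z - x\<bar> * \<bar>(f (diag z) - f (diag x)) / (z - x) - D\<bar> \<le> \<bar>z - x\<bar> * (K * \<bar>z - x\<bar> * q x)"
      by (simp only: abs_mult)
    then show ?thesis using z by simp
  qed
  have "((\<lambda>z. K * \<bar>z - x\<bar> * q x) \<longlongrightarrow> K * \<bar>x - x\<bar> * q x) (at x)" by (intro tendsto_intros)
  then have lim: "((\<lambda>z. K * \<bar>z - x\<bar> * q x) \<longlongrightarrow> 0) (at x)" by simp
  have "((\<lambda>z. (f (diag z) - f (diag x)) / (z - x) - D) \<longlongrightarrow> 0) (at x)"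
  proof (rule Lim_null_comparison[OF _ lim])
    have "eventually (\<lambda>z. z \<in> S) (nhds x)" using S by (intro eventually_nhds_in_open)
    then show "eventually (\<lambda>z. norm ((f (diag z) - f (diag x)) / (z - x) - D) \<le> K * \<bar>z - x\<bar> * q x) (at x)"
      unfolding eventually_at_filter by (rule eventually_mono) (use bound in auto)
  qed
  then show ?thesis unfolding D_def[symmetric] has_field_derivative_iff by (rule LIM_zero_cancel)
qed

end

locale diagonal_primitives = diagonal_expansion f p q
  for f :: "real ^ 'd::finite \<Rightarrow> real" and p q +
  fixes V :: "'d \<Rightarrow> real \<Rightarrow> real"
  assumes primitive: "\<And>j a b. 0 < a \<Longrightarrow> a \<le> b \<Longrightarrow> b < 1 \<Longrightarrow> V j b - V j a = integral {a..b} (p j)"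
begin

text \<open>On the diagonal the derivative of \<open>f\<close> is the sum of its partials.\<close>

lemma diagonal_eq_sum_primitives:
  obtains c where "\<And>x. 0 < x \<Longrightarrow> x < 1 \<Longrightarrow> f (diag x) = c + (\<Sum>j\<in>UNIV. V j x)"
proof
  define c where "c = f (diag (1 / 2)) - (\<Sum>j\<in>UNIV. V j (1 / 2))"
  have inc: "f (diag b) - f (diag a) = (\<Sum>j\<in>UNIV. V j b) - (\<Sum>j\<in>UNIV. V j a)" if ab: "0 < a" "a \<le> b" "b < 1" for a b
  proof -
    have "((\<lambda>x. \<Sum>j\<in>UNIV. p j x) has_integral f (diag b) - f (diag a)) {a..b}"
    proof (rule fundamental_theorem_of_calculus)
      fix x assume "x \<in> {a..b}"
      then have "((\<lambda>x. f (diag x)) has_real_derivative (\<Sum>j\<in>UNIV. p j x)) (at x)"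
        using ab by (intro diagonal_derivative) auto
      then show "((\<lambda>x. f (diag x)) has_vector_derivative (\<Sum>j\<in>UNIV. p j x)) (at x within {a..b})"
        unfolding has_real_derivative_iff_has_vector_derivative by (rule has_vector_derivative_at_within)
    qed (use ab in auto)
    moreover have "((\<lambda>x. \<Sum>j\<in>UNIV. p j x) has_integral (\<Sum>j\<in>UNIV. integral {a..b} (p j))) {a..b}"
      using ab by (intro has_integral_sum integrable_integral partials_integrable) auto
    ultimately have "f (diag b) - f (diag a) = (\<Sum>j\<in>UNIV. integral {a..b} (p j))"
      by (rule has_integral_unique)
    also have "\<dots> = (\<Sum>j\<in>UNIV. V j b - V j a)" using ab primitive by (intro sum.cong) auto
    finally show ?thesis by (simp add: sum_subtractf)
  qed
  fix x :: real assume x: "0 < x" "x < 1"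
  show "f (diag x) = c + (\<Sum>j\<in>UNIV. V j x)"
    using inc[of x "1 / 2"] inc[of "1 / 2" x] x unfolding c_def by (cases "x \<le> 1 / 2") auto
qed

text \<open>Both the expansion of \<open>f\<close> and the linear approximations of the primitives
  are taken at a point \<open>x\<close> of \<open>[a, b]\<close> where \<open>q\<close> is at most
  twice its mean; this converts the pointwise factor \<open>q x\<close> into the integral of
  \<open>q\<close>.\<close>

lemma additive_remainder_bound:
  assumes c: "\<And>x. 0 < x \<Longrightarrow> x < 1 \<Longrightarrow> f (diag x) = c + (\<Sum>j\<in>UNIV. V j x)"
  shows "\<exists>M\<^sub>0. \<forall>M\<ge>M\<^sub>0. \<exists>K\<ge>0. \<exists>\<delta>>0. additive_remainder (\<lambda>y. f y - c - (\<Sum>j\<in>UNIV. V j (y $ j))) q M K \<delta>"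
proof -
  obtain M0 where M0: "\<And>M. M \<ge> M0 \<Longrightarrow> \<exists>K\<ge>0. \<exists>\<delta>>0. taylor_bound f p q M K \<delta>"
    using taylor unfolding taylor_diag_def by blast
  obtain C where C: "C \<ge> 0" and inc:
    "\<And>j a b. \<lbrakk>0 < a; a \<le> b; b < 1\<rbrakk> \<Longrightarrow> \<bar>p j b - p j a\<bar> \<le> C * integral {a..b} q"
    using partials_increment by metis
  show ?thesis
  proof (rule exI[of _ M0], intro allI impI)
    fix M :: real assume "M \<ge> M0"
    from M0[OF this] obtain K \<delta> where K: "K \<ge> 0" and \<delta>: "\<delta> > 0" and *: "taylor_bound f p q M K \<delta>"
      by blast
    define K' where "K' = 2 * K + real CARD('d) * C"
    have main: "\<bar>f y - c - (\<Sum>j\<in>UNIV. V j (y $ j))\<bar> \<le> K' * (b - a) * integral {a..b} q"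
      if ab: "0 < a" "a \<le> b" "b < 1" "b - a < \<delta>" and y: "\<And>j. a \<le> y $ j" "\<And>j. y $ j \<le> b"
        and w: "\<And>x u. x \<in> {a..b} \<Longrightarrow> u \<in> {a..b} \<Longrightarrow> x * (1 - x) < M * (u * (1 - u))" for y a b
    proof (cases "a = b")
      case True
      then have "y = diag a" using y by (auto simp: vec_eq_iff diag_def intro: antisym)
      then show ?thesis using c[of a] ab True by (simp add: diag_def)
    next
      case False
      with ab have "a < b" by simp
      have qi: "q integrable_on {a..b}" using ab by (intro q_integrable) auto
      obtain x where x: "a \<le> x" "x \<le> b" and qx: "(b - a) * q x \<le> 2 * integral {a..b} q"
        using exists_le_twice_average[OF \<open>a < b\<close> qi q_ge_1] by metis
      have x01: "0 < x" "x < 1" using x ab by auto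
      let ?I = "integral {a..b} q"
      have I0: "?I \<ge> 0" using ab by (intro q_integral_nonneg) auto
      have "\<bar>f y - f (diag x) - (\<Sum>j\<in>UNIV. (y $ j - x) * p j x)\<bar> \<le> K * (b - a)\<^sup>2 * q x"
      proof (rule *[unfolded taylor_bound_def, rule_format], intro conjI allI)
        fix j
        show "0 < y $ j" "y $ j < 1" using y[of j] ab by auto
        show "\<bar>y $ j - x\<bar> \<le> b - a" using y[of j] x by auto
        show "x * (1 - x) < M * (y $ j * (1 - y $ j))" using y[of j] x by (intro w) auto
      qed (use ab x01 in auto)
      also have "K * (b - a)\<^sup>2 * q x = K * (b - a) * ((b - a) * q x)" by (simp add: power2_eq_square)
      also have "\<dots> \<le> K * (b - a) * (2 * ?I)" using qx K ab by (intro mult_left_mono) auto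
      finally have 1: "\<bar>f y - f (diag x) - (\<Sum>j\<in>UNIV. (y $ j - x) * p j x)\<bar> \<le> 2 * K * (b - a) * ?I" by simp
      have lin: "\<bar>V j v - V j u - (v - u) * p j x\<bar> \<le> (b - a) * (C * ?I)"
        if uv: "a \<le> u" "u \<le> v" "v \<le> b" "x = u \<or> x = v" for j u v
      proof -
        have "((\<lambda>t. p j t - p j x) has_integral (integral {u..v} (p j) - (v - u) * p j x)) {u..v}"
          using has_integral_diff[OF integrable_integral[OF partials_integrable] has_integral_const_real[of "p j x"], of u v j] ab uv
          by simp
        then have i: "((\<lambda>t. p j t - p j x) has_integral (V j v - V j u - (v - u) * p j x)) {u..v}"
          using primitive[of u v j] ab uv by simp
        have "norm (V j v - V j u - (v - u) * p j x) \<le> (C * ?I) * measure lborel (cbox u v)"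
        proof (rule has_integral_bound[OF _ i[unfolded cbox_interval[symmetric]]])
          fix t assume t: "t \<in> cbox u v"
          have "\<bar>p j t - p j x\<bar> \<le> C * integral {min t x..max t x} q"
          proof (cases "x \<le> t")
            case True then show ?thesis using inc[of x t j] t uv ab by auto
          next
            case False then show ?thesis using inc[of t x j] t uv ab by (auto simp: abs_minus_commute)
          qed
          also have "\<dots> \<le> C * ?I"
            using t uv ab C by (intro mult_left_mono q_integral_mono) auto
          finally show "norm (p j t - p j x) \<le> C * ?I" by simp
        qed (use C I0 in auto)
        also have "\<dots> = (v - u) * (C * ?I)" using uv by simp
        also have "\<dots> \<le> (b - a) * (C * ?I)" using uv C I0 by (intro mult_right_mono) auto
        finally show ?thesis by simp
      qed
      have lin': "\<bar>V j (y $ j) - V j x - (y $ j - x) * p j x\<bar> \<le> (b - a) * (C * ?I)" for j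
      proof (cases "x \<le> y $ j")
        case True then show ?thesis using lin[of x "y $ j" j] x y[of j] by auto
      next
        case False
        have "V j x - V j (y $ j) - (x - y $ j) * p j x = - (V j (y $ j) - V j x - (y $ j - x) * p j x)"
          by (simp add: algebra_simps)
        with False show ?thesis using lin[of "y $ j" x j] x y[of j] by (metis abs_minus_cancel less_imp_le not_le)
      qed
      have "f y - c - (\<Sum>j\<in>UNIV. V j (y $ j)) =
          (f y - f (diag x) - (\<Sum>j\<in>UNIV. (y $ j - x) * p j x)) - (\<Sum>j\<in>UNIV. V j (y $ j) - V j x - (y $ j - x) * p j x)"
        using c[OF x01] by (simp add: sum_subtractf)
      then have "\<bar>f y - c - (\<Sum>j\<in>UNIV. V j (y $ j))\<bar> \<le>
          \<bar>f y - f (diag x) - (\<Sum>j\<in>UNIV. (y $ j - x) * p j x)\<bar> + \<bar>\<Sum>j\<in>UNIV. V j (y $ j) - V j x - (y $ j - x) * p j x\<bar>"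
        by simp
      also have "\<bar>\<Sum>j\<in>UNIV. V j (y $ j) - V j x - (y $ j - x) * p j x\<bar> \<le> (\<Sum>j\<in>(UNIV :: 'd set). (b - a) * (C * ?I))"
        by (rule order_trans[OF sum_abs sum_mono]) (rule lin')
      also have "\<dots> = real CARD('d) * C * (b - a) * ?I" by simp
      finally show ?thesis using 1 unfolding K'_def by (simp add: algebra_simps)
    qed
    have "additive_remainder (\<lambda>y. f y - c - (\<Sum>j\<in>UNIV. V j (y $ j))) q M K' \<delta>"
      unfolding additive_remainder_def by (intro allI impI main) auto
    moreover have "K' \<ge> 0" using K C by (simp add: K'_def)
    ultimately show "\<exists>K\<ge>0. \<exists>\<delta>>0. additive_remainder (\<lambda>y. f y - c - (\<Sum>j\<in>UNIV. V j (y $ j))) q M K \<delta>"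
      using \<delta> by blast
  qed
qed

end

section \<open>Order statistics and counts\<close>

lemma sorted_nth_le_iff_length_filter:
  assumes "sorted s" "i < length s"
  shows "s ! i \<le> c \<longleftrightarrow> i < length (filter (\<lambda>y. y \<le> c) s)"
proof -
  have eq: "length (filter (\<lambda>y. y \<le> c) s) = card {k. k < length s \<and> s ! k \<le> c}"
    by (simp add: length_filter_conv_card)
  show ?thesis
  proof
    assume c: "s ! i \<le> c"
    have "{..i} \<subseteq> {k. k < length s \<and> s ! k \<le> c}"
    proof
      fix k assume "k \<in> {..i}"
      then have "s ! k \<le> s ! i" "k < length s" using assms sorted_nth_mono[of s k i] by auto
      with c show "k \<in> {k. k < length s \<and> s ! k \<le> c}" by auto
    qed
    then have "card {..i} \<le> card {k. k < length s \<and> s ! k \<le> c}" by (intro card_mono) auto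
    then show "i < length (filter (\<lambda>y. y \<le> c) s)" unfolding eq by simp
  next
    assume i: "i < length (filter (\<lambda>y. y \<le> c) s)"
    show "s ! i \<le> c"
    proof (rule ccontr)
      assume c: "\<not> s ! i \<le> c"
      have "{k. k < length s \<and> s ! k \<le> c} \<subseteq> {..<i}"
      proof
        fix k assume k: "k \<in> {k. k < length s \<and> s ! k \<le> c}"
        show "k \<in> {..<i}"
        proof (rule ccontr)
          assume "k \<notin> {..<i}"
          then have "s ! i \<le> s ! k" using k assms by (intro sorted_nth_mono) auto
          with k c show False by auto
        qed
      qed
      then have "card {k. k < length s \<and> s ! k \<le> c} \<le> card {..<i}" by (intro card_mono) auto
      with i show False unfolding eq by simp
    qed
  qed
qed

lemma length_filter_sort: "length (filter P (sort xs)) = length (filter P xs)"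
proof -
  have "size (mset (filter P (sort xs))) = size (mset (filter P xs))"
    unfolding mset_filter mset_sort ..
  then show ?thesis unfolding size_mset .
qed

definition count_le :: "(nat \<Rightarrow> real) \<Rightarrow> nat \<Rightarrow> real \<Rightarrow> nat" where
  "count_le x n u = card {l. l < n \<and> x l \<le> u}"

lemma order_stat_le_iff:
  assumes "1 \<le> i" "i \<le> n"
  shows "order_stat x n i \<le> u \<longleftrightarrow> i \<le> count_le x n u"
proof -
  have "length (filter (\<lambda>y. y \<le> u) (map x [0..<n])) = count_le x n u"
    unfolding count_le_def length_filter_conv_card by (rule arg_cong[where f = card]) auto
  then show ?thesis
    using sorted_nth_le_iff_length_filter[of "sort (map x [0..<n])" "i - 1" u] assms
    unfolding order_stat_def by (auto simp: length_filter_sort)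
qed

lemma order_stat_in_range:
  assumes "1 \<le> i" "i \<le> n"
  shows "order_stat x n i \<in> x ` {..<n}"
proof -
  have "order_stat x n i \<in> set (sort (map x [0..<n]))"
    unfolding order_stat_def using assms by (intro nth_mem) auto
  then show ?thesis by auto
qed

text \<open>Sorting permutes the sample. This is what turns additive functions of order statistics
  into sums of independent terms.\<close>

lemma sum_order_stat:
  fixes g :: "real \<Rightarrow> real"
  shows "(\<Sum>i=1..n. g (order_stat x n i)) = (\<Sum>l<n. g (x l))"
proof -
  let ?s = "sort (map x [0..<n])"
  have "(\<Sum>i=1..n. g (order_stat x n i)) = (\<Sum>i<n. g (?s ! i))"
    unfolding order_stat_def
    by (rule sum.reindex_bij_witness[of _ "\<lambda>i. i + 1" "\<lambda>i. i - 1"]) auto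
  also have "\<dots> = sum_list (map g ?s)"
    by (simp add: sum_list_sum_nth atLeast0LessThan)
  also have "\<dots> = sum_mset (image_mset g (mset ?s))"
    by (simp only: mset_map[symmetric] sum_mset_sum_list)
  also have "\<dots> = sum_mset (image_mset g (mset (map x [0..<n])))" by simp
  also have "\<dots> = sum_list (map g (map x [0..<n]))"
    by (simp only: mset_map[symmetric] sum_mset_sum_list)
  also have "\<dots> = (\<Sum>l<n. g (x l))"
    by (simp add: sum_list_sum_nth atLeast0LessThan)
  finally show ?thesis .
qed

lemma sort_map_mono_on:
  assumes "mono_on S h" "set us \<subseteq> S"
  shows "sort (map h us) = map h (sort us)"
proof (rule properties_for_sort)
  show "mset (map h (sort us)) = mset (map h us)" by simp
  show "sorted (map h (sort us))"
    unfolding sorted_map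
    by (rule sorted_wrt_mono_rel[of _ "(\<le>)"]) (use assms in \<open>auto intro: mono_onD\<close>)
qed

lemma order_stat_mono_image:
  assumes "mono_on S h" "\<And>l. l < n \<Longrightarrow> u l \<in> S" "\<And>l. l < n \<Longrightarrow> x l = h (u l)" "1 \<le> i" "i \<le> n"
  shows "order_stat x n i = h (order_stat u n i)"
proof -
  have "map x [0..<n] = map h (map u [0..<n])" using assms(3) by simp
  moreover have "sort (map h (map u [0..<n])) = map h (sort (map u [0..<n]))"
    by (rule sort_map_mono_on[OF assms(1)]) (use assms(2) in auto)
  ultimately have "sort (map x [0..<n]) = map h (sort (map u [0..<n]))" by (simp only:)
  moreover have "i - 1 < length (sort (map u [0..<n]))" using assms(4,5) by simp
  ultimately show ?thesis unfolding order_stat_def by (simp only: nth_map)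
qed

lemma count_le_eq_sum_indicator: "real (count_le x n u) = (\<Sum>l<n. indicator {..u} (x l))"
proof -
  have "(\<Sum>l<n. indicator {..u} (x l)) = (\<Sum>l<n. if x l \<le> u then 1 else (0::real))"
    by (intro sum.cong) (auto simp: indicator_def)
  also have "\<dots> = real (card {l \<in> {..<n}. x l \<le> u})" by (simp add: sum.If_cases Int_def)
  finally show ?thesis by (simp add: count_le_def)
qed

lemma borel_measurable_order_stat:
  fixes X :: "nat \<Rightarrow> 'a \<Rightarrow> real"
  assumes [measurable]: "\<And>l. X l \<in> borel_measurable M" and i: "1 \<le> i" "i \<le> n"
  shows "(\<lambda>\<omega>. order_stat (\<lambda>l. X l \<omega>) n i) \<in> borel_measurable M"
proof (rule borel_measurableI_le)
  fix y
  have "{\<omega> \<in> space M. order_stat (\<lambda>l. X l \<omega>) n i \<le> y} =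
      {\<omega> \<in> space M. real i \<le> (\<Sum>l<n. indicator {..y} (X l \<omega>))}"
    by (simp only: order_stat_le_iff[OF i] count_le_eq_sum_indicator[symmetric] of_nat_le_iff)
  also have "\<dots> \<in> sets M" by measurable
  finally show "{\<omega> \<in> space M. order_stat (\<lambda>l. X l \<omega>) n i \<le> y} \<in> sets M" .
qed

text \<open>Summing over all pairs is a crude substitute for the difference between the largest and
  the smallest count, but behaves well under expectations.\<close>

definition count_spread :: "('d::finite \<Rightarrow> nat \<Rightarrow> real) \<Rightarrow> nat \<Rightarrow> real \<Rightarrow> real" where
  "count_spread x n u = (\<Sum>j\<in>UNIV. \<Sum>k\<in>UNIV. \<bar>real (count_le (x j) n u) - real (count_le (x k) n u)\<bar>)"

text \<open>An order statistic is at most \<open>u\<close> exactly when its rank is at most the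
  count up to \<open>u\<close>, so a separated rank lies between two of the counts.\<close>

lemma card_separated_ranks:
  fixes x :: "'d::finite \<Rightarrow> nat \<Rightarrow> real"
  shows "real (card {i \<in> {1..n}. (\<exists>j. order_stat (x j) n i \<le> u) \<and> (\<exists>k. u < order_stat (x k) n i)})
      \<le> count_spread x n u"
proof -
  let ?N = "\<lambda>j. count_le (x j) n u"
  let ?S = "{i \<in> {1..n}. (\<exists>j. order_stat (x j) n i \<le> u) \<and> (\<exists>k. u < order_stat (x k) n i)}"
  have "?S \<subseteq> (\<Union>j. \<Union>k. {?N k<..?N j})"
  proof
    fix i assume "i \<in> ?S"
    then obtain j k where i: "1 \<le> i" "i \<le> n" and "order_stat (x j) n i \<le> u" "\<not> order_stat (x k) n i \<le> u"
      by (auto simp: not_le)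
    then have "i \<in> {?N k<..?N j}" by (simp add: order_stat_le_iff[OF i])
    then show "i \<in> (\<Union>j. \<Union>k. {?N k<..?N j})" by blast
  qed
  then have "card ?S \<le> card (\<Union>j. \<Union>k. {?N k<..?N j})" by (intro card_mono) auto
  also have "\<dots> \<le> (\<Sum>j\<in>UNIV. card (\<Union>k. {?N k<..?N j}))" by (rule card_UN_le) simp
  also have "\<dots> \<le> (\<Sum>j\<in>UNIV. \<Sum>k\<in>UNIV. card {?N k<..?N j})" by (intro sum_mono card_UN_le) simp
  finally have "real (card ?S) \<le> (\<Sum>j\<in>UNIV. \<Sum>k\<in>UNIV. real (card {?N k<..?N j}))"
    unfolding of_nat_sum[symmetric] of_nat_le_iff .
  also have "\<dots> \<le> (\<Sum>j\<in>UNIV. \<Sum>k\<in>UNIV. \<bar>real (?N j) - real (?N k)\<bar>)"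
    by (intro sum_mono) auto
  finally show ?thesis unfolding count_spread_def .
qed

section \<open>Counts of independent events\<close>

context prob_space
begin

lemma second_moment_indep_sum:
  fixes Z :: "nat \<Rightarrow> 'a \<Rightarrow> real"
  assumes ind: "indep_vars (\<lambda>_. borel) Z UNIV"
    and sq: "\<And>l. integrable M (\<lambda>\<omega>. (Z l \<omega>)\<^sup>2)"
    and mean: "\<And>l. expectation (Z l) = 0" and var: "\<And>l. expectation (\<lambda>\<omega>. (Z l \<omega>)\<^sup>2) = v"
  shows "integrable M (\<lambda>\<omega>. (\<Sum>l<n. Z l \<omega>)\<^sup>2)" (is ?int)
    and "expectation (\<lambda>\<omega>. (\<Sum>l<n. Z l \<omega>)\<^sup>2) = real n * v" (is ?eq)
proof -
  have [measurable]: "random_variable borel (Z l)" for l using ind unfolding indep_vars_def2 by simp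
  have i1: "integrable M (Z l)" for l
    by (rule square_integrable_imp_integrable[OF _ sq]) simp
  have cross: "integrable M (\<lambda>\<omega>. Z l \<omega> * Z k \<omega>) \<and> expectation (\<lambda>\<omega>. Z l \<omega> * Z k \<omega>) = (if l = k then v else 0)" for l k
  proof (cases "l = k")
    case True
    then show ?thesis using sq[of k] var[of k] by (simp add: power2_eq_square)
  next
    case False
    have ind2: "indep_vars (\<lambda>_. borel) Z {l, k}" by (rule indep_vars_subset[OF ind]) auto
    show ?thesis
      using indep_vars_integrable[OF _ ind2] indep_vars_lebesgue_integral[OF _ ind2] i1 mean False by simp
  qed
  have eq: "(\<Sum>l<n. Z l \<omega>)\<^sup>2 = (\<Sum>l<n. \<Sum>k<n. Z l \<omega> * Z k \<omega>)" for \<omega>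
    by (simp add: power2_eq_square sum_product)
  show ?int unfolding eq using cross by (intro Bochner_Integration.integrable_sum) blast
  have "expectation (\<lambda>\<omega>. (\<Sum>l<n. Z l \<omega>)\<^sup>2) = (\<Sum>l<n. \<Sum>k<n. expectation (\<lambda>\<omega>. Z l \<omega> * Z k \<omega>))"
    unfolding eq using cross by (simp add: Bochner_Integration.integral_sum)
  also have "\<dots> = (\<Sum>l<n. \<Sum>k<n. if l = k then v else 0)" using cross by simp
  also have "\<dots> = real n * v" by (simp add: sum.delta')
  finally show ?eq .
qed

end

definition hit_count :: "(nat \<Rightarrow> 'a \<Rightarrow> real) \<Rightarrow> real set \<Rightarrow> nat \<Rightarrow> 'a \<Rightarrow> real" where
  "hit_count U S n \<omega> = (\<Sum>l<n. indicator S (U l \<omega>))"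

locale indep_marks = prob_space M for M :: "'a measure" +
  fixes U :: "nat \<Rightarrow> 'a \<Rightarrow> real" and S :: "real set" and t :: real
  assumes indep_U: "indep_vars (\<lambda>_. borel) U UNIV"
    and S_borel [measurable]: "S \<in> sets borel"
    and prob_S: "\<And>l. prob {\<omega> \<in> space M. U l \<omega> \<in> S} = t"
begin

lemma U_measurable [measurable]: "random_variable borel (U l)"
  using indep_U unfolding indep_vars_def2 by simp

abbreviation hits :: "nat \<Rightarrow> 'a \<Rightarrow> real" where
  "hits \<equiv> hit_count U S"

lemma hits_measurable [measurable]: "random_variable borel (hits n)"
  unfolding hit_count_def by measurable

lemma t_range: "0 \<le> t" "t \<le> 1"
  using prob_S[of 0, symmetric] by auto

lemma expectation_indicator_S: "expectation (\<lambda>\<omega>. indicator S (U l \<omega>)) = t"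
proof -
  have "expectation (\<lambda>\<omega>. indicator S (U l \<omega>)) = expectation (\<lambda>\<omega>. indicator {\<omega> \<in> space M. U l \<omega> \<in> S} \<omega> :: real)"
    by (intro Bochner_Integration.integral_cong) (auto simp: indicator_def)
  then show ?thesis by (simp add: prob_S)
qed

text \<open>The exponential of the count is a product of independent factors that take only two
  values.\<close>

lemma hits_mgf: "expectation (\<lambda>\<omega>. exp (s * hits n \<omega>)) = (1 + t * (exp s - 1)) ^ n"
proof -
  have eq: "exp (s * hits n \<omega>) = (\<Prod>l<n. 1 + (exp s - 1) * indicator S (U l \<omega>))" for \<omega>
  proof -
    have "exp (s * indicator S (U l \<omega>)) = 1 + (exp s - 1) * indicator S (U l \<omega>)" for l
      by (simp add: indicator_def)
    then show ?thesis unfolding hit_count_def sum_distrib_left exp_sum[OF finite_lessThan] by simp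
  qed
  have int: "integrable M (\<lambda>\<omega>. indicator S (U l \<omega>) :: real)" for l
    by (rule integrable_const_bound[of _ 1]) (auto simp: indicator_def)
  have "expectation (\<lambda>\<omega>. \<Prod>l<n. 1 + (exp s - 1) * indicator S (U l \<omega>))
      = (\<Prod>l<n. expectation (\<lambda>\<omega>. 1 + (exp s - 1) * indicator S (U l \<omega>)))"
  proof (rule indep_vars_lebesgue_integral)
    show "indep_vars (\<lambda>_. borel) (\<lambda>l \<omega>. 1 + (exp s - 1) * indicator S (U l \<omega>)) {..<n}"
      by (rule indep_vars_compose2[OF indep_vars_subset[OF indep_U]]) auto
  qed (use int in auto)
  also have "\<dots> = (1 + t * (exp s - 1)) ^ n"
    using int by (simp add: expectation_indicator_S prob_space algebra_simps)
  finally show ?thesis unfolding eq .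
qed

lemma hits_mgf_le: "expectation (\<lambda>\<omega>. exp (s * hits n \<omega>)) \<le> exp (real n * t * (exp s - 1))"
proof -
  have "1 + t * (exp s - 1) = (1 - t) + t * exp s" by (simp add: algebra_simps)
  also have "\<dots> \<ge> 0" using t_range by simp
  finally have "(1 + t * (exp s - 1)) ^ n \<le> exp (t * (exp s - 1)) ^ n"
    by (intro power_mono) simp
  also have "\<dots> = exp (real n * t * (exp s - 1))" by (simp add: exp_of_nat_mult[symmetric] mult.assoc)
  finally show ?thesis unfolding hits_mgf .
qed

lemma hits_range: "0 \<le> hits n \<omega>" "hits n \<omega> \<le> real n"
proof -
  show "0 \<le> hits n \<omega>" unfolding hit_count_def by (intro sum_nonneg) auto
  have "hits n \<omega> \<le> (\<Sum>l<n. 1)" unfolding hit_count_def by (intro sum_mono) (auto simp: indicator_def)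
  then show "hits n \<omega> \<le> real n" by simp
qed

lemma hits_exp_integrable: "integrable M (\<lambda>\<omega>. exp (s * hits n \<omega>))"
proof (rule integrable_const_bound[of _ "exp (\<bar>s\<bar> * real n)"])
  have "s * hits n \<omega> \<le> \<bar>s\<bar> * real n" for \<omega>
    using hits_range[of n \<omega>] by (intro mult_mono) auto
  then show "AE \<omega> in M. norm (exp (s * hits n \<omega>)) \<le> exp (\<bar>s\<bar> * real n)" by simp
qed measurable

lemma hits_chernoff: "prob {\<omega> \<in> space M. s * k \<le> s * hits n \<omega>} \<le> exp (real n * t * (exp s - 1) - s * k)"
proof -
  have "prob {\<omega> \<in> space M. exp (s * k) \<le> exp (s * hits n \<omega>)} \<le> expectation (\<lambda>\<omega>. exp (s * hits n \<omega>)) / exp (s * k)"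
    by (rule integral_Markov_inequality_measure[where A = "{}"]) (use hits_exp_integrable in auto)
  also have "\<dots> \<le> exp (real n * t * (exp s - 1)) / exp (s * k)"
    by (intro divide_right_mono hits_mgf_le) simp
  finally show ?thesis by (simp add: exp_diff)
qed

text \<open>The Chernoff bound at \<open>s = ln L\<close>.\<close>

lemma hits_upper_tail:
  assumes L: "L \<ge> 1" and nt: "real n * t \<le> real k / L"
  shows "prob {\<omega> \<in> space M. real k \<le> hits n \<omega>} \<le> (exp 1 / L) ^ k"
proof (cases "L = 1")
  case True
  then show ?thesis using prob_le_1 one_le_power[of "exp 1 :: real" k] by (auto intro: order_trans)
next
  case False
  with L have L: "L > 1" by simp
  then have s: "ln L > 0" by simp
  have "prob {\<omega> \<in> space M. real k \<le> hits n \<omega>} = prob {\<omega> \<in> space M. ln L * real k \<le> ln L * hits n \<omega>}"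
    using s by simp
  also have "\<dots> \<le> exp (real n * t * (exp (ln L) - 1) - ln L * real k)" by (rule hits_chernoff)
  also have "\<dots> \<le> exp (real k - ln L * real k)"
  proof -
    have "real n * t * (L - 1) \<le> real k / L * (L - 1)" using nt L by (intro mult_right_mono) auto
    also have "\<dots> = real k * ((L - 1) / L)" by simp
    also have "\<dots> \<le> real k * 1" using L by (intro mult_left_mono) auto
    finally show ?thesis using L by simp
  qed
  also have "real k - ln L * real k = real k * (1 - ln L)" by (simp add: algebra_simps)
  also have "exp (real k * (1 - ln L)) = (exp 1 / L) ^ k" using L by (simp add: exp_of_nat_mult exp_diff)
  finally show ?thesis .
qed

text \<open>The Chernoff bound at \<open>s = -1\<close>, with \<open>exp (-1) \<le>
  1/2\<close>.\<close>

lemma hits_lower_tail: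
  assumes nt: "real n * t \<ge> real k * L" and L: "L \<ge> 0"
  shows "prob {\<omega> \<in> space M. hits n \<omega> \<le> real k} \<le> exp (1 - L / 2) ^ k"
proof -
  have e: "exp (-1) \<le> (1 / 2 :: real)"
    using exp_ge_add_one_self[of "1::real"] by (simp add: exp_minus field_simps)
  have "prob {\<omega> \<in> space M. hits n \<omega> \<le> real k} = prob {\<omega> \<in> space M. -1 * real k \<le> -1 * hits n \<omega>}" by simp
  also have "\<dots> \<le> exp (real n * t * (exp (-1) - 1) - (-1) * real k)" by (rule hits_chernoff)
  also have "\<dots> \<le> exp (real k * (1 - L / 2))"
  proof -
    have "real n * t * (exp (-1) - 1) \<le> real n * t * (- (1 / 2))"
      using e t_range by (intro mult_left_mono) auto
    also have "\<dots> \<le> real k * L * (- (1 / 2))" using nt by (intro mult_right_mono_neg) auto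
    finally show ?thesis by (simp add: algebra_simps)
  qed
  finally show ?thesis by (simp add: exp_of_nat_mult)
qed

text \<open>The mean absolute deviation is at most the standard deviation.\<close>

lemma hits_mean_deviation:
  shows "integrable M (\<lambda>\<omega>. \<bar>hits n \<omega> - real n * t\<bar>)"
    and "expectation (\<lambda>\<omega>. \<bar>hits n \<omega> - real n * t\<bar>) \<le> sqrt (real n * (t * (1 - t)))"
    and "expectation (\<lambda>\<omega>. (hits n \<omega> - real n * t)\<^sup>2) = real n * (t * (1 - t))"
    and "integrable M (\<lambda>\<omega>. (hits n \<omega> - real n * t)\<^sup>2)"
proof -
  define Z where "Z l \<omega> = indicator S (U l \<omega>) - t" for l \<omega>
  have eq: "hits n \<omega> - real n * t = (\<Sum>l<n. Z l \<omega>)" for \<omega>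
    unfolding hit_count_def Z_def by (simp add: sum_subtractf)
  have int: "integrable M (\<lambda>\<omega>. indicator S (U l \<omega>) :: real)" for l
    by (rule integrable_const_bound[of _ 1]) (auto simp: indicator_def)
  have Zind: "indep_vars (\<lambda>_. borel) Z UNIV"
    unfolding Z_def[abs_def] by (rule indep_vars_compose2[OF indep_U]) auto
  have Z2: "(Z l \<omega>)\<^sup>2 = (1 - 2 * t) * indicator S (U l \<omega>) + t\<^sup>2" for l \<omega>
    unfolding Z_def by (auto simp: indicator_def power2_eq_square algebra_simps)
  have Z2i: "integrable M (\<lambda>\<omega>. (Z l \<omega>)\<^sup>2)" for l
    unfolding Z2 using int[of l] by simp
  have Zm: "expectation (Z l) = 0" for l
    unfolding Z_def[abs_def] using int[of l] by (simp add: expectation_indicator_S prob_space)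
  have Zv: "expectation (\<lambda>\<omega>. (Z l \<omega>)\<^sup>2) = t * (1 - t)" for l
    unfolding Z2 using int[of l] by (simp add: expectation_indicator_S prob_space power2_eq_square algebra_simps)
  note sm = second_moment_indep_sum[OF Zind Z2i Zm Zv, of n]
  show v: "expectation (\<lambda>\<omega>. (hits n \<omega> - real n * t)\<^sup>2) = real n * (t * (1 - t))"
    unfolding eq by (rule sm(2))
  show v': "integrable M (\<lambda>\<omega>. (hits n \<omega> - real n * t)\<^sup>2)"
    unfolding eq by (rule sm(1))
  show i: "integrable M (\<lambda>\<omega>. \<bar>hits n \<omega> - real n * t\<bar>)"
    by (intro integrable_abs square_integrable_imp_integrable[OF _ v']) measurable
  let ?V = "real n * (t * (1 - t))" and ?E = "expectation (\<lambda>\<omega>. \<bar>hits n \<omega> - real n * t\<bar>)"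
  have "0 \<le> expectation (\<lambda>\<omega>. (\<bar>hits n \<omega> - real n * t\<bar> - ?E)\<^sup>2)" by simp
  also have "\<dots> = expectation (\<lambda>\<omega>. \<bar>hits n \<omega> - real n * t\<bar>\<^sup>2) - ?E\<^sup>2"
    by (rule variance_eq) (use i v' in auto)
  finally have "?E\<^sup>2 \<le> ?V" using v by simp
  then show "?E \<le> sqrt ?V" by (rule real_le_rsqrt)
qed

end

section \<open>Comparison of uniform order statistics\<close>

lemma sum_powers_le_twice:
  fixes r :: real
  assumes "0 \<le> r" "r \<le> 1 / 2"
  shows "(\<Sum>k=1..n. r ^ k) \<le> 2 * r"
proof -
  have "(\<Sum>k=1..n. r ^ k) = (\<Sum>k<n. r * r ^ k)"
    by (rule sum.reindex_bij_witness[of _ "\<lambda>i. i + 1" "\<lambda>i. i - 1"]) (auto simp: power_eq_if)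
  also have "\<dots> = r * ((1 - r ^ n) / (1 - r))"
    using assms by (simp add: sum_distrib_left[symmetric] sum_gp_strict)
  also have "\<dots> \<le> r * 2"
  proof (intro mult_left_mono)
    have "0 \<le> r ^ n" using assms by simp
    then have "1 - r ^ n \<le> 1" by simp
    also have "1 \<le> 2 * (1 - r)" using assms by simp
    finally have "1 - r ^ n \<le> 2 * (1 - r)" .
    then show "(1 - r ^ n) / (1 - r) \<le> 2" using assms by (simp add: divide_le_eq)
  qed (use assms in simp)
  finally show ?thesis by simp
qed

context prob_space
begin

text \<open>For points of the unit interval and \<open>S t = {..t}\<close>, this event contains all
  samples in which some \<open>k\<close>th smallest point lies below \<open>k / (n L)\<close> or
  above \<open>k L / n\<close>. With \<open>S t = {1 - t<..}\<close> it does the same for the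
  distances of the \<open>k\<close>th largest points to 1.\<close>

definition misranked :: "(nat \<Rightarrow> 'a \<Rightarrow> real) \<Rightarrow> (real \<Rightarrow> real set) \<Rightarrow> real \<Rightarrow> nat \<Rightarrow> 'a set" where
  "misranked U S L n = (\<Union>k\<in>{1..n}. {\<omega> \<in> space M. real k \<le> hit_count U (S (real k / (real n * L))) n \<omega>} \<union>
     {\<omega> \<in> space M. real k * L \<le> real n \<and> hit_count U (S (real k * L / real n)) n \<omega> \<le> real k})"

text \<open>The bounds for rank \<open>k\<close> are \<open>k\<close>th powers of small numbers, so
  their sum over \<open>k\<close> stays small uniformly in \<open>n\<close>.\<close>

lemma misranked_prob:
  assumes marks: "\<And>t. 0 \<le> t \<Longrightarrow> t \<le> 1 \<Longrightarrow> indep_marks M U (S t) t"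
    and L: "L \<ge> 1" "exp 1 / L \<le> 1 / 2" "exp (1 - L / 2) \<le> 1 / 2" and n: "n \<ge> 1"
  shows "misranked U S L n \<in> events" (is ?ev)
    and "prob (misranked U S L n) \<le> 2 * (exp 1 / L) + 2 * exp (1 - L / 2)" (is ?le)
proof -
  define A where "A k = {\<omega> \<in> space M. real k \<le> hit_count U (S (real k / (real n * L))) n \<omega>}" for k
  define B where "B k = {\<omega> \<in> space M. real k * L \<le> real n \<and> hit_count U (S (real k * L / real n)) n \<omega> \<le> real k}" for k
  have eq: "misranked U S L n = (\<Union>k\<in>{1..n}. A k \<union> B k)"
    unfolding misranked_def A_def B_def ..
  have A: "A k \<in> events \<and> prob (A k) \<le> (exp 1 / L) ^ k" if k: "k \<in> {1..n}" for k
  proof -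
    have "real k * 1 \<le> real n * L" using k L by (intro mult_mono) auto
    then have "real k / (real n * L) \<le> 1" using n L by (simp add: divide_le_eq)
    then interpret indep_marks M U "S (real k / (real n * L))" "real k / (real n * L)"
      using L by (intro marks) auto
    show ?thesis unfolding A_def using L n by (intro conjI hits_upper_tail) auto
  qed
  have B: "B k \<in> events \<and> prob (B k) \<le> exp (1 - L / 2) ^ k" if k: "k \<in> {1..n}" for k
  proof (cases "real k * L \<le> real n")
    case True
    then have "real k * L / real n \<le> 1" using n by (simp add: divide_le_eq)
    then interpret indep_marks M U "S (real k * L / real n)" "real k * L / real n"
      using L by (intro marks) auto
    show ?thesis unfolding B_def using L n True by (auto intro!: hits_lower_tail)
  next
    case False
    then have "B k = {}" by (auto simp: B_def)
    then show ?thesis by simp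
  qed
  show ?ev unfolding eq using A B by (intro sets.finite_UN sets.Un) auto
  have "prob (misranked U S L n) \<le> (\<Sum>k\<in>{1..n}. prob (A k \<union> B k))"
    unfolding eq using A B by (intro finite_measure_subadditive_finite) auto
  also have "\<dots> \<le> (\<Sum>k\<in>{1..n}. (exp 1 / L) ^ k + exp (1 - L / 2) ^ k)"
    using A B by (intro sum_mono order_trans[OF measure_Un_le] add_mono) auto
  also have "\<dots> \<le> 2 * (exp 1 / L) + 2 * exp (1 - L / 2)"
    unfolding sum.distrib using L by (intro add_mono sum_powers_le_twice) auto
  finally show ?le .
qed

end

lemma hit_count_atMost: "hit_count U {..u} n \<omega> = real (count_le (\<lambda>l. U l \<omega>) n u)"
  unfolding hit_count_def count_le_eq_sum_indicator ..

lemma hit_count_greaterThan: "hit_count U {u<..} n \<omega> = real n - real (count_le (\<lambda>l. U l \<omega>) n u)"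
proof -
  have "hit_count U {u<..} n \<omega> = (\<Sum>l<n. 1 - indicator {..u} (U l \<omega>))"
    unfolding hit_count_def by (intro sum.cong) (auto simp: indicator_def)
  then show ?thesis by (simp add: sum_subtractf count_le_eq_sum_indicator)
qed

definition ranks_comparable :: "real \<Rightarrow> nat \<Rightarrow> (nat \<Rightarrow> real) \<Rightarrow> bool" where
  "ranks_comparable L n x \<longleftrightarrow> (\<forall>i\<in>{1..n}.
     real i / (real n * L) \<le> order_stat x n i \<and> order_stat x n i \<le> real i * L / real n \<and>
     real (n + 1 - i) / (real n * L) \<le> 1 - order_stat x n i \<and> 1 - order_stat x n i \<le> real (n + 1 - i) * L / real n)"

definition grid_close :: "nat \<Rightarrow> nat \<Rightarrow> (nat \<Rightarrow> real) \<Rightarrow> bool" where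
  "grid_close m n x \<longleftrightarrow>
     (\<forall>l\<le>m. \<bar>real (count_le x n (real l / real m)) - real n * (real l / real m)\<bar> < real n / (2 * real m))"

text \<open>If the two order statistics of rank \<open>i\<close> were further apart, two consecutive
  grid points would lie between them. The count of \<open>x\<close> at the lower one would be at
  least \<open>i\<close> and that of \<open>y\<close> at the upper one less than \<open>i\<close>,
  although the expected counts increase by \<open>n / m\<close>.\<close>

lemma order_stat_diff_le_grid:
  assumes m: "m \<ge> 1" and x: "\<And>l. l < n \<Longrightarrow> 0 < x l" and y: "\<And>l. l < n \<Longrightarrow> y l < 1"
    and gx: "grid_close m n x" and gy: "grid_close m n y" and i: "1 \<le> i" "i \<le> n"
  shows "order_stat y n i - order_stat x n i \<le> 2 / real m"
proof (rule ccontr)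
  assume "\<not> ?thesis"
  then have gap: "order_stat x n i + 2 / real m < order_stat y n i" by simp
  have x0: "0 < order_stat x n i" using order_stat_in_range[OF i, of x] x by auto
  have y1: "order_stat y n i < 1" using order_stat_in_range[OF i, of y] y by auto
  have m0: "real m > 0" using m by simp
  define l where "l = nat \<lceil>real m * order_stat x n i\<rceil>"
  have l: "real m * order_stat x n i \<le> real l" "real l < real m * order_stat x n i + 1"
  proof -
    have "0 \<le> real m * order_stat x n i" using x0 m0 by simp
    then have "real l = of_int \<lceil>real m * order_stat x n i\<rceil>" unfolding l_def by simp
    then show "real m * order_stat x n i \<le> real l" "real l < real m * order_stat x n i + 1"
      using ceiling_correct[of "real m * order_stat x n i"] by linarith+
  qed
  have lx: "order_stat x n i \<le> real l / real m" using l(1) m0 by (simp add: field_simps)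
  have "(real l + 1) / real m < (real m * order_stat x n i + 2) / real m"
    using l(2) m0 by (intro divide_strict_right_mono) auto
  also have "\<dots> = order_stat x n i + 2 / real m" using m0 by (simp add: add_divide_distrib)
  finally have "(real l + 1) / real m < order_stat x n i + 2 / real m" .
  then have ly: "(real l + 1) / real m < order_stat y n i" using gap by simp
  then have "real l + 1 < real m" using y1 m0 by (metis dual_order.strict_trans divide_less_eq_1_pos)
  then have lm: "l \<le> m" "Suc l \<le> m" by linarith+
  have "i \<le> count_le x n (real l / real m)" using lx order_stat_le_iff[OF i] by blast
  moreover have "count_le y n (real (Suc l) / real m) < i"
    using ly order_stat_le_iff[OF i, of y "real (Suc l) / real m"] by (auto simp: not_le add.commute)
  moreover define a b h where "a = real n * (real l / real m)" and "b = real n * (real (Suc l) / real m)"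
    and "h = real n / (2 * real m)"
  have "\<bar>real (count_le x n (real l / real m)) - a\<bar> < h" "\<bar>real (count_le y n (real (Suc l) / real m)) - b\<bar> < h"
    using gx gy lm unfolding grid_close_def a_def b_def h_def by blast+
  moreover have "b = a + 2 * h"
    using m0 unfolding a_def b_def h_def by (simp add: field_simps)
  ultimately show False by linarith
qed

locale uniform_sequence = prob_space M for M :: "'a measure" +
  fixes U :: "nat \<Rightarrow> 'a \<Rightarrow> real"
  assumes indep: "indep_vars (\<lambda>_. borel) U UNIV"
    and uniform: "\<And>l t. 0 \<le> t \<Longrightarrow> t \<le> 1 \<Longrightarrow> prob {\<omega> \<in> space M. U l \<omega> \<le> t} = t"
begin

lemma U_borel [measurable]: "random_variable borel (U l)"
  using indep unfolding indep_vars_def2 by simp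

lemma marks_atMost: "0 \<le> t \<Longrightarrow> t \<le> 1 \<Longrightarrow> indep_marks M U {..t} t"
  by unfold_locales (use indep uniform in auto)

lemma marks_greaterThan:
  assumes "0 \<le> t" "t \<le> 1"
  shows "indep_marks M U {1 - t<..} t"
proof unfold_locales
  fix l
  have "{\<omega> \<in> space M. U l \<omega> \<in> {1 - t<..}} = space M - {\<omega> \<in> space M. U l \<omega> \<le> 1 - t}" by auto
  then show "prob {\<omega> \<in> space M. U l \<omega> \<in> {1 - t<..}} = t"
    using uniform[of "1 - t" l] assms by (simp add: prob_compl)
qed (use indep in auto)

text \<open>The bound is uniform in \<open>n\<close> and includes the extreme ranks, for which the
  order statistics are random on the scale \<open>1 / n\<close> and no law of large numbers
  applies.\<close>

lemma ranks_comparable_whp: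
  assumes "\<epsilon> > 0"
  obtains L where "L \<ge> 1" "\<And>n. n \<ge> 1 \<Longrightarrow> \<exists>A\<in>events. prob A \<le> \<epsilon> \<and>
    (\<forall>\<omega>\<in>space M - A. (\<forall>l. 0 < U l \<omega> \<and> U l \<omega> < 1) \<longrightarrow> ranks_comparable L n (\<lambda>l. U l \<omega>))"
proof -
  \<comment> \<open>Both error terms are \<open>O(1 / L)\<close>: \<open>exp 1 \<le> 3\<close> and \<open>exp (1 - L / 2) \<le> 2 / L\<close>.\<close>
  define L where "L = 20 / \<epsilon> + 20"
  have L20: "L \<ge> 20" "20 / L < \<epsilon>" using assms by (auto simp: L_def field_simps)
  have "exp 1 / L \<le> 3 / L" using exp_le L20 by (intro divide_right_mono) auto
  moreover have "exp (1 - L / 2) \<le> 2 / L"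
  proof -
    have "L / 2 \<le> exp (L / 2 - 1)" using exp_ge_add_one_self[of "L / 2 - 1"] by simp
    then have "inverse (exp (L / 2 - 1)) \<le> inverse (L / 2)" using L20 by (intro le_imp_inverse_le) auto
    moreover have "exp (1 - L / 2) = inverse (exp (L / 2 - 1))" using exp_minus[of "L / 2 - 1"] by simp
    moreover have "inverse (L / 2) = 2 / L" by simp
    ultimately show ?thesis by simp
  qed
  moreover have "3 / L < 1 / 2" "2 / L < 1 / 2" "4 * (3 / L) + 4 * (2 / L) = 20 / L"
    using L20 by (auto simp: field_simps)
  ultimately have L: "4 * (exp 1 / L) + 4 * exp (1 - L / 2) < \<epsilon>" "exp 1 / L < 1 / 2" "exp (1 - L / 2) < 1 / 2" "L \<ge> 1"
    using L20 by linarith+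
  show thesis
  proof (rule that[of L])
    fix n :: nat assume n: "n \<ge> 1"
    let ?A = "misranked U (\<lambda>t. {..t}) L n \<union> misranked U (\<lambda>t. {1 - t<..}) L n"
    have 1: "misranked U (\<lambda>t. {..t}) L n \<in> events" "prob (misranked U (\<lambda>t. {..t}) L n) \<le> 2 * (exp 1 / L) + 2 * exp (1 - L / 2)"
      by (rule misranked_prob; use marks_atMost L n in auto)+
    have 2: "misranked U (\<lambda>t. {1 - t<..}) L n \<in> events" "prob (misranked U (\<lambda>t. {1 - t<..}) L n) \<le> 2 * (exp 1 / L) + 2 * exp (1 - L / 2)"
      by (rule misranked_prob; use marks_greaterThan L n in auto)+
    have "prob ?A \<le> prob (misranked U (\<lambda>t. {..t}) L n) + prob (misranked U (\<lambda>t. {1 - t<..}) L n)"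
      by (rule measure_Un_le) (use 1 2 in auto)
    then have "prob ?A \<le> \<epsilon>" using 1(2) 2(2) L(1) by linarith
    moreover have "ranks_comparable L n (\<lambda>l. U l \<omega>)"
      if \<omega>: "\<omega> \<in> space M - ?A" and U01: "\<And>l. 0 < U l \<omega> \<and> U l \<omega> < 1" for \<omega>
      unfolding ranks_comparable_def
    proof (intro ballI conjI)
      fix i assume "i \<in> {1..n}"
      then have i: "1 \<le> i" "i \<le> n" by auto
      define r where "r = n + 1 - i"
      have r: "1 \<le> r" "r \<le> n" "real r = real n + 1 - real i" using i by (auto simp: r_def)
      let ?x = "\<lambda>l. U l \<omega>"
      let ?o = "order_stat ?x n i"
      have o: "0 < ?o" "?o < 1" using order_stat_in_range[OF i, of ?x] U01 by auto
      have no: "\<not> real k \<le> real (count_le ?x n (real k / (real n * L)))"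
          "real k * L \<le> real n \<Longrightarrow> real k < real (count_le ?x n (real k * L / real n))"
          "\<not> real k \<le> real n - real (count_le ?x n (1 - real k / (real n * L)))"
          "real k * L \<le> real n \<Longrightarrow> real k < real n - real (count_le ?x n (1 - real k * L / real n))"
        if "1 \<le> k" "k \<le> n" for k
        using \<omega> that unfolding misranked_def
          by (auto simp: hit_count_atMost hit_count_greaterThan not_le dest!: bspec[where x = k])
      show "real i / (real n * L) \<le> ?o"
      proof (rule ccontr)
        assume "\<not> ?thesis"
        then have "?o \<le> real i / (real n * L)" by simp
        then show False using no(1)[OF i] unfolding order_stat_le_iff[OF i] by simp
      qed
      show "?o \<le> real i * L / real n"
      proof (cases "real i * L \<le> real n")
        case True
        then show ?thesis using no(2)[OF i] unfolding order_stat_le_iff[OF i] by simp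
      next
        case False
        then have "1 \<le> real i * L / real n" using n by (simp add: field_simps)
        then show ?thesis using o by linarith
      qed
      have "?o \<le> 1 - real r / (real n * L)"
        unfolding order_stat_le_iff[OF i] using no(3)[of r] r by linarith
      then show "real (n + 1 - i) / (real n * L) \<le> 1 - ?o" unfolding r_def by linarith
      have "1 - real r * L / real n \<le> ?o"
      proof (cases "real r * L \<le> real n")
        case True
        show ?thesis
        proof (rule ccontr)
          assume "\<not> ?thesis"
          then have "?o \<le> 1 - real r * L / real n" by simp
          then have "i \<le> count_le ?x n (1 - real r * L / real n)" unfolding order_stat_le_iff[OF i] .
          then show False using no(4)[of r] True r by linarith
        qed
      next
        case False
        then have "1 \<le> real r * L / real n" using n by (simp add: field_simps)
        then show ?thesis using o by linarith
      qed
      then show "1 - ?o \<le> real (n + 1 - i) * L / real n" unfolding r_def by linarith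
    qed
    ultimately show "\<exists>A\<in>events. prob A \<le> \<epsilon> \<and>
        (\<forall>\<omega>\<in>space M - A. (\<forall>l. 0 < U l \<omega> \<and> U l \<omega> < 1) \<longrightarrow> ranks_comparable L n (\<lambda>l. U l \<omega>))"
      using 1(1) 2(1) by (intro bexI[of _ ?A]) auto
  qed (use L in auto)
qed

lemma grid_close_whp:
  assumes "\<epsilon> > 0" and m: "m \<ge> 1"
  obtains n\<^sub>0 where "\<And>n. n \<ge> n\<^sub>0 \<Longrightarrow> \<exists>A\<in>events. prob A \<le> \<epsilon> \<and> (\<forall>\<omega>\<in>space M - A. grid_close m n (\<lambda>l. U l \<omega>))"
proof -
  have "(\<lambda>n. real (m + 1) * (4 * (real m)\<^sup>2 / real n)) \<longlonglongrightarrow> real (m + 1) * 0"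
    by (intro tendsto_intros lim_const_over_n)
  then have "eventually (\<lambda>n. real (m + 1) * (4 * (real m)\<^sup>2 / real n) < \<epsilon> \<and> n \<ge> 1) sequentially"
    using assms by (intro eventually_conj eventually_ge_at_top order_tendstoD) auto
  then obtain n0 where n0: "\<And>n. n \<ge> n0 \<Longrightarrow> real (m + 1) * (4 * (real m)\<^sup>2 / real n) < \<epsilon> \<and> n \<ge> 1"
    unfolding eventually_sequentially by blast
  show thesis
  proof (rule that[of n0])
    fix n assume "n \<ge> n0"
    then have n: "real (m + 1) * (4 * (real m)\<^sup>2 / real n) < \<epsilon>" "n \<ge> 1" using n0 by auto
    define t where "t l = real l / real m" for l
    define A where "A l = {\<omega> \<in> space M. real n / (2 * real m) \<le> \<bar>hit_count U {..t l} n \<omega> - real n * t l\<bar>}" for l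
    have A: "A l \<in> events \<and> prob (A l) \<le> 4 * (real m)\<^sup>2 / real n" if l: "l \<le> m" for l
    proof -
      have t: "0 \<le> t l" "t l \<le> 1" using l m by (auto simp: t_def field_simps)
      interpret indep_marks M U "{..t l}" "t l" using t by (rule marks_atMost)
      have c: "0 < (real n / (2 * real m))\<^sup>2" using n m by simp
      have "A l = {\<omega> \<in> space M. (real n / (2 * real m))\<^sup>2 \<le> (hits n \<omega> - real n * t l)\<^sup>2}"
        unfolding A_def using n by (auto simp: abs_le_square_iff[symmetric])
      also have "prob \<dots> \<le> expectation (\<lambda>\<omega>. (hits n \<omega> - real n * t l)\<^sup>2) / (real n / (2 * real m))\<^sup>2"
        by (rule integral_Markov_inequality_measure[where A = "{}"]) (use hits_mean_deviation(4) c in auto)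
      also have "\<dots> = real n * (t l * (1 - t l)) / (real n / (2 * real m))\<^sup>2"
        by (simp only: hits_mean_deviation(3))
      also have "\<dots> \<le> real n * (1 * 1) / (real n / (2 * real m))\<^sup>2"
        using t by (intro divide_right_mono mult_left_mono mult_mono) auto
      also have "\<dots> = 4 * (real m)\<^sup>2 / real n" using n m by (simp add: field_simps power2_eq_square)
      finally have "prob (A l) \<le> 4 * (real m)\<^sup>2 / real n" .
      moreover have "A l \<in> events" unfolding A_def by measurable
      ultimately show ?thesis by blast
    qed
    have "prob (\<Union>l\<in>{..m}. A l) \<le> (\<Sum>l\<in>{..m}. prob (A l))"
      using A by (intro finite_measure_subadditive_finite) auto
    also have "\<dots> \<le> (\<Sum>l\<in>{..m}. 4 * (real m)\<^sup>2 / real n)" using A by (intro sum_mono) auto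
    also have "\<dots> \<le> \<epsilon>" using n(1) by simp
    finally show "\<exists>A\<in>events. prob A \<le> \<epsilon> \<and> (\<forall>\<omega>\<in>space M - A. grid_close m n (\<lambda>l. U l \<omega>))"
      using A by (intro bexI[of _ "\<Union>l\<in>{..m}. A l"])
        (auto simp: grid_close_def A_def t_def hit_count_atMost not_le)
  qed
qed

end

section \<open>The additive remainder is negligible\<close>

lemma ranks_comparable_mono:
  assumes "ranks_comparable L n x" "0 < L" "L \<le> L'" "n \<ge> 1"
  shows "ranks_comparable L' n x"
  unfolding ranks_comparable_def
proof (intro ballI)
  fix i assume i: "i \<in> {1..n}"
  have 1: "real k / (real n * L') \<le> real k / (real n * L)" for k
    using assms by (intro divide_left_mono mult_left_mono mult_pos_pos) auto
  have 2: "real k * L / real n \<le> real k * L' / real n" for k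
    using assms by (intro divide_right_mono mult_left_mono) auto
  show "real i / (real n * L') \<le> order_stat x n i \<and> order_stat x n i \<le> real i * L' / real n \<and>
     real (n + 1 - i) / (real n * L') \<le> 1 - order_stat x n i \<and> 1 - order_stat x n i \<le> real (n + 1 - i) * L' / real n"
    using assms(1) i 1[of i] 2[of i] 1[of "n + 1 - i"] 2[of "n + 1 - i"] unfolding ranks_comparable_def
    by (meson order_trans)
qed

text \<open>Both \<open>b - a\<close> and the ratio of weights are controlled by \<open>a (1 -
  b)\<close>, the product of the distances of the interval to 0 and 1.\<close>

lemma comparable_interval:
  fixes a b C u x :: real
  assumes ab: "0 < a" "a \<le> b" "b < 1" and C: "C \<ge> 1" "b \<le> C * a" "1 - a \<le> C * (1 - b)"
    and u: "a \<le> u" "u \<le> b"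
  shows "b - a \<le> 3 * C\<^sup>2 * (u * (1 - u))"
    and "a \<le> x \<Longrightarrow> x \<le> b \<Longrightarrow> x * (1 - x) < (C\<^sup>2 + 1) * (u * (1 - u))"
proof -
  have w: "a * (1 - b) \<le> u * (1 - u)" using u ab by (intro mult_mono) auto
  have w0: "0 < a * (1 - b)" using ab by simp
  let ?\<rho> = "b - a"
  have r1: "?\<rho> \<le> C * a" "?\<rho> \<le> C * (1 - b)" "0 \<le> ?\<rho>" using ab C by linarith+
  \<comment> \<open>The unit interval consists of \<open>[0, a]\<close>, \<open>[a, b]\<close> and \<open>[b, 1]\<close>.\<close>
  have "?\<rho> = ?\<rho> * a + ?\<rho> * (1 - b) + ?\<rho> * ?\<rho>" by (simp add: algebra_simps)
  also have "\<dots> \<le> C * (1 - b) * a + C * a * (1 - b) + (C * a) * (C * (1 - b))"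
    using r1 ab C by (intro add_mono mult_right_mono mult_mono) auto
  also have "\<dots> = (2 * C + C\<^sup>2) * (a * (1 - b))" by (simp add: power2_eq_square algebra_simps)
  also have "\<dots> \<le> (2 * C\<^sup>2 + C\<^sup>2) * (a * (1 - b))"
    using C(1) w0 by (intro mult_right_mono) (auto simp: power2_eq_square)
  also have "\<dots> = 3 * C\<^sup>2 * (a * (1 - b))" by simp
  also have "\<dots> \<le> 3 * C\<^sup>2 * (u * (1 - u))" using w by (intro mult_left_mono) auto
  finally show "b - a \<le> 3 * C\<^sup>2 * (u * (1 - u))" .
  assume x: "a \<le> x" "x \<le> b"
  have "x * (1 - x) \<le> b * (1 - a)" using x ab by (intro mult_mono) auto
  also have "\<dots> \<le> (C * a) * (C * (1 - b))" using ab C by (intro mult_mono) auto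
  also have "\<dots> = C\<^sup>2 * (a * (1 - b))" by (simp add: power2_eq_square)
  also have "\<dots> \<le> C\<^sup>2 * (u * (1 - u))" using w by (intro mult_left_mono) auto
  also have "\<dots> < (C\<^sup>2 + 1) * (u * (1 - u))" using w w0 by (simp add: distrib_right)
  finally show "x * (1 - x) < (C\<^sup>2 + 1) * (u * (1 - u))" .
qed

locale weighted_density =
  fixes q :: "real \<Rightarrow> real"
  assumes q_ge_1: "\<And>x. q x \<ge> 1"
    and q_measurable: "(\<lambda>x. indicator {0<..<1} x * q x) \<in> borel_measurable borel"
    and q_weighted: "integrable lborel (\<lambda>x. indicator {0<..<1} x * ((x * (1 - x)) powr (3 / 2) * q x))"
begin

lemma q_nonneg: "0 \<le> q x" using q_ge_1[of x] by linarith

lemma q_set_integrable: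
  assumes ab: "0 < a" "b < 1"
  shows "set_integrable lborel {a..b} q"
proof (cases "a \<le> b")
  case True
  define c where "c = (a * (1 - b)) powr (3 / 2)"
  have c: "c > 0" using True ab by (simp add: c_def)
  show ?thesis unfolding set_integrable_def
  proof (rule Bochner_Integration.integrable_bound)
    show "integrable lborel (\<lambda>x. (1 / c) * (indicator {0<..<1} x * ((x * (1 - x)) powr (3 / 2) * q x)))"
      using q_weighted by simp
    have "(\<lambda>x. indicator {a..b} x *\<^sub>R q x) = (\<lambda>x. indicator {a..b} x * (indicator {0<..<1} x * q x))"
      using ab by (auto simp: fun_eq_iff indicator_def)
    then show "(\<lambda>x. indicator {a..b} x *\<^sub>R q x) \<in> borel_measurable lborel"
      using borel_measurable_times[OF _ q_measurable, of "indicator {a..b}"] by simp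
    have "\<bar>indicator {a..b} x *\<^sub>R q x\<bar> \<le> \<bar>(1 / c) * (indicator {0<..<1} x * ((x * (1 - x)) powr (3 / 2) * q x))\<bar>" for x
    proof (cases "x \<in> {a..b}")
      case x: True
      have "c \<le> (x * (1 - x)) powr (3 / 2)"
        unfolding c_def using x ab by (intro powr_mono2 mult_mono) auto
      then have "c * q x \<le> (x * (1 - x)) powr (3 / 2) * q x" using q_nonneg by (rule mult_right_mono)
      then have "q x \<le> (1 / c) * ((x * (1 - x)) powr (3 / 2) * q x)" using c by (simp add: field_simps)
      moreover have "indicator {0<..<1} x = (1::real)" using x ab by auto
      ultimately show ?thesis using x q_nonneg[of x] c by simp
    qed simp
    then show "AE x in lborel. norm (indicator {a..b} x *\<^sub>R q x) \<le> norm ((1 / c) * (indicator {0<..<1} x * ((x * (1 - x)) powr (3 / 2) * q x)))"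
      by (intro AE_I2) simp
  qed
qed simp

lemma q_integrable_on: "0 < a \<Longrightarrow> b < 1 \<Longrightarrow> q integrable_on {a..b}"
  using set_borel_integral_eq_integral(1)[OF q_set_integrable] .

lemma q_integral_eq_nn_integral:
  assumes ab: "0 < a" "b < 1"
  shows "ennreal (integral {a..b} q) = (\<integral>\<^sup>+x. ennreal (indicator {a..<b} x * q x) \<partial>lborel)"
proof -
  have int: "integrable lborel (\<lambda>x. indicator {a..b} x * q x)" using q_set_integrable[OF ab] unfolding set_integrable_def by simp
  have "integral {a..b} q = (LINT x|lborel. indicator {a..b} x * q x)"
    using set_borel_integral_eq_integral(2)[OF q_set_integrable[OF ab]] unfolding set_lebesgue_integral_def by simp
  then have "ennreal (integral {a..b} q) = (\<integral>\<^sup>+x. ennreal (indicator {a..b} x * q x) \<partial>lborel)"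
    using nn_integral_eq_integral[OF int] q_nonneg by simp
  also have "\<dots> = (\<integral>\<^sup>+x. ennreal (indicator {a..<b} x * q x) \<partial>lborel)"
    by (rule nn_integral_cong_AE, rule AE_mp[OF AE_lborel_singleton[of b]]) (auto simp: indicator_def)
  finally show ?thesis .
qed

text \<open>The integrand that dominates the remainders: the lengths of the intervals around
  \<open>u\<close> are at most \<open>C u (1 - u)\<close> and at most \<open>2 / m\<close>.\<close>

definition damped :: "real \<Rightarrow> nat \<Rightarrow> real \<Rightarrow> real" where
  "damped C m u = indicator {0<..<1} u * q u * min (C * (u * (1 - u))) (2 / real m)"

lemma damped_measurable [measurable]: "damped C m \<in> borel_measurable borel"
  unfolding damped_def[abs_def] using q_measurable by measurable

lemma damped_nonneg: "C \<ge> 0 \<Longrightarrow> 0 \<le> damped C m u"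
  unfolding damped_def using q_nonneg[of u] by (auto simp: indicator_def intro!: mult_nonneg_nonneg)

lemma damped_le: "C \<ge> 0 \<Longrightarrow> damped C m u * sqrt (u * (1 - u)) \<le> C * (indicator {0<..<1} u * ((u * (1 - u)) powr (3 / 2) * q u))"
proof (cases "u \<in> {0<..<1}")
  case True
  assume C: "C \<ge> 0"
  have w: "0 < u * (1 - u)" using True by simp
  have "(u * (1 - u)) powr (3 / 2) = u * (1 - u) * sqrt (u * (1 - u))"
    using w powr_add[of "u * (1 - u)" 1 "1 / 2"] by (simp add: powr_half_sqrt)
  moreover have "q u * min (C * (u * (1 - u))) (2 / real m) \<le> q u * (C * (u * (1 - u)))"
    using q_nonneg by (intro mult_left_mono) auto
  then have "q u * min (C * (u * (1 - u))) (2 / real m) * sqrt (u * (1 - u)) \<le> q u * (C * (u * (1 - u))) * sqrt (u * (1 - u))"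
    using w by (intro mult_right_mono) auto
  ultimately show ?thesis using True by (simp add: damped_def mult_ac)
qed (simp add: damped_def)

text \<open>The bound \<open>C u (1 - u)\<close> yields the integrable majorant and the bound
  \<open>2 / m\<close> the pointwise limit.\<close>

lemma damped_integral_tendsto:
  assumes C: "C \<ge> 0"
  shows "integrable lborel (\<lambda>u. damped C m u * sqrt (u * (1 - u)))"
    and "(\<lambda>m. LINT u|lborel. damped C m u * sqrt (u * (1 - u))) \<longlonglongrightarrow> 0"
proof -
  let ?g = "\<lambda>u. C * (indicator {0<..<1} u * ((u * (1 - u)) powr (3 / 2) * q u))"
  have g: "integrable lborel ?g" using q_weighted by simp
  have nn: "0 \<le> damped C m u * sqrt (u * (1 - u))" for m u
    using damped_nonneg[OF C, of m u] by (cases "u \<in> {0<..<1}") (auto simp: damped_def)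
  show "integrable lborel (\<lambda>u. damped C m u * sqrt (u * (1 - u)))"
    using nn damped_le[OF C] by (intro Bochner_Integration.integrable_bound[OF g]) (auto intro!: AE_I2 order_trans[OF _ abs_ge_self])
  have "(\<lambda>m. LINT u|lborel. damped C m u * sqrt (u * (1 - u))) \<longlonglongrightarrow> (LINT u|(lborel::real measure). 0)"
  proof (rule integral_dominated_convergence[OF _ _ g])
    have "(\<lambda>m. damped C m u * sqrt (u * (1 - u))) \<longlonglongrightarrow> 0" for u
    proof (cases "u \<in> {0<..<1}")
      case True
      then have w: "0 \<le> C * (u * (1 - u))" using C by simp
      have "(\<lambda>m. min (C * (u * (1 - u))) (2 / real m)) \<longlonglongrightarrow> min (C * (u * (1 - u))) 0"
        by (intro tendsto_min tendsto_const lim_const_over_n)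
      then have "(\<lambda>m. indicator {0<..<1} u * q u * min (C * (u * (1 - u))) (2 / real m) * sqrt (u * (1 - u)))
          \<longlonglongrightarrow> indicator {0<..<1} u * q u * min (C * (u * (1 - u))) 0 * sqrt (u * (1 - u))"
        by (intro tendsto_mult tendsto_const)
      then show ?thesis using w by (simp add: damped_def)
    qed (simp add: damped_def)
    then show "AE u in lborel. (\<lambda>m. damped C m u * sqrt (u * (1 - u))) \<longlonglongrightarrow> 0" by simp
    show "\<And>m. AE u in lborel. norm (damped C m u * sqrt (u * (1 - u))) \<le> ?g u"
      using nn damped_le[OF C] by (intro AE_I2) simp
  qed simp_all
  then show "(\<lambda>m. LINT u|lborel. damped C m u * sqrt (u * (1 - u))) \<longlonglongrightarrow> 0" by simp
qed


text \<open>The sum over the ranks and the integral are exchanged; at a fixed \<open>u\<close> the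
  number of intervals that contain it is bounded by the spread of the counts.\<close>

lemma sum_interval_bounds_le:
  fixes x :: "'d::finite \<Rightarrow> nat \<Rightarrow> real" and h :: "nat \<Rightarrow> real"
  assumes K: "K \<ge> 0" and C: "C \<ge> 1" and m: "m \<ge> 1"
    and pos: "\<And>i. i \<in> {1..n} \<Longrightarrow> 0 < a i" "\<And>i. i \<in> {1..n} \<Longrightarrow> a i \<le> b i" "\<And>i. i \<in> {1..n} \<Longrightarrow> b i < 1"
    and comp: "\<And>i. i \<in> {1..n} \<Longrightarrow> b i \<le> C * a i" "\<And>i. i \<in> {1..n} \<Longrightarrow> 1 - a i \<le> C * (1 - b i)"
    and close: "\<And>i. i \<in> {1..n} \<Longrightarrow> b i - a i \<le> 2 / real m"
    and h: "\<And>i. i \<in> {1..n} \<Longrightarrow> \<bar>h i\<bar> \<le> K * (b i - a i) * integral {a i..b i} q"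
    and attained: "\<And>i. i \<in> {1..n} \<Longrightarrow> \<exists>j. a i = order_stat (x j) n i" "\<And>i. i \<in> {1..n} \<Longrightarrow> \<exists>j. b i = order_stat (x j) n i"
  shows "ennreal (\<Sum>i=1..n. \<bar>h i\<bar>) \<le> ennreal K *
    (\<integral>\<^sup>+u. ennreal (damped (3 * C\<^sup>2) m u * count_spread x n u) \<partial>lborel)"
proof -
  let ?d = "damped (3 * C\<^sup>2) m"
  have d0: "0 \<le> ?d u" for u by (rule damped_nonneg) simp
  have one: "ennreal \<bar>h i\<bar> \<le> ennreal K * (\<integral>\<^sup>+u. ennreal (?d u * indicator {a i..<b i} u) \<partial>lborel)" if i: "i \<in> {1..n}" for i
  proof -
    note p = pos[OF i] comp[OF i] close[OF i]
    have I0: "0 \<le> integral {a i..b i} q"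
      by (intro integral_nonneg q_integrable_on) (use p q_nonneg in auto)
    have "ennreal \<bar>h i\<bar> \<le> ennreal (K * (b i - a i) * integral {a i..b i} q)"
      using h[OF i] by (rule ennreal_leI)
    also have "\<dots> = ennreal K * (ennreal (b i - a i) * ennreal (integral {a i..b i} q))"
      using K p I0 by (simp add: ennreal_mult' mult.assoc)
    also have "ennreal (b i - a i) * ennreal (integral {a i..b i} q)
        = (\<integral>\<^sup>+u. ennreal (b i - a i) * ennreal (indicator {a i..<b i} u * q u) \<partial>lborel)"
    proof -
      have "(\<lambda>u. indicator {a i..<b i} u * q u) = (\<lambda>u. indicator {a i..<b i} u * (indicator {0<..<1} u * q u))"
        using p by (auto simp: fun_eq_iff indicator_def)
      then have [measurable]: "(\<lambda>u. indicator {a i..<b i} u * q u) \<in> borel_measurable borel"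
        using borel_measurable_times[OF _ q_measurable, of "indicator {a i..<b i}"] by simp
      show ?thesis
        unfolding q_integral_eq_nn_integral[OF p(1) p(3)] by (subst nn_integral_cmult) auto
    qed
    also have "\<dots> \<le> (\<integral>\<^sup>+u. ennreal (?d u * indicator {a i..<b i} u) \<partial>lborel)"
    proof (rule nn_integral_mono)
      fix u :: real
      show "ennreal (b i - a i) * ennreal (indicator {a i..<b i} u * q u) \<le> ennreal (?d u * indicator {a i..<b i} u)"
      proof (cases "u \<in> {a i..<b i}")
        case True
        have "b i - a i \<le> 3 * C\<^sup>2 * (u * (1 - u))"
          by (rule comparable_interval(1)[OF p(1-3) C p(4,5)]) (use True in auto)
        then have "(b i - a i) * q u \<le> min (3 * C\<^sup>2 * (u * (1 - u))) (2 / real m) * q u"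
          using p(6) q_nonneg by (intro mult_right_mono) auto
        also have "\<dots> = ?d u" using True p by (simp add: damped_def)
        finally have "(b i - a i) * q u \<le> ?d u" .
        then show ?thesis using True p q_nonneg[of u] by (simp add: ennreal_mult'[symmetric] ennreal_leI)
      qed simp
    qed
    finally show ?thesis by (simp add: mult_left_mono)
  qed
  have "ennreal (\<Sum>i=1..n. \<bar>h i\<bar>) = (\<Sum>i=1..n. ennreal \<bar>h i\<bar>)" by (simp add: sum_ennreal)
  also have "\<dots> \<le> (\<Sum>i=1..n. ennreal K * (\<integral>\<^sup>+u. ennreal (?d u * indicator {a i..<b i} u) \<partial>lborel))"
    by (intro sum_mono one)
  also have "\<dots> = ennreal K * (\<integral>\<^sup>+u. (\<Sum>i=1..n. ennreal (?d u * indicator {a i..<b i} u)) \<partial>lborel)"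
    by (simp add: sum_distrib_left[symmetric] nn_integral_sum)
  also have "\<dots> \<le> ennreal K * (\<integral>\<^sup>+u. ennreal (?d u * count_spread x n u) \<partial>lborel)"
  proof (intro mult_left_mono nn_integral_mono)
    fix u
    have "(\<Sum>i=1..n. ennreal (?d u * indicator {a i..<b i} u)) = ennreal (\<Sum>i=1..n. ?d u * indicator {a i..<b i} u)"
      using d0 by (intro sum_ennreal) auto
    also have "(\<Sum>i=1..n. ?d u * indicator {a i..<b i} u) = ?d u * (\<Sum>i=1..n. indicator {a i..<b i} u)"
      by (simp add: sum_distrib_left)
    also have "(\<Sum>i=1..n. indicator {a i..<b i} u) = real (card {i \<in> {1..n}. a i \<le> u \<and> u < b i})"
    proof -
      have "(\<Sum>i=1..n. indicator {a i..<b i} u) = (\<Sum>i\<in>{1..n}. if a i \<le> u \<and> u < b i then 1 else (0::real))"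
        by (intro sum.cong) (auto simp: indicator_def)
      then show ?thesis by (simp add: sum.If_cases Int_def)
    qed
    also have "ennreal (?d u * real (card {i \<in> {1..n}. a i \<le> u \<and> u < b i}))
        \<le> ennreal (?d u * count_spread x n u)"
    proof (intro ennreal_leI mult_left_mono d0)
      have "{i \<in> {1..n}. a i \<le> u \<and> u < b i} \<subseteq>
          {i \<in> {1..n}. (\<exists>j. order_stat (x j) n i \<le> u) \<and> (\<exists>k. u < order_stat (x k) n i)}"
      proof
        fix i assume "i \<in> {i \<in> {1..n}. a i \<le> u \<and> u < b i}"
        then have i: "i \<in> {1..n}" "a i \<le> u" "u < b i" by auto
        obtain j k where "a i = order_stat (x j) n i" "b i = order_stat (x k) n i" using attained[OF i(1)] by blast
        then have "order_stat (x j) n i \<le> u" "u < order_stat (x k) n i" using i by simp_all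
        then show "i \<in> {i \<in> {1..n}. (\<exists>j. order_stat (x j) n i \<le> u) \<and> (\<exists>k. u < order_stat (x k) n i)}"
          using i(1) by blast
      qed
      then have "card {i \<in> {1..n}. a i \<le> u \<and> u < b i} \<le>
          card {i \<in> {1..n}. (\<exists>j. order_stat (x j) n i \<le> u) \<and> (\<exists>k. u < order_stat (x k) n i)}"
        by (intro card_mono) auto
      then show "real (card {i \<in> {1..n}. a i \<le> u \<and> u < b i})
          \<le> count_spread x n u"
        using card_separated_ranks[of n x u] by linarith
    qed
    finally show "(\<Sum>i=1..n. ennreal (?d u * indicator {a i..<b i} u)) \<le>
        ennreal (?d u * count_spread x n u)" .
  qed simp
  finally show ?thesis .
qed

text \<open>After exchanging expectation and integral, each count deviates from its mean \<open>n
  u\<close> by at most \<open>sqrt (n u (1 - u))\<close> in expectation.\<close>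

lemma damped_count_deviation:
  fixes U :: "'d::finite \<Rightarrow> nat \<Rightarrow> 'a \<Rightarrow> real" and m n :: nat
  assumes "prob_space M" and U: "\<And>j. uniform_sequence M (U j)" and C: "C \<ge> 0"
  defines "Y \<equiv> \<lambda>\<omega>. \<integral>\<^sup>+u. ennreal (damped C m u * count_spread (\<lambda>j l. U j l \<omega>) n u) \<partial>lborel"
  shows "Y \<in> borel_measurable M"
    and "(\<integral>\<^sup>+\<omega>. Y \<omega> \<partial>M) \<le> ennreal (2 * (real CARD('d))\<^sup>2 * sqrt (real n) * (LINT u|lborel. damped C m u * sqrt (u * (1 - u))))"
proof -
  interpret prob_space M by fact
  let ?D = "real CARD('d)"
  let ?N = "\<lambda>j \<omega> u. real (count_le (\<lambda>l. U j l \<omega>) n u)"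
  have Um [measurable]: "random_variable borel (U j l)" for j l
    using uniform_sequence.U_borel[OF U] .
  have N_meas [measurable]: "(\<lambda>(\<omega>, u). ?N j \<omega> u) \<in> borel_measurable (M \<Otimes>\<^sub>M lborel)" for j
  proof -
    have "(\<lambda>(\<omega>, u). \<Sum>l<n. if U j l \<omega> \<le> u then 1 else (0::real)) \<in> borel_measurable (M \<Otimes>\<^sub>M lborel)"
      by measurable
    moreover have "(\<Sum>l<n. if U j l \<omega> \<le> u then 1 else (0::real)) = ?N j \<omega> u" for \<omega> u
      unfolding count_le_eq_sum_indicator by (intro sum.cong) (auto simp: indicator_def)
    ultimately show ?thesis by simp
  qed
  let ?T = "\<lambda>\<omega> u. damped C m u * (\<Sum>j\<in>UNIV. \<Sum>k\<in>UNIV. \<bar>?N j \<omega> u - ?N k \<omega> u\<bar>)"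
  have T_meas [measurable]: "(\<lambda>(\<omega>, u). ennreal (?T \<omega> u)) \<in> borel_measurable (M \<Otimes>\<^sub>M lborel)"
    by measurable
  show "Y \<in> borel_measurable M"
    unfolding Y_def count_spread_def by measurable
  interpret MB: pair_sigma_finite M "lborel :: real measure" by unfold_locales
  have "(\<integral>\<^sup>+\<omega>. Y \<omega> \<partial>M) = (\<integral>\<^sup>+u. (\<integral>\<^sup>+\<omega>. ennreal (?T \<omega> u) \<partial>M) \<partial>lborel)"
    unfolding Y_def count_spread_def by (rule MB.Fubini'[symmetric]) measurable
  also have "\<dots> \<le> (\<integral>\<^sup>+u. ennreal (2 * ?D\<^sup>2 * sqrt (real n) * (damped C m u * sqrt (u * (1 - u)))) \<partial>lborel)"
  proof (rule nn_integral_mono)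
    fix u :: real
    show "(\<integral>\<^sup>+\<omega>. ennreal (?T \<omega> u) \<partial>M) \<le> ennreal (2 * ?D\<^sup>2 * sqrt (real n) * (damped C m u * sqrt (u * (1 - u))))"
    proof (cases "u \<in> {0<..<1}")
      case False
      then show ?thesis by (simp add: damped_def)
    next
      case True
      then have u: "0 \<le> u" "u \<le> 1" by auto
      have dev: "integrable M (\<lambda>\<omega>. \<bar>?N j \<omega> u - real n * u\<bar>)"
          "expectation (\<lambda>\<omega>. \<bar>?N j \<omega> u - real n * u\<bar>) \<le> sqrt (real n * (u * (1 - u)))" for j
        using indep_marks.hits_mean_deviation(1,2)[OF uniform_sequence.marks_atMost[OF U u], of j n]
        unfolding hit_count_atMost by auto
      let ?S = "\<lambda>\<omega>. damped C m u * (\<Sum>j\<in>UNIV. \<Sum>k\<in>UNIV. \<bar>?N j \<omega> u - real n * u\<bar> + \<bar>?N k \<omega> u - real n * u\<bar>)"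
      have Si: "integrable M ?S"
        by (intro integrable_mult_right Bochner_Integration.integrable_sum Bochner_Integration.integrable_add dev)
      have "?T \<omega> u \<le> ?S \<omega>" for \<omega>
        by (intro mult_left_mono sum_mono damped_nonneg C) linarith
      then have "(\<integral>\<^sup>+\<omega>. ennreal (?T \<omega> u) \<partial>M) \<le> (\<integral>\<^sup>+\<omega>. ennreal (?S \<omega>) \<partial>M)"
        by (intro nn_integral_mono ennreal_leI)
      also have "\<dots> = ennreal (expectation ?S)"
        by (rule nn_integral_eq_integral[OF Si]) (auto intro!: mult_nonneg_nonneg damped_nonneg C sum_nonneg)
      also have "expectation ?S = damped C m u * (\<Sum>j\<in>UNIV. \<Sum>k\<in>UNIV.
          expectation (\<lambda>\<omega>. \<bar>?N j \<omega> u - real n * u\<bar>) + expectation (\<lambda>\<omega>. \<bar>?N k \<omega> u - real n * u\<bar>))"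
        using dev(1) by (simp add: Bochner_Integration.integral_sum Bochner_Integration.integrable_sum)
      also have "\<dots> \<le> damped C m u * (\<Sum>j\<in>(UNIV::'d set). \<Sum>k\<in>(UNIV::'d set). sqrt (real n * (u * (1 - u))) + sqrt (real n * (u * (1 - u))))"
        by (intro mult_left_mono sum_mono add_mono dev(2) damped_nonneg C)
      also have "\<dots> = 2 * ?D\<^sup>2 * sqrt (real n) * (damped C m u * sqrt (u * (1 - u)))"
        by (simp add: real_sqrt_mult power2_eq_square)
      finally show ?thesis by (simp add: ennreal_leI)
    qed
  qed
  also have "\<dots> = ennreal (LINT u|lborel. 2 * ?D\<^sup>2 * sqrt (real n) * (damped C m u * sqrt (u * (1 - u))))"
  proof (rule nn_integral_eq_integral)
    show "integrable lborel (\<lambda>u. 2 * ?D\<^sup>2 * sqrt (real n) * (damped C m u * sqrt (u * (1 - u))))"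
      using damped_integral_tendsto(1)[OF C] by simp
    have "0 \<le> damped C m u * sqrt (u * (1 - u))" for u
      using damped_nonneg[OF C, of m u] by (cases "u \<in> {0<..<1}") (auto simp: damped_def)
    then show "AE u in lborel. 0 \<le> 2 * ?D\<^sup>2 * sqrt (real n) * (damped C m u * sqrt (u * (1 - u)))"
      by (intro AE_I2 mult_nonneg_nonneg[where a = "2 * ?D\<^sup>2 * sqrt (real n)"]) simp_all
  qed
  finally show "(\<integral>\<^sup>+\<omega>. Y \<omega> \<partial>M) \<le> ennreal (2 * ?D\<^sup>2 * sqrt (real n) * (LINT u|lborel. damped C m u * sqrt (u * (1 - u))))"
    by simp
qed


text \<open>The scale \<open>L\<close> of the comparison of ranks is fixed first and determines the
  constants of the remainder bound; then the mesh \<open>1 / m\<close> is chosen so fine that the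
  damped integral is small, and only then \<open>n\<close> is large.\<close>

theorem additive_remainder_negligible:
  fixes U :: "'d::finite \<Rightarrow> nat \<Rightarrow> 'a \<Rightarrow> real" and H :: "real ^ 'd \<Rightarrow> real"
  assumes "prob_space M" and U: "\<And>j. uniform_sequence M (U j)"
    and H: "\<And>M'. M' \<ge> M\<^sub>0 \<Longrightarrow> \<exists>K\<ge>0. \<exists>\<delta>>0. additive_remainder H q M' K \<delta>"
    and \<epsilon>: "\<epsilon> > 0" and \<eta>: "\<eta> > 0"
  shows "\<exists>n\<^sub>0. \<forall>n\<ge>n\<^sub>0. \<exists>A\<in>sets M. measure M A \<le> \<epsilon> \<and>
    (\<forall>\<omega>\<in>space M - A. (\<forall>j l. 0 < U j l \<omega> \<and> U j l \<omega> < 1) \<longrightarrow>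
       (\<Sum>i=1..n. \<bar>H (\<chi> j. order_stat (\<lambda>l. U j l \<omega>) n i)\<bar>) \<le> \<eta> * sqrt (real n))"
proof -
  interpret prob_space M by fact
  let ?D = "real CARD('d)"
  have D: "?D > 0" by simp
  define \<epsilon>' where "\<epsilon>' = \<epsilon> / (3 * ?D)"
  have \<epsilon>': "\<epsilon>' > 0" using \<epsilon> by (simp add: \<epsilon>'_def)
  have "\<forall>j. \<exists>L\<ge>1. \<forall>n\<ge>1. \<exists>A\<in>events. prob A \<le> \<epsilon>' \<and>
      (\<forall>\<omega>\<in>space M - A. (\<forall>l. 0 < U j l \<omega> \<and> U j l \<omega> < 1) \<longrightarrow> ranks_comparable L n (\<lambda>l. U j l \<omega>))"
    using uniform_sequence.ranks_comparable_whp[OF U \<epsilon>'] by metis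
  then obtain Lj where Lj: "\<And>j. Lj j \<ge> 1"
    "\<And>j n. n \<ge> 1 \<Longrightarrow> \<exists>A\<in>events. prob A \<le> \<epsilon>' \<and>
      (\<forall>\<omega>\<in>space M - A. (\<forall>l. 0 < U j l \<omega> \<and> U j l \<omega> < 1) \<longrightarrow> ranks_comparable (Lj j) n (\<lambda>l. U j l \<omega>))"
    by metis
  define L where "L = (\<Sum>j\<in>UNIV. Lj j)"
  have L: "Lj j \<le> L" for j
    unfolding L_def using Lj(1) by (intro member_le_sum) (auto intro: order_trans[OF zero_le_one])
  have L1: "L \<ge> 1" using Lj(1)[of undefined] L[of undefined] by linarith
  define C where "C = L\<^sup>2"
  have C1: "C \<ge> 1" using L1 by (simp add: C_def one_le_power)
  obtain K \<delta> where K: "K \<ge> 0" and \<delta>: "\<delta> > 0" and Hb: "additive_remainder H q (max M\<^sub>0 (C\<^sup>2 + 1)) K \<delta>"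
    using H[of "max M\<^sub>0 (C\<^sup>2 + 1)"] by auto
  define B where "B m = (LINT u|lborel. damped (3 * C\<^sup>2) m u * sqrt (u * (1 - u)))" for m
  have "B \<longlonglongrightarrow> 0" unfolding B_def[abs_def] by (rule damped_integral_tendsto(2)) simp
  then have "(\<lambda>m. (K + 1) * (2 * ?D\<^sup>2 * B m) / \<eta>) \<longlonglongrightarrow> (K + 1) * (2 * ?D\<^sup>2 * 0) / \<eta>"
    by (intro tendsto_intros) (use \<eta> in auto)
  then have ev1: "eventually (\<lambda>m. (K + 1) * (2 * ?D\<^sup>2 * B m) / \<eta> < \<epsilon> / 3) sequentially"
    by (rule order_tendstoD) (use \<epsilon> in simp)
  have "(\<lambda>m. 2 / real m) \<longlonglongrightarrow> 0" by (rule lim_const_over_n)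
  then have ev2: "eventually (\<lambda>m. 2 / real m < \<delta>) sequentially" by (rule order_tendstoD) (rule \<delta>)
  obtain m where m: "(K + 1) * (2 * ?D\<^sup>2 * B m) / \<eta> < \<epsilon> / 3" "2 / real m < \<delta>" "m \<ge> 1"
    using eventually_happens[OF eventually_conj[OF ev1 eventually_conj[OF ev2 eventually_ge_at_top[of 1]]]] by auto
  have "\<forall>j. \<exists>n0. \<forall>n\<ge>n0. \<exists>A\<in>events. prob A \<le> \<epsilon>' \<and> (\<forall>\<omega>\<in>space M - A. grid_close m n (\<lambda>l. U j l \<omega>))"
    using uniform_sequence.grid_close_whp[OF U \<epsilon>' m(3)] by metis
  then obtain nj where nj: "\<And>j n. n \<ge> nj j \<Longrightarrow> \<exists>A\<in>events. prob A \<le> \<epsilon>' \<and> (\<forall>\<omega>\<in>space M - A. grid_close m n (\<lambda>l. U j l \<omega>))"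
    by metis
  define n0 where "n0 = Suc (\<Sum>j\<in>UNIV. nj j)"
  have n0: "nj j \<le> n0" for j
    unfolding n0_def by (rule le_SucI, rule member_le_sum) auto
  show ?thesis
  proof (intro exI[of _ n0] allI impI)
    fix n assume n: "n \<ge> n0"
    then have n1: "n \<ge> 1" by (simp add: n0_def)
    obtain A1 where A1: "\<And>j. A1 j \<in> events" "\<And>j. prob (A1 j) \<le> \<epsilon>'"
      "\<And>j \<omega>. \<omega> \<in> space M - A1 j \<Longrightarrow> (\<forall>l. 0 < U j l \<omega> \<and> U j l \<omega> < 1) \<Longrightarrow> ranks_comparable (Lj j) n (\<lambda>l. U j l \<omega>)"
      using Lj(2)[OF n1] by metis
    have "\<forall>j. \<exists>A\<in>events. prob A \<le> \<epsilon>' \<and> (\<forall>\<omega>\<in>space M - A. grid_close m n (\<lambda>l. U j l \<omega>))"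
      using nj n0 n order_trans by blast
    then obtain A2 where A2: "\<And>j. A2 j \<in> events" "\<And>j. prob (A2 j) \<le> \<epsilon>'"
      "\<And>j \<omega>. \<omega> \<in> space M - A2 j \<Longrightarrow> grid_close m n (\<lambda>l. U j l \<omega>)"
      by metis
    define Y where "Y = (\<lambda>\<omega>. \<integral>\<^sup>+u. ennreal (damped (3 * C\<^sup>2) m u * count_spread (\<lambda>j l. U j l \<omega>) n u) \<partial>lborel)"
    have C3: "3 * C\<^sup>2 \<ge> 0" by simp
    have Ym [measurable]: "Y \<in> borel_measurable M"
      and Yi: "(\<integral>\<^sup>+\<omega>. Y \<omega> \<partial>M) \<le> ennreal (2 * ?D\<^sup>2 * sqrt (real n) * B m)"
      using damped_count_deviation[OF \<open>prob_space M\<close> _ C3, where U = U and m = m and n = n, OF U] unfolding Y_def B_def by auto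
    define c where "c = (K + 1) / (\<eta> * sqrt (real n))"
    have c: "c > 0" using K \<eta> n1 by (simp add: c_def)
    define A3 where "A3 = {\<omega> \<in> space M. 1 \<le> ennreal c * Y \<omega>}"
    have A3: "A3 \<in> events" unfolding A3_def by measurable
    have "emeasure M A3 \<le> ennreal c * (\<integral>\<^sup>+\<omega>. Y \<omega> * indicator (space M) \<omega> \<partial>M)"
      unfolding A3_def by (rule nn_integral_Markov_inequality) auto
    also have "(\<integral>\<^sup>+\<omega>. Y \<omega> * indicator (space M) \<omega> \<partial>M) = (\<integral>\<^sup>+\<omega>. Y \<omega> \<partial>M)"
      by (intro nn_integral_cong) simp
    also have "ennreal c * \<dots> \<le> ennreal c * ennreal (2 * ?D\<^sup>2 * sqrt (real n) * B m)"
      by (intro mult_left_mono Yi) simp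
    also have "\<dots> = ennreal (c * (2 * ?D\<^sup>2 * sqrt (real n) * B m))"
      using c by (simp add: ennreal_mult')
    also have "c * (2 * ?D\<^sup>2 * sqrt (real n) * B m) = (K + 1) * (2 * ?D\<^sup>2 * B m) / \<eta>"
      using n1 \<eta> unfolding c_def by (simp add: field_simps)
    also have "ennreal \<dots> \<le> ennreal (\<epsilon> / 3)" using m(1) by (intro ennreal_leI) simp
    finally have A3p: "prob A3 \<le> \<epsilon> / 3" using \<epsilon> by (simp add: emeasure_eq_measure)
    define A where "A = (\<Union>j. A1 j) \<union> (\<Union>j. A2 j) \<union> A3"
    have Ae: "A \<in> events" unfolding A_def using A1(1) A2(1) A3 by auto
    have U1: "prob (\<Union>j. A1 j) \<le> \<epsilon> / 3" "prob (\<Union>j. A2 j) \<le> \<epsilon> / 3"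
    proof -
      have "prob (\<Union>j\<in>UNIV. A1 j) \<le> (\<Sum>j\<in>UNIV. prob (A1 j))"
        using A1(1) by (intro finite_measure_subadditive_finite) auto
      also have "\<dots> \<le> (\<Sum>j\<in>(UNIV::'d set). \<epsilon>')" using A1(2) by (intro sum_mono) auto
      finally show "prob (\<Union>j. A1 j) \<le> \<epsilon> / 3" by (simp add: \<epsilon>'_def)
      have "prob (\<Union>j\<in>UNIV. A2 j) \<le> (\<Sum>j\<in>UNIV. prob (A2 j))"
        using A2(1) by (intro finite_measure_subadditive_finite) auto
      also have "\<dots> \<le> (\<Sum>j\<in>(UNIV::'d set). \<epsilon>')" using A2(2) by (intro sum_mono) auto
      finally show "prob (\<Union>j. A2 j) \<le> \<epsilon> / 3" by (simp add: \<epsilon>'_def)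
    qed
    have "prob A \<le> prob ((\<Union>j. A1 j) \<union> (\<Union>j. A2 j)) + prob A3"
      unfolding A_def using A1(1) A2(1) A3 by (intro measure_Un_le) auto
    also have "prob ((\<Union>j. A1 j) \<union> (\<Union>j. A2 j)) \<le> prob (\<Union>j. A1 j) + prob (\<Union>j. A2 j)"
      using A1(1) A2(1) by (intro measure_Un_le) auto
    finally have Ap: "prob A \<le> \<epsilon>" using U1 A3p by linarith
    have good: "(\<Sum>i=1..n. \<bar>H (\<chi> j. order_stat (\<lambda>l. U j l \<omega>) n i)\<bar>) \<le> \<eta> * sqrt (real n)"
      if \<omega>: "\<omega> \<in> space M - A" and U01: "\<forall>j l. 0 < U j l \<omega> \<and> U j l \<omega> < 1" for \<omega>
    proof -
      define x where "x j l = U j l \<omega>" for j l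
      have x01: "0 < x j l" "x j l < 1" for j l using U01 by (auto simp: x_def)
      have rc: "ranks_comparable L n (x j)" for j
      proof (rule ranks_comparable_mono[OF _ _ L n1])
        show "ranks_comparable (Lj j) n (x j)" unfolding x_def using A1(3)[of \<omega> j] \<omega> U01 by (auto simp: A_def)
        show "0 < Lj j" using Lj(1)[of j] by linarith
      qed
      have gc: "grid_close m n (x j)" for j unfolding x_def using A2(3)[of \<omega> j] \<omega> by (auto simp: A_def)
      define o' where "o' j i = order_stat (x j) n i" for j i
      define a where "a i = (MIN j. o' j i)" for i
      define b where "b i = (MAX j. o' j i)" for i
      have att: "\<exists>j. a i = o' j i" "\<exists>j. b i = o' j i" for i
      proof -
        have "a i \<in> range (\<lambda>j. o' j i)" unfolding a_def by (rule Min_in) auto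
        then show "\<exists>j. a i = o' j i" by blast
        have "b i \<in> range (\<lambda>j. o' j i)" unfolding b_def by (rule Max_in) auto
        then show "\<exists>j. b i = o' j i" by blast
      qed
      have ab: "a i \<le> o' j i" "o' j i \<le> b i" for i j unfolding a_def b_def by auto
      have o01: "0 < o' j i" "o' j i < 1" if "i \<in> {1..n}" for i j
        using order_stat_in_range[of i n "x j"] that x01 unfolding o'_def by auto
      have ratio: "o' k i \<le> C * o' j i" "1 - o' j i \<le> C * (1 - o' k i)" if i: "i \<in> {1..n}" for i j k
      proof -
        note r = rc[unfolded ranks_comparable_def, rule_format, OF i, folded o'_def]
        have n0: "real n > 0" using n1 by simp
        have e: "real v * L / real n = C * (real v / (real n * L))" for v
          using n0 L1 by (simp add: C_def power2_eq_square field_simps)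
        have "o' k i \<le> C * (real i / (real n * L))" using r[of k] unfolding e by blast
        also have "\<dots> \<le> C * o' j i" using r[of j] C1 by (intro mult_left_mono) auto
        finally show "o' k i \<le> C * o' j i" .
        have "1 - o' j i \<le> C * (real (n + 1 - i) / (real n * L))" using r[of j] unfolding e by blast
        also have "\<dots> \<le> C * (1 - o' k i)" using r[of k] C1 by (intro mult_left_mono) auto
        finally show "1 - o' j i \<le> C * (1 - o' k i)" .
      qed
      have close: "o' k i - o' j i \<le> 2 / real m" if i: "i \<in> {1..n}" for i j k
        unfolding o'_def using i x01 by (intro order_stat_diff_le_grid[OF m(3) _ _ gc gc]) auto
      have pos: "0 < a i" "a i \<le> b i" "b i < 1" "b i \<le> C * a i" "1 - a i \<le> C * (1 - b i)" "b i - a i \<le> 2 / real m"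
        if i: "i \<in> {1..n}" for i
      proof -
        obtain j k where jk: "a i = o' j i" "b i = o' k i" using att by metis
        show "0 < a i" "b i < 1" "a i \<le> b i" using o01[OF i] ab(1)[of i j] ab(2)[of j i] jk by auto
        show "b i \<le> C * a i" "1 - a i \<le> C * (1 - b i)" "b i - a i \<le> 2 / real m"
          unfolding jk using ratio[OF i] close[OF i] by auto
      qed
      have hb: "\<bar>H (\<chi> j. o' j i)\<bar> \<le> K * (b i - a i) * integral {a i..b i} q" if i: "i \<in> {1..n}" for i
      proof (rule Hb[unfolded additive_remainder_def, rule_format], intro conjI ballI allI)
        show "b i - a i < \<delta>" using pos(6)[OF i] m(2) by linarith
        fix u v assume u: "u \<in> {a i..b i}" and v: "v \<in> {a i..b i}"
        have "u * (1 - u) < (C\<^sup>2 + 1) * (v * (1 - v))"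
          by (rule comparable_interval(2)[OF pos(1-3)[OF i] C1 pos(4,5)[OF i]]) (use u v in auto)
        also have "\<dots> \<le> max M\<^sub>0 (C\<^sup>2 + 1) * (v * (1 - v))"
          using v pos[OF i] by (intro mult_right_mono) auto
        finally show "u * (1 - u) < max M\<^sub>0 (C\<^sup>2 + 1) * (v * (1 - v))" .
      qed (use pos[OF i] ab in auto)
      let ?S = "\<Sum>i=1..n. \<bar>H (\<chi> j. o' j i)\<bar>"
      have "ennreal ?S \<le> ennreal K * Y \<omega>"
        unfolding Y_def x_def[symmetric]
        by (rule sum_interval_bounds_le[where a = a and b = b and x = x and C = C])
          (use K C1 m(3) pos hb att in \<open>auto simp: o'_def x_def[abs_def]\<close>)
      also have "\<dots> \<le> ennreal (K + 1) * Y \<omega>" using K by (intro mult_right_mono ennreal_leI) auto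
      finally have S1: "ennreal ?S \<le> ennreal (K + 1) * Y \<omega>" .
      have "ennreal c * Y \<omega> < 1" using \<omega> by (auto simp: A_def A3_def not_le)
      moreover have cK: "ennreal (K + 1) = ennreal (\<eta> * sqrt (real n)) * ennreal c"
        using K \<eta> n1 by (simp add: c_def ennreal_mult'[symmetric])
      ultimately have "ennreal (K + 1) * Y \<omega> \<le> ennreal (\<eta> * sqrt (real n)) * 1"
        unfolding cK mult.assoc by (intro mult_left_mono) auto
      with S1 have "ennreal ?S \<le> ennreal (\<eta> * sqrt (real n))" by simp
      then have "?S \<le> \<eta> * sqrt (real n)" using \<eta> by (subst (asm) ennreal_le_iff) auto
      then show ?thesis unfolding o'_def x_def .
    qed
    show "\<exists>A\<in>sets M. measure M A \<le> \<epsilon> \<and>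
      (\<forall>\<omega>\<in>space M - A. (\<forall>j l. 0 < U j l \<omega> \<and> U j l \<omega> < 1) \<longrightarrow>
        (\<Sum>i=1..n. \<bar>H (\<chi> j. order_stat (\<lambda>l. U j l \<omega>) n i)\<bar>) \<le> \<eta> * sqrt (real n))"
      using Ae Ap good by (intro bexI[of _ A]) auto
  qed
qed

end

section \<open>Centred primitives and their covariances\<close>

text \<open>The function \<open>arcsin (2 x - 1)\<close> is a bounded primitive.\<close>

lemma inverse_sqrt_weight_integrable:
  "set_integrable lborel {0<..<1} (\<lambda>x::real. 1 / sqrt (x * (1 - x)))"
proof -
  have eq: "(sqrt (x * (1 - x))) * 2 = sqrt (1 - (2 * x - 1)\<^sup>2)" for x :: real
  proof -
    have "1 - (2 * x - 1)\<^sup>2 = (x * (1 - x)) * 2\<^sup>2" by (simp add: power2_eq_square algebra_simps)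
    then show ?thesis by (simp only: real_sqrt_mult real_sqrt_abs abs_numeral)
  qed
  have "set_integrable lborel (einterval 0 1) (\<lambda>x::real. 1 / sqrt (x * (1 - x)))"
  proof (rule interval_integral_FTC_nonneg(1)[where F = "\<lambda>x. arcsin (2 * x - 1)" and A = "arcsin (-1)" and B = "arcsin 1"])
    fix x assume "ereal x > 0" "ereal x < 1"
    then have x: "0 < x" "x < 1" by auto
    have "DERIV arcsin (2 * x - 1) :> inverse (sqrt (1 - (2 * x - 1)\<^sup>2))"
      by (rule DERIV_arcsin) (use x in auto)
    moreover have "((\<lambda>x. 2 * x - 1) has_real_derivative 2) (at x)" by (auto intro!: derivative_eq_intros)
    ultimately have "((\<lambda>x. arcsin (2 * x - 1)) has_real_derivative inverse (sqrt (1 - (2 * x - 1)\<^sup>2)) * 2) (at x)"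
      by (rule DERIV_chain2)
    moreover have "inverse (sqrt (1 - (2 * x - 1)\<^sup>2)) * 2 = 1 / sqrt (x * (1 - x))"
      unfolding eq[symmetric] using x by (simp add: field_simps)
    ultimately show "((\<lambda>x. arcsin (2 * x - 1)) has_real_derivative 1 / sqrt (x * (1 - x))) (at x)" by simp
    show "isCont (\<lambda>x. 1 / sqrt (x * (1 - x))) x" using x by (intro continuous_intros) auto
  next
    have c: "continuous_on {0..1} (\<lambda>x::real. arcsin (2 * x - 1))"
      by (intro continuous_intros) auto
    have "((\<lambda>x::real. arcsin (2 * x - 1)) \<longlongrightarrow> arcsin (- 1)) (at 0 within {0..1})"
      using c[unfolded continuous_on_def, rule_format, of 0] by simp
    then show "(((\<lambda>x. arcsin (2 * x - 1)) \<circ> real_of_ereal) \<longlongrightarrow> arcsin (- 1)) (at_right 0)"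
      unfolding zero_ereal_def by (simp add: ereal_tendsto_simps at_within_Icc_at_right)
    have "((\<lambda>x::real. arcsin (2 * x - 1)) \<longlongrightarrow> arcsin 1) (at 1 within {0..1})"
      using c[unfolded continuous_on_def, rule_format, of 1] by simp
    then show "(((\<lambda>x. arcsin (2 * x - 1)) \<circ> real_of_ereal) \<longlongrightarrow> arcsin 1) (at_left 1)"
      unfolding one_ereal_def by (simp add: ereal_tendsto_simps at_within_Icc_at_left)
  next
    show "AE x in lborel. 0 < ereal x \<longrightarrow> ereal x < 1 \<longrightarrow> 0 \<le> 1 / sqrt (x * (1 - x))"
      by (intro AE_I2) simp
  qed simp
  moreover have "einterval 0 1 = {0<..<1::real}" by (auto simp: einterval_def)
  ultimately show ?thesis by simp
qed

text \<open>The weight \<open>(x (1 - x))\<^sup>1\<^sup>/\<^sup>2\<close> is the standard deviation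
  of the indicator of \<open>U \<le> x\<close> for a uniform variable \<open>U\<close>;
  integrability against it makes the covariance integrals converge.\<close>

definition unit_supported :: "(real \<Rightarrow> real) \<Rightarrow> bool" where
  "unit_supported P \<longleftrightarrow> P \<in> borel_measurable borel \<and> (\<forall>x. x \<notin> {0<..<1} \<longrightarrow> P x = 0) \<and>
     integrable lborel (\<lambda>x. sqrt (x * (1 - x)) * \<bar>P x\<bar>)"

text \<open>A product is at most the sum of the squares: \<open>w\<^sup>1\<^sup>/\<^sup>2
  \<bar>p\<bar> \<le> w\<^sup>3\<^sup>/\<^sup>2 p\<^sup>2 +
  w\<^sup>-\<^sup>1\<^sup>/\<^sup>2\<close>, and \<open>w\<^sup>-\<^sup>1\<^sup>/\<^sup>2\<close> is
  integrable.\<close>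

lemma unit_supportedI:
  assumes p: "continuous_on {0<..<1} p"
    and int: "set_integrable lborel {0<..<1} (\<lambda>x. (x * (1 - x)) powr (3 / 2) * (p x)\<^sup>2)"
  shows "unit_supported (\<lambda>x. indicator {0<..<1} x * p x)"
proof -
  let ?P = "\<lambda>x. indicator {0<..<1} x * p x :: real"
  have [measurable]: "?P \<in> borel_measurable borel"
    using borel_measurable_continuous_on_indicator[OF _ p] by simp
  have "integrable lborel (\<lambda>x. sqrt (x * (1 - x)) * \<bar>?P x\<bar>)"
  proof (rule Bochner_Integration.integrable_bound)
    show "integrable lborel (\<lambda>x. indicator {0<..<1} x *\<^sub>R ((x * (1 - x)) powr (3 / 2) * (p x)\<^sup>2) + indicator {0<..<1} x *\<^sub>R (1 / sqrt (x * (1 - x))))"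
      using int inverse_sqrt_weight_integrable unfolding set_integrable_def by (rule Bochner_Integration.integrable_add)
    have "sqrt w * \<bar>a\<bar> \<le> w powr (3 / 2) * a\<^sup>2 + 1 / sqrt w" if w: "w > 0" for w a :: real
    proof -
      have s: "sqrt w > 0" "w powr (3 / 2) = sqrt w * w" "w = (sqrt w)\<^sup>2"
        using w powr_add[of w 1 "1 / 2"] by (auto simp: powr_half_sqrt)
      define v where "v = sqrt w"
      have v: "v > 0" "w = v\<^sup>2" using s by (auto simp: v_def)
      have "v\<^sup>2 * \<bar>a\<bar> \<le> (v\<^sup>2 * \<bar>a\<bar>)\<^sup>2 + 1"
      proof -
        have "2 * (v\<^sup>2 * \<bar>a\<bar>) \<le> (v\<^sup>2 * \<bar>a\<bar>)\<^sup>2 + 1" using sum_squares_bound[of "v\<^sup>2 * \<bar>a\<bar>" 1] by simp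
        moreover have "0 \<le> v\<^sup>2 * \<bar>a\<bar>" by simp
        ultimately show ?thesis by linarith
      qed
      then have "v * \<bar>a\<bar> \<le> ((v\<^sup>2 * \<bar>a\<bar>)\<^sup>2 + 1) / v"
        using v by (simp add: pos_le_divide_eq power2_eq_square mult_ac)
      also have "\<dots> = v * v\<^sup>2 * a\<^sup>2 + 1 / v"
        using v by (simp add: add_divide_distrib power2_eq_square)
      finally show ?thesis using s(2) v unfolding v_def by simp
    qed
    then show "AE x in lborel. norm (sqrt (x * (1 - x)) * \<bar>?P x\<bar>) \<le> norm (indicator {0<..<1} x *\<^sub>R ((x * (1 - x)) powr (3 / 2) * (p x)\<^sup>2) + indicator {0<..<1} x *\<^sub>R (1 / sqrt (x * (1 - x))))"
      by (intro AE_I2) (auto simp: indicator_def abs_mult abs_of_nonneg)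
  qed simp
  moreover have "\<forall>x. x \<notin> {0<..<1} \<longrightarrow> ?P x = 0" by simp
  ultimately show ?thesis unfolding unit_supported_def using \<open>?P \<in> borel_measurable borel\<close> by blast
qed

text \<open>The primitive of \<open>P\<close> with mean 0 under the uniform distribution, written as
  an integral so that covariances can be computed by exchanging integrals.\<close>

definition centred_primitive :: "(real \<Rightarrow> real) \<Rightarrow> real \<Rightarrow> real" where
  "centred_primitive P u = - (LINT x|lborel. (indicator {..x} u - x) * P x)"

lemma centred_primitive_measurable [measurable]:
  assumes [measurable]: "P \<in> borel_measurable borel"
  shows "centred_primitive P \<in> borel_measurable borel"
proof -
  have "(\<lambda>u. LINT x|lborel. ((if u \<le> x then 1 else 0) - x) * P x) \<in> borel_measurable borel"
    by measurable
  then show ?thesis unfolding centred_primitive_def[abs_def] indicator_def by simp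
qed

text \<open>Near 0 the kernel is \<open>x\<close> and near 1 it is \<open>1 - x\<close> in absolute
  value, both bounded by a multiple of \<open>(x (1 - x))\<^sup>1\<^sup>/\<^sup>2\<close> that
  depends on \<open>u\<close>.\<close>

lemma centred_kernel_integrable:
  assumes P: "unit_supported P" and u: "0 < u" "u < 1"
  shows "integrable lborel (\<lambda>x. (indicator {..x} u - x) * P x)"
proof -
  have [measurable]: "P \<in> borel_measurable borel" and P0: "\<And>x. x \<notin> {0<..<1} \<Longrightarrow> P x = 0"
    and int: "integrable lborel (\<lambda>x. sqrt (x * (1 - x)) * \<bar>P x\<bar>)"
    using P unfolding unit_supported_def by auto
  define C where "C = 1 / sqrt u + 1 / sqrt (1 - u)"
  have C: "1 / sqrt u \<le> C" "1 / sqrt (1 - u) \<le> C" using u by (auto simp: C_def)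
  have bound: "\<bar>(indicator {..x} u - x) * P x\<bar> \<le> C * (sqrt (x * (1 - x)) * \<bar>P x\<bar>)" for x
  proof (cases "x \<in> {0<..<1}")
    case False then show ?thesis using P0[OF False] by simp
  next
    case True
    then have x: "0 < x" "x < 1" by auto
    have s: "sqrt (x * (1 - x)) = sqrt x * sqrt (1 - x)" "sqrt x * sqrt x = x" "sqrt (1 - x) * sqrt (1 - x) = 1 - x"
      using x by (auto simp: real_sqrt_mult)
    have "\<bar>indicator {..x} u - x\<bar> \<le> C * sqrt (x * (1 - x))"
    proof (cases "u \<le> x")
      case True
      have "sqrt (1 - x) \<le> 1" "1 \<le> sqrt x / sqrt u" using True u x by auto
      then have "sqrt (1 - x) \<le> sqrt x / sqrt u" by (rule order_trans)
      then have "sqrt (1 - x) * sqrt (1 - x) \<le> sqrt (1 - x) * (sqrt x / sqrt u)"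
        using x by (intro mult_left_mono) auto
      then have "1 - x \<le> sqrt (1 - x) * (sqrt x / sqrt u)" unfolding s(3) .
      also have "\<dots> = 1 / sqrt u * sqrt (x * (1 - x))" unfolding s(1) by simp
      also have "\<dots> \<le> C * sqrt (x * (1 - x))" using C x by (intro mult_right_mono) auto
      finally show ?thesis using True x by simp
    next
      case False
      have "sqrt x \<le> 1" "1 \<le> sqrt (1 - x) / sqrt (1 - u)" using False u x by auto
      then have "sqrt x \<le> sqrt (1 - x) / sqrt (1 - u)" by (rule order_trans)
      then have "sqrt x * sqrt x \<le> sqrt x * (sqrt (1 - x) / sqrt (1 - u))"
        using x by (intro mult_left_mono) auto
      then have "x \<le> sqrt x * (sqrt (1 - x) / sqrt (1 - u))" unfolding s(2) .
      also have "\<dots> = 1 / sqrt (1 - u) * sqrt (x * (1 - x))" unfolding s(1) by simp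
      also have "\<dots> \<le> C * sqrt (x * (1 - x))" using C x by (intro mult_right_mono) auto
      finally show ?thesis using False x by simp
    qed
    then have "\<bar>indicator {..x} u - x\<bar> * \<bar>P x\<bar> \<le> C * sqrt (x * (1 - x)) * \<bar>P x\<bar>" by (intro mult_right_mono) auto
    then show ?thesis by (simp add: abs_mult mult.assoc)
  qed
  show ?thesis
  proof (rule Bochner_Integration.integrable_bound)
    show "integrable lborel (\<lambda>x. C * (sqrt (x * (1 - x)) * \<bar>P x\<bar>))" using int by simp
    have "(\<lambda>x. ((if u \<le> x then 1 else 0) - x) * P x) \<in> borel_measurable lborel" by measurable
    then show "(\<lambda>x. (indicator {..x} u - x) * P x) \<in> borel_measurable lborel" unfolding indicator_def by simp
    show "AE x in lborel. norm ((indicator {..x} u - x) * P x) \<le> norm (C * (sqrt (x * (1 - x)) * \<bar>P x\<bar>))"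
      unfolding real_norm_def by (intro AE_I2 order_trans[OF bound abs_ge_self])
  qed
qed

lemma centred_primitive_increment:
  assumes P: "unit_supported P" and ab: "0 < a" "a \<le> b" "b < 1"
  shows "centred_primitive P b - centred_primitive P a = integral {a..b} P"
proof -
  have [measurable]: "P \<in> borel_measurable borel" using P unfolding unit_supported_def by auto
  have ia: "integrable lborel (\<lambda>x. (indicator {..x} a - x) * P x)" and ib: "integrable lborel (\<lambda>x. (indicator {..x} b - x) * P x)"
    using centred_kernel_integrable[OF P] ab by auto
  have "centred_primitive P b - centred_primitive P a =
      (LINT x|lborel. (indicator {..x} a - x) * P x - (indicator {..x} b - x) * P x)"
    unfolding centred_primitive_def Bochner_Integration.integral_diff[OF ia ib] by simp
  have eq: "(indicator {..x} a - x) * P x - (indicator {..x} b - x) * P x = indicator {a..<b} x * P x" for x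
    using ab by (auto simp: indicator_def algebra_simps)
  have i1: "integrable lborel (\<lambda>x. indicator {a..<b} x * P x)"
    using Bochner_Integration.integrable_diff[OF ia ib] unfolding eq .
  have ae: "AE x in lborel. indicator {a..<b} x * P x = indicator {a..b} x *\<^sub>R P x"
    by (rule AE_mp[OF AE_lborel_singleton[of b]]) (auto simp: indicator_def)
  have "set_integrable lborel {a..b} P"
    unfolding set_integrable_def using i1 by (rule integrable_cong_AE_imp) (use ae in auto)
  then have "(LINT x:{a..b}|lborel. P x) = integral {a..b} P"
    by (rule set_borel_integral_eq_integral)
  moreover have "(LINT x|lborel. indicator {a..<b} x * P x) = (LINT x:{a..b}|lborel. P x)"
    unfolding set_lebesgue_integral_def by (rule integral_cong_AE) (use ae in auto)
  moreover have "centred_primitive P b - centred_primitive P a = (LINT x|lborel. indicator {a..<b} x * P x)"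
    unfolding centred_primitive_def eq[symmetric] Bochner_Integration.integral_diff[OF ia ib] by simp
  ultimately show ?thesis by simp
qed

lemma integrable_tensor_lborel:
  fixes f g :: "real \<Rightarrow> real"
  assumes f: "integrable lborel f" and g: "integrable lborel g"
  shows "integrable (lborel \<Otimes>\<^sub>M lborel) (\<lambda>(x, y). f x * g y)"
proof (rule lborel_pair.Fubini_integrable)
  have [measurable]: "f \<in> borel_measurable borel" "g \<in> borel_measurable borel" using f g by auto
  show "(\<lambda>(x, y). f x * g y) \<in> borel_measurable (lborel \<Otimes>\<^sub>M lborel)" by measurable
  have "integrable lborel (\<lambda>x. \<bar>f x\<bar> * (LINT y|lborel. \<bar>g y\<bar>))" using f by (intro integrable_mult_left integrable_abs)
  then show "integrable lborel (\<lambda>x. LINT y|lborel. norm (case (x, y) of (x, y) \<Rightarrow> f x * g y))" by (simp add: abs_mult)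
  show "AE x in lborel. integrable lborel (\<lambda>y. case (x, y) of (x, y) \<Rightarrow> f x * g y)" using g by simp
qed

locale uniform_pair = prob_space M for M :: "'a measure" +
  fixes U U' :: "'a \<Rightarrow> real"
  assumes U_meas [measurable]: "random_variable borel U" and U'_meas [measurable]: "random_variable borel U'"
    and U_unif: "\<And>t. 0 \<le> t \<Longrightarrow> t \<le> 1 \<Longrightarrow> prob {\<omega> \<in> space M. U \<omega> \<le> t} = t"
    and U'_unif: "\<And>t. 0 \<le> t \<Longrightarrow> t \<le> 1 \<Longrightarrow> prob {\<omega> \<in> space M. U' \<omega> \<le> t} = t"
begin

definition copula :: "real \<Rightarrow> real \<Rightarrow> real" where
  "copula x y = prob {\<omega> \<in> space M. U \<omega> \<le> x \<and> U' \<omega> \<le> y}"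

lemma indicator_expectation:
  assumes "0 \<le> x" "x \<le> 1"
  shows "expectation (\<lambda>\<omega>. indicator {..x} (U \<omega>)) = x" "expectation (\<lambda>\<omega>. indicator {..x} (U' \<omega>)) = x"
proof -
  have "(\<lambda>\<omega>. indicator {..x} (U \<omega>)) = (\<lambda>\<omega>. indicator (U -` {..x}) \<omega> :: real)" by (simp add: fun_eq_iff indicator_def)
  then have "expectation (\<lambda>\<omega>. indicator {..x} (U \<omega>)) = prob (U -` {..x} \<inter> space M)" by simp
  also have "U -` {..x} \<inter> space M = {\<omega> \<in> space M. U \<omega> \<le> x}" by auto
  finally show "expectation (\<lambda>\<omega>. indicator {..x} (U \<omega>)) = x" using U_unif[OF assms] by simp
  have "(\<lambda>\<omega>. indicator {..x} (U' \<omega>)) = (\<lambda>\<omega>. indicator (U' -` {..x}) \<omega> :: real)" by (simp add: fun_eq_iff indicator_def)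
  then have "expectation (\<lambda>\<omega>. indicator {..x} (U' \<omega>)) = prob (U' -` {..x} \<inter> space M)" by simp
  also have "U' -` {..x} \<inter> space M = {\<omega> \<in> space M. U' \<omega> \<le> x}" by auto
  finally show "expectation (\<lambda>\<omega>. indicator {..x} (U' \<omega>)) = x" using U'_unif[OF assms] by simp
qed

lemma indicator_integrable:
  "integrable M (\<lambda>\<omega>. indicator {..x} (U \<omega>) :: real)" "integrable M (\<lambda>\<omega>. indicator {..y} (U' \<omega>) :: real)"
  "integrable M (\<lambda>\<omega>. indicator {..x} (U \<omega>) * indicator {..y} (U' \<omega>) :: real)"
  by (rule integrable_const_bound[of _ 1]; auto simp: indicator_def)+

lemma kernel_product_expectation:
  assumes "0 \<le> x" "x \<le> 1" "0 \<le> y" "y \<le> 1"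
  shows "expectation (\<lambda>\<omega>. (indicator {..x} (U \<omega>) - x) * (indicator {..y} (U' \<omega>) - y)) = copula x y - x * y"
proof -
  have "(\<lambda>\<omega>. indicator {..x} (U \<omega>) * indicator {..y} (U' \<omega>)) = (\<lambda>\<omega>. indicator {\<omega>. U \<omega> \<le> x \<and> U' \<omega> \<le> y} \<omega> :: real)"
    by (simp add: fun_eq_iff indicator_def)
  then have "expectation (\<lambda>\<omega>. indicator {..x} (U \<omega>) * indicator {..y} (U' \<omega>)) = prob ({\<omega>. U \<omega> \<le> x \<and> U' \<omega> \<le> y} \<inter> space M)"
    by simp
  also have "{\<omega>. U \<omega> \<le> x \<and> U' \<omega> \<le> y} \<inter> space M = {\<omega> \<in> space M. U \<omega> \<le> x \<and> U' \<omega> \<le> y}" by auto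
  finally have 1: "expectation (\<lambda>\<omega>. indicator {..x} (U \<omega>) * indicator {..y} (U' \<omega>)) = copula x y"
    unfolding copula_def .
  have "(\<lambda>\<omega>. (indicator {..x} (U \<omega>) - x) * (indicator {..y} (U' \<omega>) - y)) =
      (\<lambda>\<omega>. indicator {..x} (U \<omega>) * indicator {..y} (U' \<omega>) - y * indicator {..x} (U \<omega>) - x * indicator {..y} (U' \<omega>) + x * y :: real)"
    by (simp add: fun_eq_iff algebra_simps)
  then show ?thesis
    using indicator_expectation[OF assms(1,2)] indicator_expectation[OF assms(3,4)] indicator_integrable 1
    by (simp add: prob_space)
qed

lemma kernel_square_expectation:
  assumes "0 \<le> x" "x \<le> 1"
  shows "expectation (\<lambda>\<omega>. (indicator {..x} (U \<omega>) - x)\<^sup>2) = x * (1 - x)"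
    "expectation (\<lambda>\<omega>. (indicator {..x} (U' \<omega>) - x)\<^sup>2) = x * (1 - x)"
proof -
  have eq: "(indicator A u - x)\<^sup>2 = (1 - 2 * x) * indicator A u + x\<^sup>2" for A and u :: real
    by (auto simp: indicator_def power2_eq_square algebra_simps)
  show "expectation (\<lambda>\<omega>. (indicator {..x} (U \<omega>) - x)\<^sup>2) = x * (1 - x)"
    "expectation (\<lambda>\<omega>. (indicator {..x} (U' \<omega>) - x)\<^sup>2) = x * (1 - x)"
    unfolding eq using indicator_expectation[OF assms] indicator_integrable
    by (simp_all add: prob_space power2_eq_square algebra_simps)
qed

text \<open>The Cauchy--Schwarz inequality, in the form of the weighted inequality between
  arithmetic and geometric mean.\<close>

lemma kernel_product_abs_le:
  assumes "0 < x" "x < 1" "0 < y" "y < 1"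
  shows "expectation (\<lambda>\<omega>. \<bar>(indicator {..x} (U \<omega>) - x) * (indicator {..y} (U' \<omega>) - y)\<bar>) \<le> sqrt (x * (1 - x)) * sqrt (y * (1 - y))"
proof -
  define r s where "r = sqrt (x * (1 - x))" and "s = sqrt (y * (1 - y))"
  have rs: "r > 0" "s > 0" "r\<^sup>2 = x * (1 - x)" "s\<^sup>2 = y * (1 - y)" using assms by (auto simp: r_def s_def)
  let ?a = "\<lambda>\<omega>. indicator {..x} (U \<omega>) - x" and ?b = "\<lambda>\<omega>. indicator {..y} (U' \<omega>) - y"
  have le: "\<bar>a * b\<bar> \<le> (s / r * a\<^sup>2 + r / s * b\<^sup>2) / 2" for a b :: real
  proof -
    have "0 \<le> (s * \<bar>a\<bar> - r * \<bar>b\<bar>)\<^sup>2 / (r * s)" using rs by simp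
    also have "\<dots> = s / r * a\<^sup>2 + r / s * b\<^sup>2 - 2 * \<bar>a * b\<bar>"
      using rs by (simp add: power2_eq_square abs_mult field_simps)
    finally show ?thesis by simp
  qed
  have int: "integrable M (\<lambda>\<omega>. (?a \<omega>)\<^sup>2)" "integrable M (\<lambda>\<omega>. (?b \<omega>)\<^sup>2)" "integrable M (\<lambda>\<omega>. \<bar>?a \<omega> * ?b \<omega>\<bar>)"
  proof -
    have k: "\<bar>indicator A u - z\<bar> \<le> 1" if "0 < z" "z < 1" for A and u z :: real using that by (auto simp: indicator_def)
    have "\<bar>?a \<omega> * ?b \<omega>\<bar> \<le> 1" for \<omega>
      unfolding abs_mult using k[of x] k[of y] assms by (intro mult_le_one) auto
    then show "integrable M (\<lambda>\<omega>. \<bar>?a \<omega> * ?b \<omega>\<bar>)" by (intro integrable_const_bound[of _ 1]) auto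
    show "integrable M (\<lambda>\<omega>. (?a \<omega>)\<^sup>2)" "integrable M (\<lambda>\<omega>. (?b \<omega>)\<^sup>2)"
      using k[of x] k[of y] assms by (auto intro!: integrable_const_bound[of _ 1] simp: abs_square_le_1)
  qed
  have "expectation (\<lambda>\<omega>. \<bar>?a \<omega> * ?b \<omega>\<bar>) \<le> expectation (\<lambda>\<omega>. (s / r * (?a \<omega>)\<^sup>2 + r / s * (?b \<omega>)\<^sup>2) / 2)"
    using int le by (intro integral_mono) auto
  also have "\<dots> = (s / r * r\<^sup>2 + r / s * s\<^sup>2) / 2"
    unfolding rs(3,4) using int kernel_square_expectation[of x] kernel_square_expectation[of y] assms by simp
  also have "\<dots> = r * s" using rs(1,2) by (simp add: power2_eq_square)
  finally show ?thesis unfolding r_def s_def .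
qed

lemma copula_integrable:
  assumes P: "unit_supported P" and Q: "unit_supported Q"
  shows "integrable (M \<Otimes>\<^sub>M (lborel \<Otimes>\<^sub>M lborel)) (\<lambda>(\<omega>, x, y). (indicator {..x} (U \<omega>) - x) * P x * ((indicator {..y} (U' \<omega>) - y) * Q y))"
proof -
  have [measurable]: "P \<in> borel_measurable borel" "Q \<in> borel_measurable borel"
    and P0: "\<And>x. x \<notin> {0<..<1} \<Longrightarrow> P x = 0" and Q0: "\<And>x. x \<notin> {0<..<1} \<Longrightarrow> Q x = 0"
    and Pi: "integrable lborel (\<lambda>x. sqrt (x * (1 - x)) * \<bar>P x\<bar>)" and Qi: "integrable lborel (\<lambda>x. sqrt (x * (1 - x)) * \<bar>Q x\<bar>)"
    using P Q unfolding unit_supported_def by auto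
  let ?f = "\<lambda>(\<omega>, x, y). (indicator {..x} (U \<omega>) - x) * P x * ((indicator {..y} (U' \<omega>) - y) * Q y)"
  let ?g = "\<lambda>(x, y). (sqrt (x * (1 - x)) * \<bar>P x\<bar>) * (sqrt (y * (1 - y)) * \<bar>Q y\<bar>)"
  have m: "?f \<in> borel_measurable (M \<Otimes>\<^sub>M (lborel \<Otimes>\<^sub>M lborel))"
  proof -
    have "(\<lambda>(\<omega>, x, y). ((if U \<omega> \<le> x then 1 else 0) - x) * P x * (((if U' \<omega> \<le> y then 1 else 0) - y) * Q y)) \<in> borel_measurable (M \<Otimes>\<^sub>M (lborel \<Otimes>\<^sub>M lborel))"
      by measurable
    then show ?thesis unfolding indicator_def by simp
  qed
  interpret LL: sigma_finite_measure "lborel \<Otimes>\<^sub>M lborel :: (real \<times> real) measure" by (rule sigma_finite_pair_measure) unfold_locales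
  interpret MB: pair_sigma_finite M "lborel \<Otimes>\<^sub>M lborel :: (real \<times> real) measure" by unfold_locales
  interpret BM: pair_sigma_finite "lborel \<Otimes>\<^sub>M lborel :: (real \<times> real) measure" M by unfold_locales
  have gi: "integrable (lborel \<Otimes>\<^sub>M lborel) ?g"
    by (rule integrable_tensor_lborel[OF Pi Qi])
  have int1: "integrable M (\<lambda>\<omega>. ?f (\<omega>, x, y))" for x y
  proof -
    have "integrable M (\<lambda>\<omega>. (indicator {..x} (U \<omega>) * indicator {..y} (U' \<omega>) - y * indicator {..x} (U \<omega>) - x * indicator {..y} (U' \<omega>) + x * y) * (P x * Q y) :: real)"
      using indicator_integrable by (intro integrable_mult_left Bochner_Integration.integrable_add Bochner_Integration.integrable_diff integrable_mult_right) auto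
    then show ?thesis by (simp add: algebra_simps)
  qed
  have "integrable ((lborel \<Otimes>\<^sub>M lborel) \<Otimes>\<^sub>M M) (\<lambda>(z, \<omega>). ?f (\<omega>, z))"
  proof (rule BM.Fubini_integrable)
    show "(\<lambda>(z, \<omega>). ?f (\<omega>, z)) \<in> borel_measurable ((lborel \<Otimes>\<^sub>M lborel) \<Otimes>\<^sub>M M)"
      using measurable_pair_swap[OF m] by (simp add: case_prod_beta')
    show "AE z in lborel \<Otimes>\<^sub>M lborel. integrable M (\<lambda>\<omega>. case (z, \<omega>) of (z, \<omega>) \<Rightarrow> ?f (\<omega>, z))"
      using int1 by (intro AE_I2) (auto simp: case_prod_beta')
    show "integrable (lborel \<Otimes>\<^sub>M lborel) (\<lambda>z. LINT \<omega>|M. norm (case (z, \<omega>) of (z, \<omega>) \<Rightarrow> ?f (\<omega>, z)))"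
    proof (rule Bochner_Integration.integrable_bound[OF gi])
      have "(\<lambda>(z, \<omega>). norm (?f (\<omega>, z))) \<in> borel_measurable ((lborel \<Otimes>\<^sub>M lborel) \<Otimes>\<^sub>M M)"
        using measurable_pair_swap[OF m] by (simp add: case_prod_beta')
      then show "(\<lambda>z. LINT \<omega>|M. norm (case (z, \<omega>) of (z, \<omega>) \<Rightarrow> ?f (\<omega>, z))) \<in> borel_measurable (lborel \<Otimes>\<^sub>M lborel)"
        by (intro borel_measurable_lebesgue_integral) (simp add: case_prod_beta')
      have "\<bar>LINT \<omega>|M. \<bar>?f (\<omega>, x, y)\<bar>\<bar> \<le> \<bar>?g (x, y)\<bar>" for x y
      proof (cases "x \<in> {0<..<1} \<and> y \<in> {0<..<1}")
        case False
        then show ?thesis using P0[of x] Q0[of y] by auto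
      next
        case True
        have "(LINT \<omega>|M. \<bar>?f (\<omega>, x, y)\<bar>) = (LINT \<omega>|M. \<bar>(indicator {..x} (U \<omega>) - x) * (indicator {..y} (U' \<omega>) - y)\<bar> * \<bar>P x * Q y\<bar>)"
          by (intro Bochner_Integration.integral_cong) (auto simp: abs_mult mult_ac)
        also have "\<dots> = (LINT \<omega>|M. \<bar>(indicator {..x} (U \<omega>) - x) * (indicator {..y} (U' \<omega>) - y)\<bar>) * \<bar>P x * Q y\<bar>"
          by (rule integral_mult_left_zero)
        also have "\<dots> \<le> (sqrt (x * (1 - x)) * sqrt (y * (1 - y))) * \<bar>P x * Q y\<bar>"
          using True by (intro mult_right_mono kernel_product_abs_le) auto
        also have "\<dots> = ?g (x, y)" by (simp add: abs_mult)
        finally have "(LINT \<omega>|M. \<bar>?f (\<omega>, x, y)\<bar>) \<le> ?g (x, y)" .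
        moreover have "0 \<le> (LINT \<omega>|M. \<bar>?f (\<omega>, x, y)\<bar>)" by (intro Bochner_Integration.integral_nonneg) simp
        ultimately show ?thesis by linarith
      qed
      then show "AE z in lborel \<Otimes>\<^sub>M lborel. norm (LINT \<omega>|M. norm (case (z, \<omega>) of (z, \<omega>) \<Rightarrow> ?f (\<omega>, z))) \<le> norm (?g z)"
        by (intro AE_I2) (simp add: case_prod_beta')
    qed
  qed
  then have "integrable (M \<Otimes>\<^sub>M (lborel \<Otimes>\<^sub>M lborel)) (\<lambda>(\<omega>, z). ?f (\<omega>, z))"
    by (subst MB.integrable_product_swap_iff[symmetric]) (simp add: case_prod_beta')
  then show ?thesis by (simp add: case_prod_beta')
qed

text \<open>The identity of Hoeffding: the covariance of two functions of \<open>U\<close> and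
  \<open>U'\<close> is the integral of their derivatives against the difference between the joint
  distribution function and the product of the marginals.\<close>

theorem covariance_centred_primitives:
  assumes P: "unit_supported P" and Q: "unit_supported Q"
    and U01: "AE \<omega> in M. 0 < U \<omega> \<and> U \<omega> < 1" and U'01: "AE \<omega> in M. 0 < U' \<omega> \<and> U' \<omega> < 1"
  shows "integrable M (\<lambda>\<omega>. centred_primitive P (U \<omega>) * centred_primitive Q (U' \<omega>))"
    and "integrable (lborel \<Otimes>\<^sub>M lborel) (\<lambda>(x, y). (copula x y - x * y) * (P x * Q y))"
    and "expectation (\<lambda>\<omega>. centred_primitive P (U \<omega>) * centred_primitive Q (U' \<omega>)) =
      integral\<^sup>L (lborel \<Otimes>\<^sub>M lborel) (\<lambda>(x, y). (copula x y - x * y) * (P x * Q y))"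
proof -
  have Pm [measurable]: "P \<in> borel_measurable borel" "Q \<in> borel_measurable borel"
    and P0: "\<And>x. x \<notin> {0<..<1} \<Longrightarrow> P x = 0" and Q0: "\<And>x. x \<notin> {0<..<1} \<Longrightarrow> Q x = 0"
    using P Q unfolding unit_supported_def by auto
  let ?f = "\<lambda>(\<omega>, x, y). (indicator {..x} (U \<omega>) - x) * P x * ((indicator {..y} (U' \<omega>) - y) * Q y)"
  note fi = copula_integrable[OF P Q]
  interpret LL: sigma_finite_measure "lborel \<Otimes>\<^sub>M lborel :: (real \<times> real) measure" by (rule sigma_finite_pair_measure) unfold_locales
  interpret MB: pair_sigma_finite M "lborel \<Otimes>\<^sub>M lborel :: (real \<times> real) measure" by unfold_locales
  have inner: "(LINT z|(lborel \<Otimes>\<^sub>M lborel). ?f (\<omega>, z)) = centred_primitive P (U \<omega>) * centred_primitive Q (U' \<omega>)"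
    if "0 < U \<omega> \<and> U \<omega> < 1" "0 < U' \<omega> \<and> U' \<omega> < 1" for \<omega>
  proof -
    have i: "integrable lborel (\<lambda>x. (indicator {..x} (U \<omega>) - x) * P x)" "integrable lborel (\<lambda>y. (indicator {..y} (U' \<omega>) - y) * Q y)"
      using centred_kernel_integrable[OF P] centred_kernel_integrable[OF Q] that by auto
    have "integrable (lborel \<Otimes>\<^sub>M lborel) (\<lambda>(x, y). ((indicator {..x} (U \<omega>) - x) * P x) * ((indicator {..y} (U' \<omega>) - y) * Q y))"
      by (rule integrable_tensor_lborel[OF i])
    from lborel_pair.integral_fst'[OF this, symmetric] show ?thesis
      unfolding centred_primitive_def by simp
  qed
  have copula_eq: "(LINT \<omega>|M. ?f (\<omega>, x, y)) = (copula x y - x * y) * (P x * Q y)" for x y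
  proof (cases "x \<in> {0<..<1} \<and> y \<in> {0<..<1}")
    case False
    then show ?thesis using P0[of x] Q0[of y] by auto
  next
    case True
    have "(LINT \<omega>|M. ?f (\<omega>, x, y)) = (LINT \<omega>|M. ((indicator {..x} (U \<omega>) - x) * (indicator {..y} (U' \<omega>) - y)) * (P x * Q y))"
      by (intro Bochner_Integration.integral_cong) (auto simp: mult_ac)
    also have "\<dots> = (LINT \<omega>|M. (indicator {..x} (U \<omega>) - x) * (indicator {..y} (U' \<omega>) - y)) * (P x * Q y)"
      by (rule integral_mult_left_zero)
    finally show ?thesis using kernel_product_expectation[of x y] True by simp
  qed
  have ae: "AE \<omega> in M. (LINT z|(lborel \<Otimes>\<^sub>M lborel). ?f (\<omega>, z)) = centred_primitive P (U \<omega>) * centred_primitive Q (U' \<omega>)"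
    using U01 U'01 by eventually_elim (rule inner)
  have m: "(\<lambda>\<omega>. centred_primitive P (U \<omega>) * centred_primitive Q (U' \<omega>)) \<in> borel_measurable M" by measurable
  have if1: "integrable M (\<lambda>\<omega>. LINT z|(lborel \<Otimes>\<^sub>M lborel). ?f (\<omega>, z))"
    using MB.integrable_fst'[OF fi] .
  show "integrable M (\<lambda>\<omega>. centred_primitive P (U \<omega>) * centred_primitive Q (U' \<omega>))"
    by (rule integrable_cong_AE_imp[OF if1 m]) (use ae in auto)
  have swap: "integrable (M \<Otimes>\<^sub>M (lborel \<Otimes>\<^sub>M lborel)) (\<lambda>(\<omega>, z). ?f (\<omega>, z))" using fi by (simp add: case_prod_beta')
  have if2: "integrable (lborel \<Otimes>\<^sub>M lborel) (\<lambda>z. LINT \<omega>|M. ?f (\<omega>, z))"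
    by (rule MB.integrable_snd[OF swap])
  have eqf: "(\<lambda>z. LINT \<omega>|M. ?f (\<omega>, z)) = (\<lambda>(x, y). (copula x y - x * y) * (P x * Q y))"
    using copula_eq by (auto simp: fun_eq_iff)
  show "integrable (lborel \<Otimes>\<^sub>M lborel) (\<lambda>(x, y). (copula x y - x * y) * (P x * Q y))" using if2 unfolding eqf .
  have "expectation (\<lambda>\<omega>. centred_primitive P (U \<omega>) * centred_primitive Q (U' \<omega>)) = (LINT \<omega>|M. LINT z|(lborel \<Otimes>\<^sub>M lborel). ?f (\<omega>, z))"
    using if1 m by (intro integral_cong_AE) (use ae in auto)
  also have "\<dots> = (LINT z|(lborel \<Otimes>\<^sub>M lborel). LINT \<omega>|M. ?f (\<omega>, z))"
    using MB.Fubini_integral[OF swap] by simp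
  finally show "expectation (\<lambda>\<omega>. centred_primitive P (U \<omega>) * centred_primitive Q (U' \<omega>)) =
      integral\<^sup>L (lborel \<Otimes>\<^sub>M lborel) (\<lambda>(x, y). (copula x y - x * y) * (P x * Q y))"
    unfolding eqf .
qed

lemma centred_primitive_mean:
  assumes P: "unit_supported P" and U01: "AE \<omega> in M. 0 < U \<omega> \<and> U \<omega> < 1"
  shows "integrable M (\<lambda>\<omega>. centred_primitive P (U \<omega>))" and "expectation (\<lambda>\<omega>. centred_primitive P (U \<omega>)) = 0"
proof -
  have Pm [measurable]: "P \<in> borel_measurable borel" and P0: "\<And>x. x \<notin> {0<..<1} \<Longrightarrow> P x = 0"
    and Pi: "integrable lborel (\<lambda>x. sqrt (x * (1 - x)) * \<bar>P x\<bar>)"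
    using P unfolding unit_supported_def by auto
  let ?f = "\<lambda>(\<omega>, x). (indicator {..x} (U \<omega>) - x) * P x"
  interpret MB: pair_sigma_finite M "lborel :: real measure" by unfold_locales
  interpret BM: pair_sigma_finite "lborel :: real measure" M by unfold_locales
  have m: "?f \<in> borel_measurable (M \<Otimes>\<^sub>M lborel)"
  proof -
    have "(\<lambda>(\<omega>, x). ((if U \<omega> \<le> x then 1 else 0) - x) * P x) \<in> borel_measurable (M \<Otimes>\<^sub>M lborel)" by measurable
    then show ?thesis unfolding indicator_def by simp
  qed
  have abs_le: "expectation (\<lambda>\<omega>. \<bar>indicator {..x} (U \<omega>) - x\<bar>) \<le> sqrt (x * (1 - x))" if x: "0 < x" "x < 1" for x
  proof (rule real_le_rsqrt)
    have i: "integrable M (\<lambda>\<omega>. \<bar>indicator {..x} (U \<omega>) - x\<bar>)" "integrable M (\<lambda>\<omega>. (indicator {..x} (U \<omega>) - x)\<^sup>2)"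
      using x by (auto intro!: integrable_const_bound[of _ 1] simp: indicator_def abs_square_le_1)
    let ?E = "expectation (\<lambda>\<omega>. \<bar>indicator {..x} (U \<omega>) - x\<bar>)"
    have "0 \<le> expectation (\<lambda>\<omega>. (\<bar>indicator {..x} (U \<omega>) - x\<bar> - ?E)\<^sup>2)" by simp
    also have "\<dots> = expectation (\<lambda>\<omega>. \<bar>indicator {..x} (U \<omega>) - x\<bar>\<^sup>2) - ?E\<^sup>2"
      by (rule variance_eq) (use i in auto)
    finally show "?E\<^sup>2 \<le> x * (1 - x)" using kernel_square_expectation(1)[of x] x by simp
  qed
  have zero: "(LINT \<omega>|M. ?f (\<omega>, x)) = 0" for x
  proof (cases "x \<in> {0<..<1}")
    case True
    have "(LINT \<omega>|M. ?f (\<omega>, x)) = (LINT \<omega>|M. indicator {..x} (U \<omega>) - x) * P x" by simp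
    also have "(LINT \<omega>|M. indicator {..x} (U \<omega>) - x) = 0"
      using indicator_integrable(1)[of x] indicator_expectation(1)[of x] True by (simp add: prob_space)
    finally show ?thesis by simp
  qed (simp add: P0)
  have "integrable (lborel \<Otimes>\<^sub>M M) (\<lambda>(x, \<omega>). ?f (\<omega>, x))"
  proof (rule BM.Fubini_integrable)
    show ms: "(\<lambda>(x, \<omega>). ?f (\<omega>, x)) \<in> borel_measurable (lborel \<Otimes>\<^sub>M M)"
      using measurable_pair_swap[OF m] by (simp add: case_prod_beta')
    show "AE x in lborel. integrable M (\<lambda>\<omega>. case (x, \<omega>) of (x, \<omega>) \<Rightarrow> ?f (\<omega>, x))"
      using indicator_integrable(1) by (intro AE_I2) auto
    show "integrable lborel (\<lambda>x. LINT \<omega>|M. norm (case (x, \<omega>) of (x, \<omega>) \<Rightarrow> ?f (\<omega>, x)))"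
    proof (rule Bochner_Integration.integrable_bound[OF Pi])
      have "(\<lambda>(x, \<omega>). norm (?f (\<omega>, x))) \<in> borel_measurable (lborel \<Otimes>\<^sub>M M)"
        using ms by (simp add: case_prod_beta')
      then show "(\<lambda>x. LINT \<omega>|M. norm (case (x, \<omega>) of (x, \<omega>) \<Rightarrow> ?f (\<omega>, x))) \<in> borel_measurable lborel"
        by (intro borel_measurable_lebesgue_integral) (simp add: case_prod_beta')
      have "\<bar>LINT \<omega>|M. \<bar>?f (\<omega>, x)\<bar>\<bar> \<le> \<bar>sqrt (x * (1 - x)) * \<bar>P x\<bar>\<bar>" for x
      proof (cases "x \<in> {0<..<1}")
        case True
        have "(LINT \<omega>|M. \<bar>?f (\<omega>, x)\<bar>) = (LINT \<omega>|M. \<bar>indicator {..x} (U \<omega>) - x\<bar>) * \<bar>P x\<bar>"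
          by (simp add: abs_mult)
        also have "\<dots> \<le> sqrt (x * (1 - x)) * \<bar>P x\<bar>" using True by (intro mult_right_mono abs_le) auto
        finally have "(LINT \<omega>|M. \<bar>?f (\<omega>, x)\<bar>) \<le> sqrt (x * (1 - x)) * \<bar>P x\<bar>" .
        moreover have "0 \<le> (LINT \<omega>|M. \<bar>?f (\<omega>, x)\<bar>)" by (intro Bochner_Integration.integral_nonneg) simp
        ultimately show ?thesis by linarith
      qed (simp add: P0)
      then show "AE x in lborel. norm (LINT \<omega>|M. norm (case (x, \<omega>) of (x, \<omega>) \<Rightarrow> ?f (\<omega>, x))) \<le> norm (sqrt (x * (1 - x)) * \<bar>P x\<bar>)"
        by (intro AE_I2) simp
    qed
  qed
  then have swap: "integrable (M \<Otimes>\<^sub>M lborel) (\<lambda>(\<omega>, x). ?f (\<omega>, x))"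
    by (subst MB.integrable_product_swap_iff[symmetric]) (simp add: case_prod_beta')
  have eq: "(\<lambda>\<omega>. LINT x|lborel. ?f (\<omega>, x)) = (\<lambda>\<omega>. - centred_primitive P (U \<omega>))"
    unfolding centred_primitive_def by simp
  have "integrable M (\<lambda>\<omega>. LINT x|lborel. ?f (\<omega>, x))" using MB.integrable_fst[OF swap] .
  then show "integrable M (\<lambda>\<omega>. centred_primitive P (U \<omega>))" unfolding eq by simp
  have "(LINT \<omega>|M. LINT x|lborel. ?f (\<omega>, x)) = (LINT x|lborel. LINT \<omega>|M. ?f (\<omega>, x))"
    using MB.Fubini_integral[OF swap] by simp
  then show "expectation (\<lambda>\<omega>. centred_primitive P (U \<omega>)) = 0" unfolding eq zero by simp
qed

end

lemma iterated_integral_open_square: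
  fixes c :: "real \<Rightarrow> real \<Rightarrow> real"
  defines "J \<equiv> \<lambda>f g (x, y). (c x y - x * y) * ((indicator {0<..<1} x * f x) * (indicator {0<..<1} y * g y))"
  assumes 1: "integrable (lborel \<Otimes>\<^sub>M lborel) (J f g)" and 2: "integrable (lborel \<Otimes>\<^sub>M lborel) (J f' g')"
  shows "(LINT y:{0<..<1}|lborel. LINT x:{0<..<1}|lborel. (c x y - x * y) * (f x * g y + f' x * g' y))
    = integral\<^sup>L (lborel \<Otimes>\<^sub>M lborel) (J f g) + integral\<^sup>L (lborel \<Otimes>\<^sub>M lborel) (J f' g')"
proof -
  have sum: "integrable (lborel \<Otimes>\<^sub>M lborel) (\<lambda>(x, y). J f g (x, y) + J f' g' (x, y))"
    using Bochner_Integration.integrable_add[OF 1 2] by (simp add: case_prod_beta')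
  have eq: "indicator {0<..<1} y *\<^sub>R (LINT x|lborel. indicator {0<..<1} x *\<^sub>R ((c x y - x * y) * (f x * g y + f' x * g' y)))
      = (LINT x|lborel. J f g (x, y) + J f' g' (x, y))" for y
  proof -
    have "indicator {0<..<1} y *\<^sub>R (LINT x|lborel. indicator {0<..<1} x *\<^sub>R ((c x y - x * y) * (f x * g y + f' x * g' y)))
      = (LINT x|lborel. indicator {0<..<1} y *\<^sub>R (indicator {0<..<1} x *\<^sub>R ((c x y - x * y) * (f x * g y + f' x * g' y))))"
      by (rule integral_scaleR_right[symmetric])
    also have "\<dots> = (LINT x|lborel. J f g (x, y) + J f' g' (x, y))"
      by (intro Bochner_Integration.integral_cong refl) (simp add: J_def algebra_simps)
    finally show ?thesis .
  qed
  have "(LINT y:{0<..<1}|lborel. LINT x:{0<..<1}|lborel. (c x y - x * y) * (f x * g y + f' x * g' y))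
      = (LINT y|lborel. LINT x|lborel. J f g (x, y) + J f' g' (x, y))"
    unfolding set_lebesgue_integral_def eq ..
  also have "\<dots> = integral\<^sup>L (lborel \<Otimes>\<^sub>M lborel) (\<lambda>(x, y). J f g (x, y) + J f' g' (x, y))"
    by (rule lborel_pair.integral_snd[OF sum])
  also have "\<dots> = integral\<^sup>L (lborel \<Otimes>\<^sub>M lborel) (J f g) + integral\<^sup>L (lborel \<Otimes>\<^sub>M lborel) (J f' g')"
    using Bochner_Integration.integral_add[OF 1 2] by (simp add: case_prod_beta')
  finally show ?thesis .
qed

text \<open>The kernel \<open>min x y - x y\<close> is symmetric and equals \<open>x (1 - y)\<close>
  above the diagonal; reflecting the lower triangle there symmetrises the two functions, and the
  diagonal is a null set.\<close>

lemma iterated_integral_triangle: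
  fixes f g :: "real \<Rightarrow> real"
  defines "P \<equiv> \<lambda>x. indicator {0<..<1} x * f x" and "Q \<equiv> \<lambda>x. indicator {0<..<1} x * g x"
  assumes [measurable]: "P \<in> borel_measurable borel" "Q \<in> borel_measurable borel"
    and int: "integrable (lborel \<Otimes>\<^sub>M lborel) (\<lambda>(x, y). (min x y - x * y) * (P x * Q y))"
  shows "(LINT y:{0<..<1}|lborel. LINT x:{0<..<y}|lborel. x * (1 - y) * (f x * g y + g x * f y))
    = integral\<^sup>L (lborel \<Otimes>\<^sub>M lborel) (\<lambda>(x, y). (min x y - x * y) * (P x * Q y))"
proof -
  define h where "h = (\<lambda>(x, y). (min x y - x * y) * (P x * Q y))"
  define up where "up = (\<lambda>(x, y). if x < y then (min x y - x * y) * (P x * Q y) else 0)"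
  define lo where "lo = (\<lambda>(x, y). if y < x then (min x y - x * y) * (P x * Q y) else 0)"
  define dg where "dg = (\<lambda>(x, y). if x = y then (min x y - x * y) * (P x * Q y) else 0)"
  have hi: "integrable (lborel \<Otimes>\<^sub>M lborel) h" using int unfolding h_def .
  have m: "up \<in> borel_measurable (lborel \<Otimes>\<^sub>M lborel)" "lo \<in> borel_measurable (lborel \<Otimes>\<^sub>M lborel)" "dg \<in> borel_measurable (lborel \<Otimes>\<^sub>M lborel)"
    unfolding up_def lo_def dg_def by measurable
  have i: "integrable (lborel \<Otimes>\<^sub>M lborel) up" "integrable (lborel \<Otimes>\<^sub>M lborel) lo" "integrable (lborel \<Otimes>\<^sub>M lborel) dg"
    by (rule Bochner_Integration.integrable_bound[OF hi]; use m in \<open>auto simp: h_def up_def lo_def dg_def\<close>)+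
  have split: "h = (\<lambda>z. up z + lo z + dg z)"
    by (auto simp: fun_eq_iff h_def up_def lo_def dg_def)
  have "integral\<^sup>L (lborel \<Otimes>\<^sub>M lborel) dg = (LINT y|lborel. LINT x|lborel. dg (x, y))"
    using lborel_pair.integral_snd[of "\<lambda>x y. dg (x, y)"] i(3) by simp
  also have "(\<lambda>y. LINT x|lborel. dg (x, y)) = (\<lambda>y. 0)"
  proof (rule ext, rule integral_eq_zero_AE)
    fix y :: real
    show "AE x in lborel. dg (x, y) = 0"
      by (rule AE_mp[OF AE_lborel_singleton[of y]]) (simp add: dg_def)
  qed
  finally have dg0: "integral\<^sup>L (lborel \<Otimes>\<^sub>M lborel) dg = 0" by simp
  have lo_swap: "integrable (lborel \<Otimes>\<^sub>M lborel) (\<lambda>(x, y). lo (y, x))"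
    "integral\<^sup>L (lborel \<Otimes>\<^sub>M lborel) (\<lambda>(x, y). lo (y, x)) = integral\<^sup>L (lborel \<Otimes>\<^sub>M lborel) lo"
    using lborel_pair.integrable_product_swap[OF i(2)] lborel_pair.integral_product_swap[of lo] m(2) by auto
  \<comment> \<open>The swap moves the lower triangle onto the upper one.\<close>
  have tri: "up (x, y) + lo (y, x) = indicator {0<..<1} y * (indicator {0<..<y} x * (x * (1 - y) * (f x * g y + g x * f y)))" for x y
    by (auto simp: up_def lo_def P_def Q_def indicator_def algebra_simps min_def)
  have both: "integrable (lborel \<Otimes>\<^sub>M lborel) (\<lambda>(x, y). up (x, y) + lo (y, x))"
    using Bochner_Integration.integrable_add[OF i(1) lo_swap(1)] by (simp add: case_prod_beta')
  have "integral\<^sup>L (lborel \<Otimes>\<^sub>M lborel) h = integral\<^sup>L (lborel \<Otimes>\<^sub>M lborel) up + integral\<^sup>L (lborel \<Otimes>\<^sub>M lborel) lo"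
    unfolding split using i dg0 by simp
  also have "\<dots> = integral\<^sup>L (lborel \<Otimes>\<^sub>M lborel) (\<lambda>(x, y). up (x, y) + lo (y, x))"
    using Bochner_Integration.integral_add[OF i(1) lo_swap(1)] lo_swap(2) by (simp add: case_prod_beta')
  also have "\<dots> = (LINT y|lborel. LINT x|lborel. up (x, y) + lo (y, x))"
    by (rule lborel_pair.integral_snd[OF both, symmetric])
  also have "\<dots> = (LINT y:{0<..<1}|lborel. LINT x:{0<..<y}|lborel. x * (1 - y) * (f x * g y + g x * f y))"
    unfolding set_lebesgue_integral_def tri by simp
  finally show ?thesis unfolding h_def by (rule sym)
qed

section \<open>Centred Gaussian vectors\<close>

text \<open>Induction over the index set. A zero diagonal entry forces its row to vanish; a positive
  one is eliminated by passing to the Schur complement, which is again positive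
  semidefinite.\<close>

lemma psd_gram_factorization:
  fixes B :: "'i \<Rightarrow> 'i \<Rightarrow> real"
  assumes "finite S" and sym: "\<And>r s. B r s = B s r"
    and psd: "\<And>c. 0 \<le> (\<Sum>r\<in>S. \<Sum>s\<in>S. c r * c s * B r s)"
  shows "\<exists>p a. \<forall>r\<in>S. \<forall>s\<in>S. B r s = (\<Sum>k<p::nat. a r k * a s k)"
  using assms
proof (induction S arbitrary: B rule: finite_induct)
  case (insert q S)
  note sym = insert.prems(1)
  have expand: "(\<Sum>r\<in>insert q S. \<Sum>s\<in>insert q S. c r * c s * B r s) =
      (c q)\<^sup>2 * B q q + 2 * c q * (\<Sum>s\<in>S. c s * B q s) + (\<Sum>r\<in>S. \<Sum>s\<in>S. c r * c s * B r s)" for c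
  proof -
    have "(\<Sum>r\<in>S. c r * c q * B r q) = c q * (\<Sum>s\<in>S. c s * B q s)"
      by (simp add: sum_distrib_left sym[of _ q] mult_ac)
    moreover have "(\<Sum>s\<in>S. c q * c s * B q s) = c q * (\<Sum>s\<in>S. c s * B q s)"
      by (simp add: sum_distrib_left mult_ac)
    ultimately show ?thesis
      using insert.hyps by (simp add: sum.distrib power2_eq_square algebra_simps)
  qed
  have psd: "0 \<le> (c q)\<^sup>2 * B q q + 2 * c q * (\<Sum>s\<in>S. c s * B q s) + (\<Sum>r\<in>S. \<Sum>s\<in>S. c r * c s * B r s)" for c
    using insert.prems(2)[of c] unfolding expand .
  have psd': "0 \<le> x\<^sup>2 * B q q + 2 * x * (\<Sum>s\<in>S. c s * B q s) + (\<Sum>r\<in>S. \<Sum>s\<in>S. c r * c s * B r s)" for c x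
  proof -
    have "(\<Sum>s\<in>S. (c(q := x)) s * B q s) = (\<Sum>s\<in>S. c s * B q s)"
      using insert.hyps by (intro sum.cong) auto
    moreover have "(\<Sum>r\<in>S. \<Sum>s\<in>S. (c(q := x)) r * (c(q := x)) s * B r s) = (\<Sum>r\<in>S. \<Sum>s\<in>S. c r * c s * B r s)"
      using insert.hyps by (intro sum.cong) auto
    ultimately show ?thesis using psd[of "c(q := x)"] by simp
  qed
  have Bqq: "0 \<le> B q q" using psd'[of 1 "\<lambda>_. 0"] by simp
  show ?case
  proof (cases "B q q = 0")
    case True
    have zero: "B q s = 0" if s: "s \<in> S" for s
    proof (rule ccontr)
      assume nz: "B q s \<noteq> 0"
      \<comment> \<open>The quadratic form is linear in \<open>x\<close>; this value makes it equal to \<open>-1\<close>.\<close>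
      define x where "x = - (B s s + 1) / (2 * B q s)"
      have "(\<Sum>u\<in>S. (if u = s then 1 else 0) * B q u) = B q s"
        using s insert.hyps by (simp add: if_distrib[of "\<lambda>x. x * _"] cong: if_cong)
      moreover have "(\<Sum>r\<in>S. \<Sum>u\<in>S. (if r = s then 1 else 0) * (if u = s then 1 else 0) * B r u) = B s s"
      proof -
        have "(\<Sum>u\<in>S. (if r = s then 1 else 0) * (if u = s then 1 else 0) * B r u) = (if r = s then B s s else 0)" for r
          using s insert.hyps by (simp add: if_distrib[of "\<lambda>x. x * _"] cong: if_cong)
        then show ?thesis using s insert.hyps by simp
      qed
      ultimately have "0 \<le> x\<^sup>2 * B q q + 2 * x * B q s + B s s"
        using psd'[of x "\<lambda>u. if u = s then 1 else 0"] by simp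
      then show False using True nz by (simp add: x_def field_simps)
    qed
    have "0 \<le> (\<Sum>r\<in>S. \<Sum>s\<in>S. c r * c s * B r s)" for c using psd'[of 0 c] by simp
    then obtain p a where a: "\<forall>r\<in>S. \<forall>s\<in>S. B r s = (\<Sum>k<p::nat. a r k * a s k)"
      using insert.IH[of B] sym by blast
    have "\<forall>r\<in>insert q S. \<forall>s\<in>insert q S. B r s = (\<Sum>k<p. (a(q := \<lambda>_. 0)) r k * (a(q := \<lambda>_. 0)) s k)"
    proof (intro ballI)
      fix r s assume rs: "r \<in> insert q S" "s \<in> insert q S"
      show "B r s = (\<Sum>k<p. (a(q := \<lambda>_. 0)) r k * (a(q := \<lambda>_. 0)) s k)"
      proof (cases "r = q \<or> s = q")
        case True
        then have "B r s = 0" using zero \<open>B q q = 0\<close> rs sym[of r s] by auto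
        then show ?thesis using True by auto
      next
        case False
        then show ?thesis using a rs by auto
      qed
    qed
    then show ?thesis by (intro exI)
  next
    case False
    with Bqq have pos: "B q q > 0" by simp
    define B' where "B' r s = B r s - B q r * B q s / B q q" for r s
    have "0 \<le> (\<Sum>r\<in>S. \<Sum>s\<in>S. c r * c s * B' r s)" for c
    proof -
      define T where "T = (\<Sum>s\<in>S. c s * B q s)"
      have "(\<Sum>r\<in>S. \<Sum>s\<in>S. c r * c s * B' r s) =
          (\<Sum>r\<in>S. \<Sum>s\<in>S. c r * c s * B r s) - (\<Sum>r\<in>S. \<Sum>s\<in>S. (c r * B q r) * (c s * B q s) / B q q)"
        unfolding B'_def sum_subtractf[symmetric] by (intro sum.cong refl) (simp add: algebra_simps)
      also have "(\<Sum>r\<in>S. \<Sum>s\<in>S. (c r * B q r) * (c s * B q s) / B q q) = T\<^sup>2 / B q q"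
        unfolding T_def power2_eq_square sum_product sum_divide_distrib ..
      finally have eq: "(\<Sum>r\<in>S. \<Sum>s\<in>S. c r * c s * B' r s) = (\<Sum>r\<in>S. \<Sum>s\<in>S. c r * c s * B r s) - T\<^sup>2 / B q q" .
      have "0 \<le> (- (T / B q q))\<^sup>2 * B q q + 2 * (- (T / B q q)) * T + (\<Sum>r\<in>S. \<Sum>s\<in>S. c r * c s * B r s)"
        using psd'[of "- (T / B q q)" c] unfolding T_def .
      also have "(- (T / B q q))\<^sup>2 * B q q + 2 * (- (T / B q q)) * T = - (T\<^sup>2 / B q q)"
        using pos by (simp add: power2_eq_square field_simps)
      finally show ?thesis unfolding eq by simp
    qed
    moreover have "B' r s = B' s r" for r s unfolding B'_def using sym[of r s] by (simp add: mult.commute)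
    ultimately obtain p a where a: "\<forall>r\<in>S. \<forall>s\<in>S. B' r s = (\<Sum>k<p::nat. a r k * a s k)"
      using insert.IH[of B'] by blast
    define b where "b r k = (if k = p then B q r / sqrt (B q q) else if r = q then 0 else a r k)" for r k
    have "B r s = (\<Sum>k<Suc p. b r k * b s k)" if rs: "r \<in> insert q S" "s \<in> insert q S" for r s
    proof -
      have last: "b r p * b s p = B q r * B q s / B q q" using pos by (simp add: b_def)
      have "(\<Sum>k<p. b r k * b s k) = (if r = q \<or> s = q then 0 else \<Sum>k<p. a r k * a s k)"
        by (auto simp: b_def intro!: sum.cong)
      also have "\<dots> = B r s - B q r * B q s / B q q"
        using a rs insert.hyps pos sym[of r q] unfolding B'_def by auto
      finally show ?thesis using last by simp
    qed
    then show ?thesis by blast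
  qed
qed simp

lemma borel_measurable_vec_lambda_iff:
  fixes f :: "'a \<Rightarrow> real ^ 'n"
  shows "f \<in> borel_measurable M \<longleftrightarrow> (\<forall>i. (\<lambda>x. f x $ i) \<in> borel_measurable M)"
proof
  assume f: "f \<in> borel_measurable M"
  show "\<forall>i. (\<lambda>x. f x $ i) \<in> borel_measurable M"
  proof
    fix i
    have "(\<lambda>y::real ^ 'n. y $ i) \<in> borel_measurable borel"
      by (intro borel_measurable_continuous_onI continuous_intros)
    then show "(\<lambda>x. f x $ i) \<in> borel_measurable M" using measurable_compose[OF f] by blast
  qed
next
  assume "\<forall>i. (\<lambda>x. f x $ i) \<in> borel_measurable M"
  then show "f \<in> borel_measurable M"
    unfolding borel_measurable_euclidean_space[where f = f]
    by (auto simp: Basis_vec_def inner_axis)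
qed

text \<open>The image of independent standard normal variables under a factor of the covariance
  matrix.\<close>

theorem multivariate_normal_exists:
  fixes \<Sigma> :: "real ^ 'm ^ 'm"
  assumes sym: "transpose \<Sigma> = \<Sigma>" and psd: "\<And>t. 0 \<le> t \<bullet> (\<Sigma> *v t)"
  shows "\<exists>\<nu>. multivariate_normal 0 \<Sigma> \<nu>"
proof -
  have quad: "t \<bullet> (\<Sigma> *v t) = (\<Sum>r\<in>UNIV. \<Sum>s\<in>UNIV. t $ r * t $ s * \<Sigma> $ r $ s)" for t
    by (simp add: inner_vec_def matrix_vector_mult_def sum_distrib_left mult_ac)
  have "\<exists>p a. \<forall>r\<in>UNIV. \<forall>s\<in>UNIV. \<Sigma> $ r $ s = (\<Sum>k<p::nat. a r k * a s k)"
  proof (rule psd_gram_factorization)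
    show "\<Sigma> $ r $ s = \<Sigma> $ s $ r" for r s using sym by (metis transpose_def vec_lambda_beta)
    show "0 \<le> (\<Sum>r\<in>UNIV. \<Sum>s\<in>UNIV. c r * c s * \<Sigma> $ r $ s)" for c
      using psd[of "\<chi> r. c r"] unfolding quad by simp
  qed simp
  then obtain p a where a: "\<And>r s. \<Sigma> $ r $ s = (\<Sum>k<p::nat. a r k * a s k)" by blast
  let ?N = "\<lambda>_::nat. std_normal_distribution"
  interpret N: prob_space std_normal_distribution
    using real_dist_normal_dist real_distribution.axioms(1) by blast
  interpret PN: product_prob_space ?N "{..<p}" by unfold_locales
  define P where "P = PiM {..<p} ?N"
  have P: "prob_space P" unfolding P_def by (rule prob_space_PiM) unfold_locales
  define g where "g \<omega> = (\<chi> r. \<Sum>k<p. a r k * \<omega> k)" for \<omega> :: "nat \<Rightarrow> real"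
  have g [measurable]: "g \<in> P \<rightarrow>\<^sub>M borel"
    unfolding borel_measurable_vec_lambda_iff g_def P_def by simp
  define \<nu> where "\<nu> = distr P borel g"
  have "(CLINT x|\<nu>. iexp (t \<bullet> x)) = exp (- complex_of_real (t \<bullet> (\<Sigma> *v t)) / 2)" for t
  proof -
    define c where "c k = (\<Sum>r\<in>UNIV. t $ r * a r k)" for k
    have lin: "t \<bullet> g \<omega> = (\<Sum>k<p. c k * \<omega> k)" for \<omega>
      unfolding inner_vec_def g_def c_def
      by (simp add: sum_distrib_left sum_distrib_right mult.assoc) (rule sum.swap)
    have "(CLINT x|\<nu>. iexp (t \<bullet> x)) = (CLINT \<omega>|P. iexp (t \<bullet> g \<omega>))"
      unfolding \<nu>_def by (intro integral_distr) (simp, measurable)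
    also have "\<dots> = (CLINT \<omega>|P. (\<Prod>k<p. iexp (c k * \<omega> k)))"
      unfolding lin by (simp add: sum_distrib_left exp_sum)
    also have "\<dots> = (\<Prod>k<p. CLINT x|std_normal_distribution. iexp (c k * x))"
      unfolding P_def
    proof (rule PN.product_integral_prod)
      fix k
      show "integrable std_normal_distribution (\<lambda>x. iexp (c k * x))"
        by (rule N.integrable_const_bound[of _ 1]) auto
    qed simp
    also have "\<dots> = (\<Prod>k<p. char std_normal_distribution (c k))" unfolding char_def ..
    also have "\<dots> = (\<Prod>k<p. exp (complex_of_real (- (c k)\<^sup>2 / 2)))"
      unfolding char_std_normal_distribution by (simp only: exp_of_real)
    also have "\<dots> = exp (complex_of_real (\<Sum>k<p. - (c k)\<^sup>2 / 2))"
      by (simp only: exp_sum[OF finite_lessThan, symmetric] of_real_sum)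
    also have "(\<Sum>k<p. - (c k)\<^sup>2 / 2) = - (1 / 2) * (\<Sum>k<p. (c k)\<^sup>2)"
      unfolding sum_distrib_left by (intro sum.cong refl) simp
    also have "(\<Sum>k<p. (c k)\<^sup>2) = t \<bullet> (\<Sigma> *v t)"
    proof -
      have "t \<bullet> (\<Sigma> *v t) = (\<Sum>r\<in>UNIV. \<Sum>s\<in>UNIV. \<Sum>k<p. (t $ r * a r k) * (t $ s * a s k))"
        unfolding quad a sum_distrib_left by (intro sum.cong refl) (simp only: mult_ac)
      also have "\<dots> = (\<Sum>r\<in>UNIV. \<Sum>k<p. \<Sum>s\<in>UNIV. (t $ r * a r k) * (t $ s * a s k))"
        by (rule sum.cong[OF refl], rule sum.swap)
      also have "\<dots> = (\<Sum>k<p. \<Sum>r\<in>UNIV. \<Sum>s\<in>UNIV. (t $ r * a r k) * (t $ s * a s k))"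
        by (rule sum.swap)
      also have "\<dots> = (\<Sum>k<p. (c k)\<^sup>2)"
        unfolding c_def power2_eq_square sum_product ..
      finally show ?thesis by (rule HOL.sym)
    qed
    finally have "(CLINT x|\<nu>. iexp (t \<bullet> x)) = exp (complex_of_real (- (1 / 2) * (t \<bullet> (\<Sigma> *v t))))" .
    moreover have "complex_of_real (- (1 / 2) * u) = - complex_of_real u / 2" for u
      by (rule complex_eqI) simp_all
    ultimately show ?thesis by (simp only:)
  qed
  moreover have "prob_space \<nu>" "sets \<nu> = sets borel"
    unfolding \<nu>_def by (rule prob_space.prob_space_distr[OF P g]) simp
  ultimately have "multivariate_normal 0 \<Sigma> \<nu>"
    unfolding multivariate_normal_def using sym by simp
  then show ?thesis by blast
qed

section \<open>Weak convergence from characteristic functions\<close>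

text \<open>Complex trigonometric polynomials with arbitrary frequencies. Expectations of such
  functions are determined by the characteristic function.\<close>

inductive trig_poly :: "('v::euclidean_space \<Rightarrow> complex) \<Rightarrow> bool" where
  exponential: "trig_poly (\<lambda>x. c * iexp (t \<bullet> x))"
| add: "trig_poly f \<Longrightarrow> trig_poly g \<Longrightarrow> trig_poly (\<lambda>x. f x + g x)"

lemma trig_poly_const: "trig_poly (\<lambda>x. c)"
  using trig_poly.exponential[of c 0] by simp

lemma trig_poly_mult:
  assumes "trig_poly f" "trig_poly g"
  shows "trig_poly (\<lambda>x. f x * g x)"
  using assms(1)
proof (induction rule: trig_poly.induct)
  case (exponential c t)
  show ?case using assms(2)
  proof (induction rule: trig_poly.induct)
    case (exponential c' t')
    have "(\<lambda>x. c * iexp (t \<bullet> x) * (c' * iexp (t' \<bullet> x))) = (\<lambda>x. (c * c') * iexp ((t + t') \<bullet> x))"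
      by (simp add: fun_eq_iff inner_add_left distrib_left exp_add mult_ac)
    then show ?case using trig_poly.exponential[of "c * c'" "t + t'"] by simp
  next
    case (add f g)
    then show ?case by (simp add: distrib_left trig_poly.add)
  qed
next
  case (add f g)
  then show ?case by (simp add: distrib_right trig_poly.add)
qed

lemma trig_poly_sum: "finite I \<Longrightarrow> (\<And>i. i \<in> I \<Longrightarrow> trig_poly (f i)) \<Longrightarrow> trig_poly (\<lambda>x. \<Sum>i\<in>I. f i x)"
  by (induction I rule: finite_induct) (auto intro: trig_poly_const trig_poly.add)

lemma trig_poly_sin: "trig_poly (\<lambda>x. complex_of_real (sin (t \<bullet> x)))"
proof -
  have "complex_of_real (sin u) = (- \<i> / 2) * iexp u + (\<i> / 2) * iexp (- u)" for u
  proof -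
    have "iexp v = Complex (cos v) (sin v)" for v by (simp add: cis_conv_exp[symmetric] cis.ctr)
    then show ?thesis by (simp only: cos_minus sin_minus) (simp add: complex_eq_iff)
  qed
  then have "(\<lambda>x. complex_of_real (sin (t \<bullet> x))) =
      (\<lambda>x. (- \<i> / 2) * iexp (t \<bullet> x) + (\<i> / 2) * iexp ((- t) \<bullet> x))"
    by simp
  then show ?thesis by (simp only:) (intro trig_poly.intros)
qed

definition coordwise_sin :: "real \<Rightarrow> 'v::euclidean_space \<Rightarrow> 'v" where
  "coordwise_sin h x = (\<Sum>b\<in>Basis. sin (h * (x \<bullet> b)) *\<^sub>R b)"

lemma trig_poly_polynomial_sin:
  assumes "real_polynomial_function P"
  shows "trig_poly (\<lambda>x. complex_of_real (P (coordwise_sin h x)))"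
  using assms
proof (induction rule: real_polynomial_function.induct)
  case (linear f)
  have "f (coordwise_sin h x) = (\<Sum>b\<in>Basis. f b * sin ((h *\<^sub>R b) \<bullet> x))" for x
    unfolding coordwise_sin_def linear_sum[OF bounded_linear.linear[OF linear]]
      linear_scale[OF bounded_linear.linear[OF linear]]
    by (intro sum.cong refl) (simp add: inner_commute mult.commute)
  then have "(\<lambda>x. complex_of_real (f (coordwise_sin h x))) =
      (\<lambda>x. \<Sum>b\<in>Basis. complex_of_real (f b) * complex_of_real (sin ((h *\<^sub>R b) \<bullet> x)))"
    by simp
  then show ?case
    by (simp only:) (intro trig_poly_sum finite_Basis trig_poly_mult trig_poly_const trig_poly_sin)
next
  case (const c)
  show ?case by (rule trig_poly_const)
next
  case (add f g)
  show ?case using trig_poly.add[OF add.IH] by simp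
next
  case (mult f g)
  show ?case using trig_poly_mult[OF mult.IH] by simp
qed

lemma integrable_trig_poly:
  assumes "trig_poly g" "prob_space N" "sets N = sets borel"
  shows "integrable N g"
  using assms(1)
proof (induction rule: trig_poly.induct)
  case (exponential c t)
  interpret prob_space N by fact
  have "integrable N (\<lambda>x. iexp (t \<bullet> x))"
  proof (rule integrable_const_bound[of _ 1])
    show "(\<lambda>x. iexp (t \<bullet> x)) \<in> borel_measurable N"
      by (subst measurable_cong_sets[OF assms(3) refl]) measurable
  qed simp
  then show ?case by simp
qed simp

lemma trig_poly_integral_tendsto:
  assumes "trig_poly g"
    and N: "\<And>n. prob_space (N n)" "\<And>n. sets (N n) = sets borel" "prob_space \<nu>" "sets \<nu> = sets borel"
    and chf: "\<And>t. (\<lambda>n. CLINT x|N n. iexp (t \<bullet> x)) \<longlonglongrightarrow> (CLINT x|\<nu>. iexp (t \<bullet> x))"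
  shows "(\<lambda>n. CLINT x|N n. g x) \<longlonglongrightarrow> (CLINT x|\<nu>. g x)"
  using assms(1)
proof (induction rule: trig_poly.induct)
  case (exponential c t)
  show ?case by (simp add: tendsto_mult_left chf)
next
  case (add f g)
  then show ?case
    using N by (simp only: Bochner_Integration.integral_add integrable_trig_poly) (intro tendsto_add)
qed

text \<open>On the cube, the coordinates are recovered from \<open>sin (h x\<^sub>b)\<close> by the
  arcsine if \<open>h R = \<pi> / 2\<close>. The Stone--Weierstrass theorem applied to
  \<open>f\<close> composed with this inverse gives a polynomial in the sines. Unlike a polynomial
  in the coordinates it stays bounded outside the cube.\<close>

lemma trig_poly_approx_on_cube:
  fixes f :: "'v::euclidean_space \<Rightarrow> real"
  assumes f: "continuous_on UNIV f" and B: "\<And>x. \<bar>f x\<bar> \<le> B" and R: "R > 0" and e: "e > 0"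
  obtains g where "trig_poly (\<lambda>x. complex_of_real (g x))"
    "\<And>x. (\<And>b. b \<in> Basis \<Longrightarrow> \<bar>x \<bullet> b\<bar> \<le> R) \<Longrightarrow> \<bar>f x - g x\<bar> \<le> e" "\<And>x. \<bar>g x\<bar> \<le> B + e"
proof -
  \<comment> \<open>The largest frequency for which the sine is injective on \<open>[-R, R]\<close>.\<close>
  define h where "h = pi / (2 * R)"
  have h: "h > 0" using R by (simp add: h_def)
  define q where "q y = f (\<Sum>b\<in>Basis. (arcsin (y \<bullet> b) / h) *\<^sub>R b)" for y
  define K where "K = cbox (- One :: 'v) One"
  have K: "y \<in> K \<longleftrightarrow> (\<forall>b\<in>Basis. - 1 \<le> y \<bullet> b \<and> y \<bullet> b \<le> 1)" for y
    unfolding K_def mem_box by simp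
  have "continuous_on K q"
    unfolding q_def
  proof (rule continuous_on_compose2[OF f])
    show "continuous_on K (\<lambda>y. \<Sum>b\<in>Basis. (arcsin (y \<bullet> b) / h) *\<^sub>R b)"
      using h by (intro continuous_intros) (auto simp: K)
  qed simp
  moreover have "compact K" unfolding K_def by simp
  ultimately obtain P where P: "real_polynomial_function P" "\<And>y. y \<in> K \<Longrightarrow> \<bar>q y - P y\<bar> < e"
    using Stone_Weierstrass_real_polynomial_function e by blast
  have coord: "coordwise_sin h x \<bullet> b = sin (h * (x \<bullet> b))" if "b \<in> Basis" for x :: 'v and b
    using that unfolding coordwise_sin_def by (rule inner_sum_left_Basis)
  have inK: "coordwise_sin h x \<in> K" for x
    unfolding K by (simp add: coord)
  show thesis
  proof (rule that)
    show "trig_poly (\<lambda>x. complex_of_real (P (coordwise_sin h x)))"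
      by (rule trig_poly_polynomial_sin[OF P(1)])
  next
    fix x :: 'v assume x: "\<And>b. b \<in> Basis \<Longrightarrow> \<bar>x \<bullet> b\<bar> \<le> R"
    have "arcsin (coordwise_sin h x \<bullet> b) / h = x \<bullet> b" if b: "b \<in> Basis" for b
    proof -
      have "\<bar>h * (x \<bullet> b)\<bar> \<le> h * R" using x[OF b] h by (simp add: abs_mult)
      also have "h * R = pi / 2" using R by (simp add: h_def)
      finally have "arcsin (sin (h * (x \<bullet> b))) = h * (x \<bullet> b)"
        by (intro arcsin_sin) auto
      then show ?thesis using coord[OF b] h by simp
    qed
    then have "q (coordwise_sin h x) = f (\<Sum>b\<in>Basis. (x \<bullet> b) *\<^sub>R b)"
      unfolding q_def by (intro arg_cong[where f = f] sum.cong) auto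
    then have "q (coordwise_sin h x) = f x" by (simp add: euclidean_representation)
    then show "\<bar>f x - P (coordwise_sin h x)\<bar> \<le> e" using P(2)[OF inK[of x]] by simp
  next
    fix x :: 'v
    show "\<bar>P (coordwise_sin h x)\<bar> \<le> B + e"
      using P(2)[OF inK[of x]] B[of "\<Sum>b\<in>Basis. (arcsin (coordwise_sin h x \<bullet> b) / h) *\<^sub>R b"]
      unfolding q_def by linarith
  qed
qed

definition off_cube :: "real \<Rightarrow> 'v::euclidean_space set" where
  "off_cube R = {x. \<exists>b\<in>Basis. R < \<bar>x \<bullet> b\<bar>}"

lemma open_off_cube: "open (off_cube R :: 'v::euclidean_space set)"
proof -
  have "off_cube R = (\<Union>b\<in>Basis. {x :: 'v. R < \<bar>x \<bullet> b\<bar>})" by (auto simp: off_cube_def)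
  moreover have "open {x :: 'v. R < \<bar>x \<bullet> b\<bar>}" for b by (intro open_Collect_less continuous_intros)
  ultimately show ?thesis by (simp add: open_UN)
qed

lemma off_cube_antimono:
  assumes "R' \<le> R"
  shows "off_cube R \<subseteq> off_cube R'"
proof
  fix x assume "x \<in> off_cube R"
  then obtain b where "b \<in> Basis" "R < \<bar>x \<bullet> b\<bar>" unfolding off_cube_def by blast
  then show "x \<in> off_cube R'" using assms unfolding off_cube_def by (auto intro!: bexI[of _ b])
qed

lemma off_cube_borel [measurable]: "off_cube R \<in> sets borel"
  using open_off_cube by (rule borel_open)

lemma off_cube_small:
  fixes N :: "'v::euclidean_space measure"
  assumes "prob_space N" "sets N = sets borel" "\<epsilon> > 0"
  obtains R\<^sub>0 where "\<And>R. R \<ge> R\<^sub>0 \<Longrightarrow> measure N (off_cube R) \<le> \<epsilon>"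
proof -
  interpret prob_space N by fact
  have [simp]: "off_cube R \<in> sets N" for R using off_cube_borel assms(2) by simp
  have "(\<lambda>n. measure N (off_cube (real n))) \<longlonglongrightarrow> measure N (\<Inter>n. off_cube (real n))"
  proof (rule finite_Lim_measure_decseq)
    show "decseq (\<lambda>n. off_cube (real n) :: 'v set)"
      unfolding decseq_def by (simp add: off_cube_antimono)
  qed auto
  moreover have "(\<Inter>n. off_cube (real n)) = ({} :: 'v set)"
  proof -
    have "x \<notin> off_cube (real n)" if "n \<ge> nat \<lceil>norm x\<rceil>" for x :: 'v and n
    proof -
      have "norm x \<le> real n" using that by linarith
      then have "\<bar>x \<bullet> b\<bar> \<le> real n" if "b \<in> Basis" for b
        using Basis_le_norm[OF that, of x] by linarith
      then show ?thesis unfolding off_cube_def by (auto simp: not_less)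
    qed
    then show ?thesis by blast
  qed
  ultimately have "(\<lambda>n. measure N (off_cube (real n))) \<longlonglongrightarrow> 0" by simp
  then have "eventually (\<lambda>n. measure N (off_cube (real n)) < \<epsilon>) sequentially"
    using assms(3) by (rule order_tendstoD)
  then obtain n where n: "measure N (off_cube (real n)) < \<epsilon>"
    unfolding eventually_sequentially by blast
  show thesis
  proof (rule that[of "real n"])
    fix R assume "R \<ge> real n"
    then have "off_cube R \<subseteq> (off_cube (real n) :: 'v set)" by (rule off_cube_antimono)
    then have "measure N (off_cube R) \<le> measure N (off_cube (real n))" by (intro finite_measure_mono) auto
    then show "measure N (off_cube R) \<le> \<epsilon>" using n by simp
  qed
qed

lemma integral_diff_le_off_cube:
  fixes f g :: "'v::euclidean_space \<Rightarrow> real"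
  assumes N: "prob_space N" "sets N = sets borel"
    and f: "f \<in> borel_measurable borel" "\<And>x. \<bar>f x\<bar> \<le> B" and g: "integrable N g" "\<And>x. \<bar>g x\<bar> \<le> B + e"
    and fg: "\<And>x. (\<And>b. b \<in> Basis \<Longrightarrow> \<bar>x \<bullet> b\<bar> \<le> R) \<Longrightarrow> \<bar>f x - g x\<bar> \<le> e" and e: "e > 0"
  shows "\<bar>(LINT x|N. f x) - (LINT x|N. g x)\<bar> \<le> e + (2 * B + e) * measure N (off_cube R)"
proof -
  interpret prob_space N by fact
  have [measurable]: "f \<in> borel_measurable N" using f(1) N(2) by (simp cong: measurable_cong_sets)
  have [simp]: "off_cube R \<in> sets N" using off_cube_borel N(2) by simp
  have ii: "integrable N (indicator (off_cube R) :: 'v \<Rightarrow> real)"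
    by (intro integrable_real_indicator) (auto simp: emeasure_eq_measure)
  have fi: "integrable N f" by (rule integrable_const_bound[of _ B]) (use f(2) in auto)
  have "\<bar>(LINT x|N. f x) - (LINT x|N. g x)\<bar> = \<bar>LINT x|N. f x - g x\<bar>" using fi g(1) by simp
  also have "\<dots> \<le> (LINT x|N. \<bar>f x - g x\<bar>)" by (rule integral_abs_bound)
  also have "\<dots> \<le> (LINT x|N. e + (2 * B + e) * indicator (off_cube R) x)"
  proof (rule integral_mono)
    fix x
    show "\<bar>f x - g x\<bar> \<le> e + (2 * B + e) * indicator (off_cube R) x"
    proof (cases "x \<in> off_cube R")
      case True
      then show ?thesis using f(2)[of x] g(2)[of x] e by simp
    next
      case False
      then show ?thesis using fg[of x] by (auto simp: off_cube_def not_less)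
    qed
  qed (use fi g(1) ii in auto)
  also have "\<dots> = e + (2 * B + e) * measure N (off_cube R)"
    using ii by (simp add: prob_space)
  finally show ?thesis .
qed

text \<open>Tightness makes the values outside a large cube irrelevant, and inside it
  \<open>f\<close> is replaced by a trigonometric polynomial.\<close>

theorem weak_convergence_from_chf_tight:
  fixes f :: "'v::euclidean_space \<Rightarrow> real" and N :: "nat \<Rightarrow> 'v measure"
  assumes N: "\<And>n. prob_space (N n)" "\<And>n. sets (N n) = sets borel" and \<nu>: "prob_space \<nu>" "sets \<nu> = sets borel"
    and chf: "\<And>t. (\<lambda>n. CLINT x|N n. iexp (t \<bullet> x)) \<longlonglongrightarrow> (CLINT x|\<nu>. iexp (t \<bullet> x))"
    and tight: "\<And>\<epsilon>. \<epsilon> > 0 \<Longrightarrow> \<exists>R\<^sub>0. \<forall>R\<ge>R\<^sub>0. eventually (\<lambda>n. measure (N n) (off_cube R) \<le> \<epsilon>) sequentially"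
    and f: "continuous_on UNIV f" "bounded (range f)"
  shows "(\<lambda>n. LINT x|N n. f x) \<longlonglongrightarrow> (LINT x|\<nu>. f x)"
proof (rule LIMSEQ_I)
  fix r :: real assume r: "r > 0"
  obtain B where "\<And>x. \<bar>f x\<bar> \<le> B" using f(2) unfolding bounded_iff by auto
  then have B: "\<bar>f x\<bar> \<le> max B 0" for x using max.coboundedI1 by blast
  define B' where "B' = max B 0"
  have B': "\<And>x. \<bar>f x\<bar> \<le> B'" "B' \<ge> 0" using B by (auto simp: B'_def)
  define e where "e = r / 8"
  define \<epsilon> where "\<epsilon> = r / (8 * (2 * B' + e))"
  have pos: "e > 0" "\<epsilon> > 0" "2 * B' + e > 0" using r B' by (auto simp: e_def \<epsilon>_def intro!: divide_pos_pos add_nonneg_pos)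
  have e2: "e + (2 * B' + e) * \<epsilon> = r / 4"
    using pos unfolding \<epsilon>_def e_def by (simp add: field_simps)
  obtain R1 where R1: "\<And>R. R \<ge> R1 \<Longrightarrow> eventually (\<lambda>n. measure (N n) (off_cube R) \<le> \<epsilon>) sequentially"
    using tight[OF pos(2)] by blast
  obtain R2 where R2: "\<And>R. R \<ge> R2 \<Longrightarrow> measure \<nu> (off_cube R) \<le> \<epsilon>"
    using off_cube_small[OF \<nu> pos(2)] by metis
  define R where "R = max 1 (max R1 R2)"
  have R: "R > 0" "R \<ge> R1" "R \<ge> R2" unfolding R_def by auto
  obtain g where g: "trig_poly (\<lambda>x. complex_of_real (g x))"
    "\<And>x. (\<And>b. b \<in> Basis \<Longrightarrow> \<bar>x \<bullet> b\<bar> \<le> R) \<Longrightarrow> \<bar>f x - g x\<bar> \<le> e" "\<And>x. \<bar>g x\<bar> \<le> B' + e"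
    using trig_poly_approx_on_cube[OF f(1) B'(1) R(1) pos(1)] by metis
  have fm: "f \<in> borel_measurable borel" using f(1) by (rule borel_measurable_continuous_onI)
  have gi: "integrable P g" if "prob_space P" "sets P = sets borel" for P
    using integrable_trig_poly[OF g(1) that] by (simp add: complex_of_real_integrable_eq)
  have diff: "\<bar>(LINT x|P. f x) - (LINT x|P. g x)\<bar> \<le> r / 4"
    if P: "prob_space P" "sets P = sets borel" and small: "measure P (off_cube R) \<le> \<epsilon>" for P
  proof -
    have "\<bar>(LINT x|P. f x) - (LINT x|P. g x)\<bar> \<le> e + (2 * B' + e) * measure P (off_cube R)"
      by (rule integral_diff_le_off_cube[OF P fm B'(1) gi[OF P] g(3) g(2) pos(1)])
    also have "\<dots> \<le> e + (2 * B' + e) * \<epsilon>" using small pos by (intro add_left_mono mult_left_mono) auto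
    finally show ?thesis unfolding e2 .
  qed
  have "(\<lambda>n. CLINT x|N n. complex_of_real (g x)) \<longlonglongrightarrow> (CLINT x|\<nu>. complex_of_real (g x))"
    by (rule trig_poly_integral_tendsto[OF g(1) N \<nu> chf])
  then have "(\<lambda>n. LINT x|N n. g x) \<longlonglongrightarrow> (LINT x|\<nu>. g x)"
    unfolding integral_complex_of_real tendsto_of_real_iff .
  then have "eventually (\<lambda>n. \<bar>(LINT x|N n. g x) - (LINT x|\<nu>. g x)\<bar> < r / 4) sequentially"
    using r by (auto dest!: tendstoD[where e = "r / 4"] simp: dist_real_def)
  with R1[OF R(2)] have "eventually (\<lambda>n. norm ((LINT x|N n. f x) - (LINT x|\<nu>. f x)) < r) sequentially"
  proof eventually_elim
    case (elim n)
    have "\<bar>(LINT x|N n. f x) - (LINT x|N n. g x)\<bar> \<le> r / 4" by (rule diff[OF N elim(1)])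
    moreover have "\<bar>(LINT x|\<nu>. f x) - (LINT x|\<nu>. g x)\<bar> \<le> r / 4" by (rule diff[OF \<nu> R2[OF R(3)]])
    ultimately show ?case using elim(2) r unfolding real_norm_def by linarith
  qed
  then show "\<exists>no. \<forall>n\<ge>no. norm ((LINT x|N n. f x) - (LINT x|\<nu>. f x)) < r"
    unfolding eventually_sequentially .
qed

section \<open>A multivariate central limit theorem with negligible error\<close>

context prob_space
begin

text \<open>For positive variance this is the central limit theorem on the line, evaluated at the
  standard deviation. For variance 0 the summands vanish almost surely.\<close>

lemma chf_clt:
  fixes V :: "nat \<Rightarrow> 'a \<Rightarrow> real"
  assumes ind: "indep_vars (\<lambda>_. borel) V UNIV" and dist: "\<And>l. distr M borel (V l) = distr M borel (V 0)"
    and sq: "\<And>l. integrable M (\<lambda>\<omega>. (V l \<omega>)\<^sup>2)" and mean: "\<And>l. expectation (V l) = 0"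
    and var: "\<And>l. expectation (\<lambda>\<omega>. (V l \<omega>)\<^sup>2) = v"
  shows "(\<lambda>n. CLINT \<omega>|M. iexp ((\<Sum>l<n. V l \<omega>) / sqrt (real n))) \<longlonglongrightarrow> exp (complex_of_real (- v / 2))"
proof -
  have [measurable]: "random_variable borel (V l)" for l using ind unfolding indep_vars_def2 by simp
  have v0: "v \<ge> 0" unfolding var[of 0, symmetric] by simp
  show ?thesis
  proof (cases "v = 0")
    case True
    have "AE \<omega> in M. V l \<omega> = 0" for l
    proof -
      have "AE \<omega> in M. (V l \<omega>)\<^sup>2 = 0"
        using integral_nonneg_eq_0_iff_AE[OF sq[of l]] var[of l] True by simp
      then show ?thesis by simp
    qed
    then have ae: "AE \<omega> in M. \<forall>l. V l \<omega> = 0" by (simp add: AE_all_countable)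
    have "(CLINT \<omega>|M. iexp ((\<Sum>l<n. V l \<omega>) / sqrt (real n))) = (CLINT \<omega>|M. 1)" for n
      by (rule integral_cong_AE) (use ae in \<open>auto elim: eventually_mono\<close>)
    then show ?thesis using True by (simp add: prob_space)
  next
    case False
    with v0 have v: "v > 0" by simp
    define s where "s = sqrt v"
    have s: "s > 0" "s\<^sup>2 = v" using v by (auto simp: s_def)
    define D where "D n = distr M borel (\<lambda>\<omega>. (\<Sum>l<n. V l \<omega>) / sqrt (real n * s\<^sup>2))" for n :: nat
    have "weak_conv_m D std_normal_distribution"
      unfolding D_def
    proof (rule central_limit_theorem_zero_mean[OF ind mean s(1) sq])
      show "variance (V n) = s\<^sup>2" for n using var[of n] mean[of n] s by simp
      show "distr M borel (V n) = distr M borel (V 0)" for n by (rule dist)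
    qed
    moreover have "real_distribution (D n)" for n
      unfolding D_def by (intro real_distribution_distr) measurable
    ultimately have "(\<lambda>n. char (D n) s) \<longlonglongrightarrow> char std_normal_distribution s"
      by (intro levy_continuity1 real_dist_normal_dist)
    moreover have "char (D n) s = (CLINT \<omega>|M. iexp ((\<Sum>l<n. V l \<omega>) / sqrt (real n)))" for n
    proof -
      have "char (D n) s = (CLINT \<omega>|M. iexp (s * ((\<Sum>l<n. V l \<omega>) / sqrt (real n * s\<^sup>2))))"
        unfolding char_def D_def by (rule integral_distr) measurable
      also have "(\<lambda>\<omega>. s * ((\<Sum>l<n. V l \<omega>) / sqrt (real n * s\<^sup>2))) = (\<lambda>\<omega>. (\<Sum>l<n. V l \<omega>) / sqrt (real n))"
      proof -
        have "sqrt (real n * s\<^sup>2) = sqrt (real n) * s" using s(1) by (simp add: real_sqrt_mult)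
        then show ?thesis using s(1) by (simp only: fun_eq_iff) simp
      qed
      finally show ?thesis .
    qed
    moreover have "char std_normal_distribution s = exp (complex_of_real (- v / 2))"
      unfolding char_std_normal_distribution using s(2) by (simp only: exp_of_real)
    ultimately show ?thesis by simp
  qed
qed

end

lemma norm_iexp_diff_le: "norm (iexp a - iexp b) \<le> min 2 \<bar>a - b\<bar>"
proof -
  have "norm (iexp a - iexp b) \<le> norm (iexp a) + norm (iexp b)" by (rule norm_triangle_ineq4)
  moreover have "iexp a - iexp b = iexp b * (iexp (a - b) - 1)"
    by (simp add: right_diff_distrib exp_add[symmetric] algebra_simps)
  moreover have "norm (iexp (a - b) - 1) \<le> \<bar>a - b\<bar>"
    using iexp_approx1[of "a - b" 0] by (simp add: norm_minus_commute)
  ultimately show ?thesis by (simp add: norm_mult)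
qed

context prob_space
begin

text \<open>Linear combinations of the coordinates reduce the limit of the characteristic functions
  to one dimension. Tightness comes from the bounded second moments, and an error that tends to 0 in
  probability affects neither.\<close>

theorem multivariate_clt_with_error:
  fixes W :: "nat \<Rightarrow> 'a \<Rightarrow> real ^ 'm" and Z :: "nat \<Rightarrow> 'a \<Rightarrow> real ^ 'm"
  assumes ind: "indep_vars (\<lambda>_. borel) W UNIV" and dist: "\<And>l. distr M borel (W l) = distr M borel (W 0)"
    and sq: "\<And>r. integrable M (\<lambda>\<omega>. (W 0 \<omega> $ r)\<^sup>2)" and mean: "\<And>r. expectation (\<lambda>\<omega>. W 0 \<omega> $ r) = 0"
    and Z: "\<And>n. random_variable borel (Z n)"
    and err: "\<And>\<eta>. \<eta> > 0 \<Longrightarrow>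
      (\<lambda>n. prob {\<omega> \<in> space M. \<eta> < norm (Z n \<omega> - (1 / sqrt (real n)) *\<^sub>R (\<Sum>l<n. W l \<omega>))}) \<longlonglongrightarrow> 0"
  shows "\<exists>\<nu>. multivariate_normal 0 (\<chi> r s. expectation (\<lambda>\<omega>. W 0 \<omega> $ r * W 0 \<omega> $ s)) \<nu> \<and> converges_in_distribution M Z \<nu>"
proof -
  note [measurable] = Z
  have W [measurable]: "random_variable borel (W l)" for l using ind unfolding indep_vars_def2 by simp
  have comp [measurable]: "random_variable borel (\<lambda>\<omega>. W l \<omega> $ r)" for l r
    using W[of l] unfolding borel_measurable_vec_lambda_iff by blast
  define \<Sigma> :: "real ^ 'm ^ 'm" where "\<Sigma> = (\<chi> r s. expectation (\<lambda>\<omega>. W 0 \<omega> $ r * W 0 \<omega> $ s))"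
  have transfer: "integrable M (\<lambda>\<omega>. h (W l \<omega>)) \<longleftrightarrow> integrable M (\<lambda>\<omega>. h (W 0 \<omega>))"
      "expectation (\<lambda>\<omega>. h (W l \<omega>)) = expectation (\<lambda>\<omega>. h (W 0 \<omega>))"
    if [measurable]: "h \<in> borel_measurable borel" for h :: "real ^ 'm \<Rightarrow> real" and l
  proof -
    have "integrable M (\<lambda>\<omega>. h (W l \<omega>)) \<longleftrightarrow> integrable (distr M borel (W l)) h"
      by (simp add: integrable_distr_eq)
    also have "\<dots> \<longleftrightarrow> integrable M (\<lambda>\<omega>. h (W 0 \<omega>))"
      unfolding dist[of l] by (simp add: integrable_distr_eq)
    finally show "integrable M (\<lambda>\<omega>. h (W l \<omega>)) \<longleftrightarrow> integrable M (\<lambda>\<omega>. h (W 0 \<omega>))" .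
    have "expectation (\<lambda>\<omega>. h (W l \<omega>)) = integral\<^sup>L (distr M borel (W l)) h" by (simp add: integral_distr)
    also have "\<dots> = expectation (\<lambda>\<omega>. h (W 0 \<omega>))" unfolding dist[of l] by (simp add: integral_distr)
    finally show "expectation (\<lambda>\<omega>. h (W l \<omega>)) = expectation (\<lambda>\<omega>. h (W 0 \<omega>))" .
  qed
  have coord [measurable]: "(\<lambda>x :: real ^ 'm. x $ r) \<in> borel_measurable borel" for r
    by (intro borel_measurable_continuous_onI continuous_intros)
  have i1: "integrable M (\<lambda>\<omega>. W 0 \<omega> $ r)" for r
    by (rule square_integrable_imp_integrable[OF _ sq]) simp
  have prod: "integrable M (\<lambda>\<omega>. W 0 \<omega> $ r * W 0 \<omega> $ s)" for r s
  proof (rule Bochner_Integration.integrable_bound)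
    show "integrable M (\<lambda>\<omega>. (W 0 \<omega> $ r)\<^sup>2 + (W 0 \<omega> $ s)\<^sup>2)" using sq by simp
    have "\<bar>a * b\<bar> \<le> a\<^sup>2 + b\<^sup>2" for a b :: real
    proof -
      have "2 * (\<bar>a\<bar> * \<bar>b\<bar>) \<le> a\<^sup>2 + b\<^sup>2"
        using sum_squares_bound[of "\<bar>a\<bar>" "\<bar>b\<bar>"] by (simp add: mult.assoc)
      moreover have "0 \<le> \<bar>a\<bar> * \<bar>b\<bar>" by simp
      ultimately show ?thesis unfolding abs_mult by linarith
    qed
    then show "AE \<omega> in M. norm (W 0 \<omega> $ r * W 0 \<omega> $ s) \<le> norm ((W 0 \<omega> $ r)\<^sup>2 + (W 0 \<omega> $ s)\<^sup>2)" by simp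
  qed simp
  have sq_t: "(t \<bullet> w)\<^sup>2 = (\<Sum>r\<in>UNIV. \<Sum>s\<in>UNIV. t $ r * t $ s * (w $ r * w $ s))" for t w :: "real ^ 'm"
    unfolding inner_vec_def power2_eq_square sum_product by (intro sum.cong refl) simp
  have int_t: "integrable M (\<lambda>\<omega>. (t \<bullet> W 0 \<omega>)\<^sup>2)" for t
    unfolding sq_t using prod by (intro Bochner_Integration.integrable_sum integrable_mult_right)
  have var_t: "expectation (\<lambda>\<omega>. (t \<bullet> W 0 \<omega>)\<^sup>2) = t \<bullet> (\<Sigma> *v t)" for t
  proof -
    have "expectation (\<lambda>\<omega>. (t \<bullet> W 0 \<omega>)\<^sup>2) = (\<Sum>r\<in>UNIV. \<Sum>s\<in>UNIV. t $ r * t $ s * \<Sigma> $ r $ s)"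
      unfolding sq_t \<Sigma>_def using prod by (simp add: Bochner_Integration.integral_sum Bochner_Integration.integrable_sum)
    then show ?thesis by (simp add: inner_vec_def matrix_vector_mult_def sum_distrib_left mult_ac)
  qed
  have mean_t: "expectation (\<lambda>\<omega>. t \<bullet> W 0 \<omega>) = 0" for t
    unfolding inner_vec_def using i1 mean by (simp add: Bochner_Integration.integral_sum)
  have "\<exists>\<nu>. multivariate_normal 0 \<Sigma> \<nu>"
  proof (rule multivariate_normal_exists)
    show "transpose \<Sigma> = \<Sigma>" by (simp add: \<Sigma>_def transpose_def vec_eq_iff mult.commute)
    show "0 \<le> t \<bullet> (\<Sigma> *v t)" for t unfolding var_t[symmetric] by simp
  qed
  then obtain \<nu> where \<nu>: "multivariate_normal 0 \<Sigma> \<nu>" by blast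
  then have \<nu>p: "prob_space \<nu>" "sets \<nu> = sets borel"
    and \<nu>c: "\<And>t. (CLINT x|\<nu>. iexp (t \<bullet> x)) = exp (complex_of_real (- (t \<bullet> (\<Sigma> *v t)) / 2))"
    unfolding multivariate_normal_def by auto
  define S where "S n \<omega> = (1 / sqrt (real n)) *\<^sub>R (\<Sum>l<n. W l \<omega>)" for n \<omega>
  have S [measurable]: "random_variable borel (S n)" for n unfolding S_def[abs_def] by measurable
  have err': "(\<lambda>n. prob {\<omega> \<in> space M. \<eta> < norm (Z n \<omega> - S n \<omega>)}) \<longlonglongrightarrow> 0" if "\<eta> > 0" for \<eta>
    using err[OF that] unfolding S_def .
  have indt: "indep_vars (\<lambda>_. borel) (\<lambda>l \<omega>. t \<bullet> W l \<omega>) UNIV" for t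
    by (rule indep_vars_compose2[OF ind]) simp
  have chfS: "(\<lambda>n. CLINT \<omega>|M. iexp (t \<bullet> S n \<omega>)) \<longlonglongrightarrow> (CLINT x|\<nu>. iexp (t \<bullet> x))" for t
  proof -
    have "(\<lambda>n. CLINT \<omega>|M. iexp ((\<Sum>l<n. t \<bullet> W l \<omega>) / sqrt (real n))) \<longlonglongrightarrow> exp (complex_of_real (- (t \<bullet> (\<Sigma> *v t)) / 2))"
    proof (rule chf_clt[OF indt])
      fix l
      have "distr M borel (\<lambda>\<omega>. t \<bullet> W l \<omega>) = distr (distr M borel (W l)) borel (\<lambda>x. t \<bullet> x)"
        by (subst distr_distr) (simp_all add: comp_def)
      then show "distr M borel (\<lambda>\<omega>. t \<bullet> W l \<omega>) = distr M borel (\<lambda>\<omega>. t \<bullet> W 0 \<omega>)"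
        unfolding dist[of l] by (subst (asm) distr_distr) (simp_all add: comp_def)
      show "integrable M (\<lambda>\<omega>. (t \<bullet> W l \<omega>)\<^sup>2)" using transfer(1)[of "\<lambda>x. (t \<bullet> x)\<^sup>2" l] int_t by simp
      show "expectation (\<lambda>\<omega>. t \<bullet> W l \<omega>) = 0" using transfer(2)[of "\<lambda>x. t \<bullet> x" l] mean_t by simp
      show "expectation (\<lambda>\<omega>. (t \<bullet> W l \<omega>)\<^sup>2) = t \<bullet> (\<Sigma> *v t)" using transfer(2)[of "\<lambda>x. (t \<bullet> x)\<^sup>2" l] var_t by simp
    qed
    moreover have "t \<bullet> S n \<omega> = (\<Sum>l<n. t \<bullet> W l \<omega>) / sqrt (real n)" for n \<omega>
      unfolding S_def by (simp add: inner_sum_right)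
    ultimately show ?thesis unfolding \<nu>c by simp
  qed
  have chf_int: "complex_integrable M (\<lambda>\<omega>. iexp (t \<bullet> Y \<omega>))" if [measurable]: "random_variable borel Y" for t and Y :: "'a \<Rightarrow> real ^ 'm"
    by (rule integrable_const_bound[of _ 1]) auto
  have chfZ: "(\<lambda>n. CLINT \<omega>|M. iexp (t \<bullet> Z n \<omega>)) \<longlonglongrightarrow> (CLINT x|\<nu>. iexp (t \<bullet> x))" for t
  proof (rule Lim_transform2[OF chfS])
    show "(\<lambda>n. (CLINT \<omega>|M. iexp (t \<bullet> S n \<omega>)) - (CLINT \<omega>|M. iexp (t \<bullet> Z n \<omega>))) \<longlonglongrightarrow> 0"
    proof (rule LIMSEQ_I)
      fix e :: real assume e: "e > 0"
      define \<eta> where "\<eta> = (e / 4) / (norm t + 1)"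
      have t1: "norm t + 1 > 0" using norm_ge_zero[of t] by linarith
      then have \<eta>0: "\<eta> > 0" using e by (simp add: \<eta>_def)
      then have "norm t * \<eta> \<le> (norm t + 1) * \<eta>" by (intro mult_right_mono) auto
      also have "\<dots> = e / 4"
      proof -
        have "u * (c / u) = c" if "u > 0" for u c :: real using that by simp
        then show ?thesis using t1 unfolding \<eta>_def by blast
      qed
      finally have \<eta>: "\<eta> > 0" "norm t * \<eta> \<le> e / 4" using \<eta>0 by auto
      have bound: "norm ((CLINT \<omega>|M. iexp (t \<bullet> S n \<omega>)) - (CLINT \<omega>|M. iexp (t \<bullet> Z n \<omega>)))
          \<le> e / 4 + 2 * prob {\<omega> \<in> space M. \<eta> < norm (Z n \<omega> - S n \<omega>)}" for n
      proof -
        let ?A = "{\<omega> \<in> space M. \<eta> < norm (Z n \<omega> - S n \<omega>)}"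
        have A [measurable]: "?A \<in> events" by measurable
        have "norm ((CLINT \<omega>|M. iexp (t \<bullet> S n \<omega>)) - (CLINT \<omega>|M. iexp (t \<bullet> Z n \<omega>)))
            = norm (CLINT \<omega>|M. iexp (t \<bullet> S n \<omega>) - iexp (t \<bullet> Z n \<omega>))"
          by (simp only: Bochner_Integration.integral_diff[OF chf_int[OF S] chf_int[OF Z]])
        also have "\<dots> \<le> (LINT \<omega>|M. norm (iexp (t \<bullet> S n \<omega>) - iexp (t \<bullet> Z n \<omega>)))"
          by (rule integral_norm_bound)
        also have "\<dots> \<le> (LINT \<omega>|M. e / 4 + 2 * indicator ?A \<omega>)"
        proof (rule integral_mono)
          show "integrable M (\<lambda>\<omega>. norm (iexp (t \<bullet> S n \<omega>) - iexp (t \<bullet> Z n \<omega>)))"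
            by (intro integrable_norm Bochner_Integration.integrable_diff chf_int S Z)
          show "integrable M (\<lambda>\<omega>. e / 4 + 2 * indicator ?A \<omega>)"
            by (intro Bochner_Integration.integrable_add integrable_mult_right integrable_real_indicator) (auto simp: emeasure_eq_measure)
          fix \<omega> assume \<omega>: "\<omega> \<in> space M"
          have le: "norm (iexp (t \<bullet> S n \<omega>) - iexp (t \<bullet> Z n \<omega>)) \<le> min 2 \<bar>t \<bullet> S n \<omega> - t \<bullet> Z n \<omega>\<bar>"
            by (rule norm_iexp_diff_le)
          show "norm (iexp (t \<bullet> S n \<omega>) - iexp (t \<bullet> Z n \<omega>)) \<le> e / 4 + 2 * indicator ?A \<omega>"
          proof (cases "\<omega> \<in> ?A")
            case True then show ?thesis using le e by simp
          next
            case False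
            then have d: "norm (Z n \<omega> - S n \<omega>) \<le> \<eta>" using \<omega> by simp
            have "\<bar>t \<bullet> S n \<omega> - t \<bullet> Z n \<omega>\<bar> = \<bar>t \<bullet> (Z n \<omega> - S n \<omega>)\<bar>" by (simp add: inner_diff_right)
            also have "\<dots> \<le> norm t * norm (Z n \<omega> - S n \<omega>)" by (rule Cauchy_Schwarz_ineq2)
            also have "\<dots> \<le> norm t * \<eta>" using d by (intro mult_left_mono) auto
            finally show ?thesis using le \<eta> False by simp
          qed
        qed
        also have "\<dots> = e / 4 + 2 * prob ?A"
        proof -
          have ii: "integrable M (indicator ?A :: 'a \<Rightarrow> real)"
            by (intro integrable_real_indicator) (auto simp: emeasure_eq_measure)
          show ?thesis
            by (subst Bochner_Integration.integral_add) (use ii in \<open>auto simp: prob_space\<close>)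
        qed
        finally show ?thesis .
      qed
      have "eventually (\<lambda>n. prob {\<omega> \<in> space M. \<eta> < norm (Z n \<omega> - S n \<omega>)} < e / 4) sequentially"
        using err'[OF \<eta>(1)] by (rule order_tendstoD) (use e in simp)
      then have "eventually (\<lambda>n. norm ((CLINT \<omega>|M. iexp (t \<bullet> S n \<omega>)) - (CLINT \<omega>|M. iexp (t \<bullet> Z n \<omega>)) - 0) < e) sequentially"
      proof eventually_elim
        case (elim n)
        then show ?case using bound[of n] e unfolding diff_zero by linarith
      qed
      then show "\<exists>no. \<forall>n\<ge>no. norm ((CLINT \<omega>|M. iexp (t \<bullet> S n \<omega>)) - (CLINT \<omega>|M. iexp (t \<bullet> Z n \<omega>)) - 0) < e"
        unfolding eventually_sequentially .
    qed
  qed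
  define v where "v = (\<Sum>r\<in>UNIV. expectation (\<lambda>\<omega>. (W 0 \<omega> $ r)\<^sup>2))"
  have S2: "integrable M (\<lambda>\<omega>. (norm (S n \<omega>))\<^sup>2) \<and> expectation (\<lambda>\<omega>. (norm (S n \<omega>))\<^sup>2) \<le> v" for n
  proof -
    have eq: "(norm (S n \<omega>))\<^sup>2 = (\<Sum>r\<in>UNIV. (1 / real n) * (\<Sum>l<n. W l \<omega> $ r)\<^sup>2)" for \<omega>
    proof -
      have "(norm (S n \<omega>))\<^sup>2 = (\<Sum>r\<in>UNIV. (S n \<omega> $ r)\<^sup>2)"
        unfolding power2_norm_eq_inner by (simp add: inner_vec_def power2_eq_square)
      also have "\<dots> = (\<Sum>r\<in>UNIV. (1 / real n) * (\<Sum>l<n. W l \<omega> $ r)\<^sup>2)"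
        unfolding S_def by (intro sum.cong refl) (simp add: power_mult_distrib power_divide)
      finally show ?thesis .
    qed
    have indr: "indep_vars (\<lambda>_. borel) (\<lambda>l \<omega>. W l \<omega> $ r) UNIV" for r
      by (rule indep_vars_compose2[OF ind]) simp
    have sqr: "integrable M (\<lambda>\<omega>. (W l \<omega> $ r)\<^sup>2)" for l r using transfer(1)[of "\<lambda>x. (x $ r)\<^sup>2" l] sq by simp
    have mr: "expectation (\<lambda>\<omega>. W l \<omega> $ r) = 0" for l r using transfer(2)[of "\<lambda>x. x $ r" l] mean by simp
    have vr: "expectation (\<lambda>\<omega>. (W l \<omega> $ r)\<^sup>2) = expectation (\<lambda>\<omega>. (W 0 \<omega> $ r)\<^sup>2)" for l r
      using transfer(2)[of "\<lambda>x. (x $ r)\<^sup>2" l] by simp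
    note sm = second_moment_indep_sum[OF indr sqr mr vr]
    have "expectation (\<lambda>\<omega>. (norm (S n \<omega>))\<^sup>2) = (\<Sum>r\<in>UNIV. (1 / real n) * (real n * expectation (\<lambda>\<omega>. (W 0 \<omega> $ r)\<^sup>2)))"
      unfolding eq using sm by (simp add: Bochner_Integration.integral_sum)
    also have "\<dots> \<le> v" unfolding v_def by (intro sum_mono) (cases "n = 0", simp_all)
    finally show ?thesis
      unfolding eq using sm by (auto intro!: Bochner_Integration.integrable_sum integrable_mult_right)
  qed
  have "v \<ge> 0" unfolding v_def by (intro sum_nonneg) simp
  have tight: "\<exists>R\<^sub>0. \<forall>R\<ge>R\<^sub>0. eventually (\<lambda>n. measure (distr M borel (Z n)) (off_cube R) \<le> \<epsilon>) sequentially" if \<epsilon>: "\<epsilon> > 0" for \<epsilon>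
  proof -
    define R0 where "R0 = 2 + 8 * v / \<epsilon>"
    have R0: "R0 \<ge> 2" "8 * v / \<epsilon> \<le> R0" using \<open>v \<ge> 0\<close> \<epsilon> by (auto simp: R0_def)
    have "eventually (\<lambda>n. measure (distr M borel (Z n)) (off_cube R) \<le> \<epsilon>) sequentially" if R: "R \<ge> R0" for R
    proof -
      have "eventually (\<lambda>n. prob {\<omega> \<in> space M. 1 < norm (Z n \<omega> - S n \<omega>)} < \<epsilon> / 2) sequentially"
        using err'[OF zero_less_one] by (rule order_tendstoD) (use \<epsilon> in simp)
      then show ?thesis
      proof eventually_elim
        case (elim n)
        let ?A = "{\<omega> \<in> space M. 1 < norm (Z n \<omega> - S n \<omega>)}"
        let ?B = "{\<omega> \<in> space M. (R / 2)\<^sup>2 \<le> (norm (S n \<omega>))\<^sup>2}"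
        have R2: "R \<ge> 2" using R R0 by simp
        have "measure (distr M borel (Z n)) (off_cube R) = prob (Z n -` off_cube R \<inter> space M)"
          by (intro measure_distr) auto
        also have "\<dots> \<le> prob (?A \<union> ?B)"
        proof (rule finite_measure_mono)
          show "Z n -` off_cube R \<inter> space M \<subseteq> ?A \<union> ?B"
          proof
            fix \<omega> assume "\<omega> \<in> Z n -` off_cube R \<inter> space M"
            then obtain b :: "real ^ 'm" where b: "b \<in> Basis" "R < \<bar>Z n \<omega> \<bullet> b\<bar>" and \<omega>: "\<omega> \<in> space M"
              unfolding off_cube_def by auto
            have "R < norm (Z n \<omega>)" using b Basis_le_norm[OF b(1), of "Z n \<omega>"] by linarith
            moreover have "norm (Z n \<omega>) \<le> norm (Z n \<omega> - S n \<omega>) + norm (S n \<omega>)"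
              using norm_triangle_ineq[of "Z n \<omega> - S n \<omega>" "S n \<omega>"] by simp
            ultimately have "1 < norm (Z n \<omega> - S n \<omega>) \<or> R / 2 \<le> norm (S n \<omega>)" using R2 by linarith
            then show "\<omega> \<in> ?A \<union> ?B" using \<omega> R2 by (auto intro!: power_mono)
          qed
        qed measurable
        also have "\<dots> \<le> prob ?A + prob ?B" by (intro measure_Un_le) auto
        also have "prob ?B \<le> expectation (\<lambda>\<omega>. (norm (S n \<omega>))\<^sup>2) / (R / 2)\<^sup>2"
          by (rule integral_Markov_inequality_measure[where A = "{}"]) (use S2[of n] R2 in auto)
        also have "\<dots> \<le> v / (R / 2)\<^sup>2" using S2[of n] by (intro divide_right_mono) auto
        also have "\<dots> \<le> \<epsilon> / 2"
        proof -
          have "8 * v / \<epsilon> \<le> R" using R R0(2) by simp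
          then have "8 * v \<le> \<epsilon> * R" using \<epsilon> by (simp add: divide_le_eq mult.commute)
          also have "\<dots> \<le> \<epsilon> * R\<^sup>2" using R2 \<epsilon> by (simp add: power2_eq_square)
          finally show ?thesis using R2 by (simp add: field_simps power2_eq_square)
        qed
        finally show ?case using elim by linarith
      qed
    qed
    then show ?thesis by blast
  qed
  have "converges_in_distribution M Z \<nu>"
    unfolding converges_in_distribution_def
  proof (intro conjI allI impI)
    fix f :: "real ^ 'm \<Rightarrow> real" assume f: "continuous_on UNIV f \<and> bounded (range f)"
    have fm [measurable]: "f \<in> borel_measurable borel" using f by (intro borel_measurable_continuous_onI) simp
    have "(\<lambda>n. LINT x|distr M borel (Z n). f x) \<longlonglongrightarrow> (LINT x|\<nu>. f x)"
    proof (rule weak_convergence_from_chf_tight[OF _ _ \<nu>p _ tight])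
      show "prob_space (distr M borel (Z n))" for n by (rule prob_space_distr) (rule Z)
      have "(CLINT x|distr M borel (Z n). iexp (t \<bullet> x)) = (CLINT \<omega>|M. iexp (t \<bullet> Z n \<omega>))" for t n
        by (rule integral_distr) measurable
      then show "(\<lambda>n. CLINT x|distr M borel (Z n). iexp (t \<bullet> x)) \<longlonglongrightarrow> (CLINT x|\<nu>. iexp (t \<bullet> x))" for t
        using chfZ by simp
    qed (use f in auto)
    then show "(\<lambda>n. LINT \<omega>|M. f (Z n \<omega>)) \<longlonglongrightarrow> (LINT x|\<nu>. f x)" by (simp add: integral_distr)
  qed (rule Z)
  with \<nu> show ?thesis unfolding \<Sigma>_def by blast
qed

end

section \<open>Continuous distribution functions and quantiles\<close>

locale continuous_cdf = prob_space M for M :: "'a measure" +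
  fixes X :: "'a \<Rightarrow> real" and F :: "real \<Rightarrow> real"
  assumes X_meas [measurable]: "random_variable borel X"
    and F_eq: "F = cdf (distr M borel X)"
    and F_cont: "continuous_on UNIV F"
begin

lemma F_apply: "F x = prob {\<omega> \<in> space M. X \<omega> \<le> x}"
proof -
  have "X -` {..x} \<inter> space M = {\<omega> \<in> space M. X \<omega> \<le> x}" by auto
  then show ?thesis unfolding F_eq cdf_def by (simp add: measure_distr)
qed

lemma F_real_distribution: "real_distribution (distr M borel X)"
  by (rule real_distribution_distr) simp

lemma F_mono: "x \<le> y \<Longrightarrow> F x \<le> F y"
  unfolding F_apply by (intro finite_measure_mono) auto

lemma F_measurable [measurable]: "F \<in> borel_measurable borel"
  using F_cont by (rule borel_measurable_continuous_onI)

lemma F_limits: "(F \<longlongrightarrow> 0) at_bot" "(F \<longlongrightarrow> 1) at_top"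
proof -
  interpret R: real_distribution "distr M borel X" by (rule F_real_distribution)
  show "(F \<longlongrightarrow> 0) at_bot" "(F \<longlongrightarrow> 1) at_top"
    unfolding F_eq using R.cdf_lim_at_bot R.cdf_lim_at_top_prob by auto
qed

lemma F_below: "t > 0 \<Longrightarrow> \<exists>x. F x < t"
  using order_tendstoD(2)[OF F_limits(1)] eventually_happens[of _ "at_bot :: real filter"] by fastforce

lemma F_above: "t < 1 \<Longrightarrow> \<exists>x. t < F x"
  using order_tendstoD(1)[OF F_limits(2)] eventually_happens[of _ "at_top :: real filter"] by fastforce

text \<open>By continuity the superlevel set of \<open>F\<close> is closed and \<open>F\<close>
  takes the value \<open>t\<close> at its infimum.\<close>

lemma quantile_attained:
  assumes t: "0 < t" "t < 1"
  shows "F (quantile F t) = t" and "t \<le> F x \<longleftrightarrow> quantile F t \<le> x"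
proof -
  let ?S = "{x. F x \<ge> t}"
  have ne: "?S \<noteq> {}" using F_above[OF t(2)] less_imp_le by blast
  obtain l where l: "F l < t" using F_below[OF t(1)] by blast
  have lb: "l \<le> x" if "x \<in> ?S" for x
    using l that F_mono[of x l] by (cases "x \<le> l") auto
  then have bdd: "bdd_below ?S" by (rule bdd_belowI)
  have "closed ?S" using F_cont by (intro closed_Collect_le continuous_on_const) auto
  then have inS: "quantile F t \<in> ?S" unfolding quantile_def by (rule closed_contains_Inf[OF ne bdd])
  show iff: "t \<le> F x \<longleftrightarrow> quantile F t \<le> x" for x
  proof
    assume "t \<le> F x"
    then show "quantile F t \<le> x" unfolding quantile_def using bdd by (intro cInf_lower) auto
  next
    assume "quantile F t \<le> x"
    then show "t \<le> F x" using inS F_mono[of "quantile F t" x] by simp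
  qed
  have "\<exists>x\<ge>l. x \<le> quantile F t \<and> F x = t"
    using IVT'[of F l t "quantile F t"] l inS lb[OF inS] continuous_on_subset[OF F_cont] by auto
  then obtain x where "x \<le> quantile F t" "F x = t" by blast
  then show "F (quantile F t) = t" using iff[of x] by auto
qed

lemma quantile_mono: "mono_on {0<..<1} (quantile F)"
proof (rule mono_onI)
  fix s t :: real assume st: "s \<in> {0<..<1}" "t \<in> {0<..<1}" "s \<le> t"
  then have "s \<le> F (quantile F t)" using quantile_attained(1)[of t] by simp
  then show "quantile F s \<le> quantile F t" using quantile_attained(2)[of s] st by simp
qed

lemma F_uniform_open:
  assumes t: "0 < t" "t < 1"
  shows "prob {\<omega> \<in> space M. F (X \<omega>) \<le> t} = t"
proof -
  let ?S = "{x. F x \<le> t}"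
  have ne: "?S \<noteq> {}" using F_below[OF t(1)] less_imp_le by blast
  obtain h where h: "t < F h" using F_above[OF t(2)] by blast
  have ub: "x \<le> h" if "x \<in> ?S" for x
    using h that F_mono[of h x] by (cases "h \<le> x") auto
  then have bdd: "bdd_above ?S" by (rule bdd_aboveI)
  have "closed ?S" using F_cont by (intro closed_Collect_le continuous_on_const) auto
  then have inS: "Sup ?S \<in> ?S" by (rule closed_contains_Sup[OF ne bdd])
  have iff: "F x \<le> t \<longleftrightarrow> x \<le> Sup ?S" for x
  proof
    assume "F x \<le> t" then show "x \<le> Sup ?S" using bdd by (intro cSup_upper) auto
  next
    assume "x \<le> Sup ?S" then show "F x \<le> t" using inS F_mono[of x "Sup ?S"] by simp
  qed
  have "quantile F t \<le> Sup ?S" by (rule iff[THEN iffD1]) (simp add: quantile_attained(1)[OF t])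
  then have "t \<le> F (Sup ?S)" using quantile_attained(2)[OF t] by blast
  then have "F (Sup ?S) = t" using inS by auto
  moreover have "{\<omega> \<in> space M. F (X \<omega>) \<le> t} = {\<omega> \<in> space M. X \<omega> \<le> Sup ?S}" using iff by blast
  ultimately show ?thesis using F_apply[of "Sup ?S"] by (simp only:)
qed

lemma F_range: "0 \<le> F x" "F x \<le> 1"
  unfolding F_apply by simp_all

lemma F_uniform:
  assumes t: "0 \<le> t" "t \<le> 1"
  shows "prob {\<omega> \<in> space M. F (X \<omega>) \<le> t} = t"
proof -
  have top: "prob {\<omega> \<in> space M. F (X \<omega>) \<le> 1} = 1" using F_range by (simp add: prob_space)
  have zero: "prob {\<omega> \<in> space M. F (X \<omega>) \<le> 0} = 0"
  proof (rule antisym)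
    show "prob {\<omega> \<in> space M. F (X \<omega>) \<le> 0} \<le> 0"
    proof (rule field_le_epsilon)
      fix e :: real assume e: "e > 0"
      define s where "s = min e (1 / 2)"
      have s: "0 < s" "s < 1" "s \<le> e" using e by (auto simp: s_def)
      have "prob {\<omega> \<in> space M. F (X \<omega>) \<le> 0} \<le> prob {\<omega> \<in> space M. F (X \<omega>) \<le> s}"
        using s by (intro finite_measure_mono) auto
      then show "prob {\<omega> \<in> space M. F (X \<omega>) \<le> 0} \<le> 0 + e" using F_uniform_open[OF s(1,2)] s(3) by simp
    qed
  qed simp
  consider "t = 0" | "t = 1" | "0 < t" "t < 1" using t by linarith
  then show ?thesis using top zero F_uniform_open by cases auto
qed

lemma AE_F_in_unit: "AE \<omega> in M. 0 < F (X \<omega>) \<and> F (X \<omega>) < 1"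
proof -
  have "AE \<omega> in M. 0 < F (X \<omega>)"
  proof (rule AE_I')
    show "{\<omega> \<in> space M. F (X \<omega>) \<le> 0} \<in> null_sets M"
      using F_uniform[of 0] by (intro null_setsI) (auto simp: emeasure_eq_measure)
  qed auto
  moreover have "AE \<omega> in M. F (X \<omega>) < 1"
  proof -
    have "prob {\<omega> \<in> space M. 1 \<le> F (X \<omega>)} \<le> 0 + e" if e: "e > 0" for e
    proof -
      define s where "s = min e (1 / 2)"
      have s: "0 < s" "s < 1" "s \<le> e" using e by (auto simp: s_def)
      have "{\<omega> \<in> space M. 1 \<le> F (X \<omega>)} \<subseteq> space M - {\<omega> \<in> space M. F (X \<omega>) \<le> 1 - s}" using s by auto
      then have "prob {\<omega> \<in> space M. 1 \<le> F (X \<omega>)} \<le> prob (space M - {\<omega> \<in> space M. F (X \<omega>) \<le> 1 - s})"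
        by (intro finite_measure_mono) auto
      also have "\<dots> = s" using F_uniform[of "1 - s"] s by (subst prob_compl) auto
      finally show ?thesis using s by simp
    qed
    then have "prob {\<omega> \<in> space M. 1 \<le> F (X \<omega>)} \<le> 0" by (rule field_le_epsilon)
    then have "{\<omega> \<in> space M. 1 \<le> F (X \<omega>)} \<in> null_sets M"
      by (intro null_setsI) (auto simp: emeasure_eq_measure intro: antisym)
    then show ?thesis by (rule AE_I') auto
  qed
  ultimately show ?thesis by eventually_elim simp
qed

text \<open>The event \<open>X \<le> r\<close> is contained in \<open>F X \<le> F r\<close>, and
  both have probability \<open>F r\<close>.\<close>

lemma AE_le_iff_F_le: "0 < F r \<Longrightarrow> F r < 1 \<Longrightarrow> AE \<omega> in M. F (X \<omega>) \<le> F r \<longrightarrow> X \<omega> \<le> r"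
proof -
  assume r: "0 < F r" "F r < 1"
  let ?A = "{\<omega> \<in> space M. F (X \<omega>) \<le> F r}" and ?B = "{\<omega> \<in> space M. X \<omega> \<le> r}"
  have sub: "?B \<subseteq> ?A" using F_mono by auto
  have "prob (?A - ?B) = prob ?A - prob ?B" by (intro finite_measure_Diff sub) auto
  also have "\<dots> = 0" using F_uniform[of "F r"] r F_apply[of r] by simp
  finally have "?A - ?B \<in> null_sets M" by (intro null_setsI) (auto simp: emeasure_eq_measure)
  then show ?thesis by (rule AE_I') auto
qed

text \<open>The quantile of \<open>F X\<close> can be smaller than \<open>X\<close> only if
  \<open>F\<close> is constant on an interval ending at \<open>X\<close>. Such an interval contains
  a rational point, so the exceptional set is a countable union of null sets.\<close>

lemma AE_quantile_F: "AE \<omega> in M. quantile F (F (X \<omega>)) = X \<omega>"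
proof -
  have "AE \<omega> in M. \<forall>r\<in>\<rat>. 0 < F r \<longrightarrow> F r < 1 \<longrightarrow> F (X \<omega>) \<le> F r \<longrightarrow> X \<omega> \<le> r"
  proof (subst AE_ball_countable[OF countable_rat], rule ballI)
    fix r
    show "AE \<omega> in M. 0 < F r \<longrightarrow> F r < 1 \<longrightarrow> F (X \<omega>) \<le> F r \<longrightarrow> X \<omega> \<le> r"
      using AE_le_iff_F_le[of r] by (cases "0 < F r \<and> F r < 1") auto
  qed
  with AE_F_in_unit show ?thesis
  proof eventually_elim
    case (elim \<omega>)
    let ?t = "F (X \<omega>)"
    have t: "0 < ?t" "?t < 1" using elim by auto
    have le: "quantile F ?t \<le> X \<omega>" using quantile_attained(2)[OF t] by blast
    show ?case
    proof (rule ccontr)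
      assume "quantile F ?t \<noteq> X \<omega>"
      with le have "quantile F ?t < X \<omega>" by simp
      then obtain r where r: "r \<in> \<rat>" "quantile F ?t < r" "r < X \<omega>" using Rats_dense_in_real by blast
      have "F r \<le> ?t" by (rule F_mono) (use r in simp)
      moreover have "?t \<le> F r" using quantile_attained(2)[OF t] r(2) by (meson less_imp_le)
      ultimately have "F r = ?t" by (rule antisym)
      then have "X \<omega> \<le> r" using elim(2)[rule_format, OF r(1)] t by (metis order_refl)
      with r show False by simp
    qed
  qed
qed

lemma AE_le_quantile_iff:
  assumes t: "0 < t" "t < 1"
  shows "AE \<omega> in M. X \<omega> \<le> quantile F t \<longleftrightarrow> F (X \<omega>) \<le> t"
proof -
  have "AE \<omega> in M. F (X \<omega>) \<le> F (quantile F t) \<longrightarrow> X \<omega> \<le> quantile F t"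
    by (rule AE_le_iff_F_le) (use quantile_attained(1)[OF t] t in auto)
  then show ?thesis
  proof eventually_elim
    case (elim \<omega>)
    then show ?case using F_mono[of "X \<omega>" "quantile F t"] unfolding quantile_attained(1)[OF t] by blast
  qed
qed

end

section \<open>Linearisation of the statistic\<close>

lemma centred_primitive_uniform_mean:
  assumes P: "unit_supported P"
  shows "integrable (uniform_measure lborel {0<..<1}) (centred_primitive P)"
    and "(LINT u|uniform_measure lborel {0<..<1}. centred_primitive P u) = 0"
proof -
  let ?I = "uniform_measure lborel {0<..<1::real}"
  interpret I: prob_space ?I by (rule prob_space_uniform_measure) auto
  have unif: "I.prob {u \<in> space ?I. u \<le> t} = t" if t: "0 \<le> t" "t \<le> 1" for t
  proof -
    have "{u \<in> space ?I. u \<le> t} = {..t}" by auto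
    then have "I.prob {u \<in> space ?I. u \<le> t} = measure lborel ({0<..<1} \<inter> {..t}) / measure lborel {0<..<1::real}"
      by (simp add: measure_uniform_measure)
    also have "measure lborel ({0<..<1} \<inter> {..t}) = t"
    proof (cases "t = 1")
      case True
      then have "{0<..<1} \<inter> {..t} = {0<..<1::real}" by auto
      then show ?thesis using True by simp
    next
      case False
      then have "{0<..<1} \<inter> {..t} = {0<..t}" using t by auto
      then show ?thesis using t by simp
    qed
    finally show ?thesis by simp
  qed
  interpret uniform_pair ?I "\<lambda>u. u" "\<lambda>u. u"
    by unfold_locales (use unif in auto)
  have ae: "AE u in ?I. 0 < u \<and> u < 1"
    by (rule AE_uniform_measureI) auto
  show "integrable ?I (centred_primitive P)" "(LINT u|?I. centred_primitive P u) = 0"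
    using centred_primitive_mean[OF P ae] by auto
qed

locale iid_sample = prob_space M for M :: "'a measure" +
  fixes X :: "nat \<Rightarrow> 'a \<Rightarrow> real ^ ('d::finite)" and F :: "'d \<Rightarrow> real \<Rightarrow> real"
  assumes X_indep: "indep_vars (\<lambda>_. borel) X UNIV"
    and X_ident: "\<And>i. distr M borel (X i) = distr M borel (X 0)"
    and F_cdf: "F = (\<lambda>j. cdf (distr M borel (\<lambda>\<omega>. X 0 \<omega> $ j)))"
    and F_continuous: "\<And>j. continuous_on UNIV (F j)"
begin

lemma X_borel [measurable]: "random_variable borel (X l)"
  using X_indep unfolding indep_vars_def2 by simp

lemma coordinate_borel [measurable]: "(\<lambda>x :: real ^ 'd. x $ j) \<in> borel_measurable borel"
  by (intro borel_measurable_continuous_onI continuous_intros)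

lemma coordinate_cdf: "continuous_cdf M (\<lambda>\<omega>. X l \<omega> $ j) (F j)"
proof unfold_locales
  show "random_variable borel (\<lambda>\<omega>. X l \<omega> $ j)" by measurable
  have "distr M borel (\<lambda>\<omega>. X l \<omega> $ j) = distr (distr M borel (X l)) borel (\<lambda>x. x $ j)" for l
    by (subst distr_distr) (simp_all add: comp_def)
  then have "distr M borel (\<lambda>\<omega>. X l \<omega> $ j) = distr M borel (\<lambda>\<omega>. X 0 \<omega> $ j)"
    by (simp only: X_ident[of l])
  then show "F j = cdf (distr M borel (\<lambda>\<omega>. X l \<omega> $ j))" unfolding F_cdf by simp
qed (rule F_continuous)

lemma F_borel [measurable]: "F j \<in> borel_measurable borel"
  using F_continuous by (rule borel_measurable_continuous_onI)

definition U :: "'d \<Rightarrow> nat \<Rightarrow> 'a \<Rightarrow> real" where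
  "U j l \<omega> = F j (X l \<omega> $ j)"

lemma U_borel [measurable]: "random_variable borel (U j l)"
  unfolding U_def[abs_def] by measurable

lemma uniform_marginals: "uniform_sequence M (U j)"
proof unfold_locales
  show "indep_vars (\<lambda>_. borel) (U j) UNIV"
    unfolding U_def[abs_def] by (rule indep_vars_compose2[OF X_indep]) measurable
  show "prob {\<omega> \<in> space M. U j l \<omega> \<le> t} = t" if "0 \<le> t" "t \<le> 1" for l t
    unfolding U_def using continuous_cdf.F_uniform[OF coordinate_cdf that] .
qed

lemma uniform_pairs: "uniform_pair M (U j l) (U k l)"
  by unfold_locales (use uniform_sequence.uniform[OF uniform_marginals] in auto)

lemma AE_regular: "AE \<omega> in M. \<forall>l j. 0 < U j l \<omega> \<and> U j l \<omega> < 1 \<and> quantile (F j) (U j l \<omega>) = X l \<omega> $ j"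
proof -
  have "AE \<omega> in M. 0 < U j l \<omega> \<and> U j l \<omega> < 1 \<and> quantile (F j) (U j l \<omega>) = X l \<omega> $ j" for j l
    using continuous_cdf.AE_F_in_unit[OF coordinate_cdf[of l j]] continuous_cdf.AE_quantile_F[OF coordinate_cdf[of l j]]
    unfolding U_def by eventually_elim auto
  then show ?thesis by (simp add: AE_all_countable AE_finite_all)
qed

lemma AE_U_unit: "AE \<omega> in M. 0 < U j l \<omega> \<and> U j l \<omega> < 1"
  using AE_regular by eventually_elim blast

lemma T_stat_uniform:
  assumes reg: "\<forall>l j. 0 < U j l \<omega> \<and> U j l \<omega> < 1 \<and> quantile (F j) (U j l \<omega>) = X l \<omega> $ j"
  shows "T_stat (\<lambda>i. X i \<omega>) n f = (\<Sum>i=1..n. \<psi> F f (\<chi> j. order_stat (\<lambda>l. U j l \<omega>) n i))"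
  unfolding T_stat_def
proof (rule sum.cong[OF refl])
  fix i assume i: "i \<in> {1..n}"
  have "order_stat (\<lambda>l. X l \<omega> $ j) n i = quantile (F j) (order_stat (\<lambda>l. U j l \<omega>) n i)" for j
    by (rule order_stat_mono_image[OF continuous_cdf.quantile_mono[OF coordinate_cdf]]) (use reg i in auto)
  then show "f (\<chi> j. order_stat (\<lambda>l. X l \<omega> $ j) n i) = \<psi> F f (\<chi> j. order_stat (\<lambda>l. U j l \<omega>) n i)"
    unfolding \<psi>_def by simp
qed

lemma T_stat_borel:
  assumes [measurable]: "f \<in> borel_measurable borel"
  shows "(\<lambda>\<omega>. T_stat (\<lambda>i. X i \<omega>) n f) \<in> borel_measurable M"
  unfolding T_stat_def
proof (intro borel_measurable_sum)
  fix i assume i: "i \<in> {1..n}"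
  have "(\<lambda>\<omega>. order_stat (\<lambda>l. X l \<omega> $ j) n i) \<in> borel_measurable M" for j
    by (rule borel_measurable_order_stat) (use i in auto)
  then have "(\<lambda>\<omega>. \<chi> j. order_stat (\<lambda>l. X l \<omega> $ j) n i) \<in> borel_measurable M"
    unfolding borel_measurable_vec_lambda_iff by simp
  then show "(\<lambda>\<omega>. f (\<chi> j. order_stat (\<lambda>l. X l \<omega> $ j) n i)) \<in> borel_measurable M"
    by (rule measurable_compose) (rule assms)
qed

end

text \<open>The function \<open>q\<close> of the remainder bounds. As in condition C4, 1 is added to
  the second partials, which keeps \<open>q\<close> away from 0.\<close>

definition curvature :: "('d::finite \<Rightarrow> real \<Rightarrow> real) \<Rightarrow> (real ^ 'd \<Rightarrow> real) \<Rightarrow> real \<Rightarrow> real" where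
  "curvature F f x = (\<Sum>j\<in>UNIV. \<Sum>k\<in>UNIV. 1 + \<bar>\<psi>2 F f j k x\<bar>)"

lemma weighted_density_curvature:
  fixes F :: "'d::finite \<Rightarrow> real \<Rightarrow> real"
  assumes "C3 F f"
  shows "weighted_density (curvature F f)"
proof
  have C3: "set_integrable lborel {0<..<1} (\<lambda>x. (x * (1 - x)) powr (3 / 2) * \<bar>\<psi>2 F f j k x\<bar>)" for j k
    using assms unfolding C3_def C3_for_def by blast
  show "curvature F f x \<ge> 1" for x
  proof -
    have "1 \<le> (\<Sum>k\<in>{undefined :: 'd}. 1 + \<bar>\<psi>2 F f undefined k x\<bar>)" by simp
    also have "\<dots> \<le> (\<Sum>k\<in>UNIV. 1 + \<bar>\<psi>2 F f undefined k x\<bar>)" by (intro sum_mono2) auto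
    also have "\<dots> \<le> (\<Sum>j\<in>UNIV. \<Sum>k\<in>UNIV. 1 + \<bar>\<psi>2 F f j k x\<bar>)"
      by (rule member_le_sum) (auto intro!: sum_nonneg)
    finally show ?thesis unfolding curvature_def .
  qed
  let ?w = "\<lambda>x::real. (x * (1 - x)) powr (3 / 2)"
  have i: "integrable lborel (\<lambda>x. indicator {0<..<1} x * (?w x * \<bar>\<psi>2 F f j k x\<bar>))" for j k
    using C3[of j k] unfolding set_integrable_def by simp
  have m [measurable]: "(\<lambda>x. indicator {0<..<1} x * \<bar>\<psi>2 F f j k x\<bar>) \<in> borel_measurable borel" for j k
  proof -
    have [measurable]: "(\<lambda>x. indicator {0<..<1} x * (?w x * \<bar>\<psi>2 F f j k x\<bar>)) \<in> borel_measurable borel"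
      using borel_measurable_integrable[OF i[of j k]] by simp
    have "(\<lambda>x. (indicator {0<..<1} x * (?w x * \<bar>\<psi>2 F f j k x\<bar>)) / ?w x) \<in> borel_measurable borel" by measurable
    moreover have "(indicator {0<..<1} x * (?w x * \<bar>\<psi>2 F f j k x\<bar>)) / ?w x = indicator {0<..<1} x * \<bar>\<psi>2 F f j k x\<bar>" for x
      by (cases "x \<in> {0<..<1}") auto
    ultimately show ?thesis by simp
  qed
  have "(\<lambda>x. \<Sum>j\<in>UNIV. \<Sum>k\<in>UNIV. indicator {0<..<1} x + indicator {0<..<1} x * \<bar>\<psi>2 F f j k x\<bar>) \<in> borel_measurable borel"
    by measurable
  then show "(\<lambda>x. indicator {0<..<1} x * curvature F f x) \<in> borel_measurable borel"
    unfolding curvature_def by (simp add: sum_distrib_left distrib_left)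
  have w: "integrable lborel (\<lambda>x. indicator {0<..<1} x * ?w x)"
  proof (rule Bochner_Integration.integrable_bound)
    show "integrable lborel (indicator {0<..<1::real} :: real \<Rightarrow> real)" by simp
    have "?w x \<le> 1" if "0 < x" "x < 1" for x
      using that by (intro powr_le1) (auto intro: mult_le_one)
    then show "AE x in lborel. norm (indicator {0<..<1} x * ?w x) \<le> norm (indicator {0<..<1} x :: real)"
      by (intro AE_I2) (auto simp: indicator_def)
  qed measurable
  have "integrable lborel (\<lambda>x. \<Sum>j\<in>UNIV. \<Sum>k\<in>UNIV. indicator {0<..<1} x * ?w x + indicator {0<..<1} x * (?w x * \<bar>\<psi>2 F f j k x\<bar>))"
    by (intro Bochner_Integration.integrable_sum Bochner_Integration.integrable_add w i)
  then show "integrable lborel (\<lambda>x. indicator {0<..<1} x * (?w x * curvature F f x))"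
    unfolding curvature_def by (simp add: sum_distrib_left distrib_left)
qed

definition gradient_density :: "('d \<Rightarrow> real \<Rightarrow> real) \<Rightarrow> (real ^ 'd \<Rightarrow> real) \<Rightarrow> 'd \<Rightarrow> real \<Rightarrow> real" where
  "gradient_density F f j x = indicator {0<..<1} x * \<psi>1 F f j x"

lemma diagonal_expansion_conditions:
  fixes F :: "'d::finite \<Rightarrow> real \<Rightarrow> real"
  assumes "C3 F f" "C4 F f"
  shows "diagonal_expansion (\<psi> F f) (\<psi>1 F f) (curvature F f)"
proof -
  interpret weighted_density "curvature F f" by (rule weighted_density_curvature) (rule assms)
  show ?thesis
    by unfold_locales (use taylor_diagI_C4[OF assms(2)] q_ge_1 q_integrable_on in \<open>auto simp: curvature_def[abs_def]\<close>)
qed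

lemma gradient_density_supported:
  fixes F :: "'d::finite \<Rightarrow> real \<Rightarrow> real"
  assumes "C3 F f" "C4 F f"
  shows "unit_supported (gradient_density F f j)"
  unfolding gradient_density_def[abs_def]
proof (rule unit_supportedI)
  show "continuous_on {0<..<1} (\<psi>1 F f j)"
    by (rule diagonal_expansion.continuous_partials[OF diagonal_expansion_conditions[OF assms]])
  show "set_integrable lborel {0<..<1} (\<lambda>x. (x * (1 - x)) powr (3 / 2) * (\<psi>1 F f j x)\<^sup>2)"
    using assms(1) unfolding C3_def C3_for_def by blast
qed

lemma diagonal_primitives_conditions:
  fixes F :: "'d::finite \<Rightarrow> real \<Rightarrow> real"
  assumes "C3 F f" "C4 F f"
  shows "diagonal_primitives (\<psi> F f) (\<psi>1 F f) (curvature F f) (\<lambda>j. centred_primitive (gradient_density F f j))"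
proof -
  interpret diagonal_expansion "\<psi> F f" "\<psi>1 F f" "curvature F f" by (rule diagonal_expansion_conditions[OF assms])
  show ?thesis
  proof unfold_locales
    fix j and a b :: real assume ab: "0 < a" "a \<le> b" "b < 1"
    have "integral {a..b} (gradient_density F f j) = integral {a..b} (\<psi>1 F f j)"
      using ab by (intro Henstock_Kurzweil_Integration.integral_cong) (simp add: gradient_density_def)
    then show "centred_primitive (gradient_density F f j) b - centred_primitive (gradient_density F f j) a = integral {a..b} (\<psi>1 F f j)"
      using centred_primitive_increment[OF gradient_density_supported[OF assms] ab, of j] by simp
  qed
qed

text \<open>At arguments up to 0 the quantile is the infimum of the whole line, and beyond 1 it is
  that of the empty set. Whatever these default values are, \<open>\<gamma>\<close> is constant on
  both rays, and the point 1 contributes a single value.\<close>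

lemma \<gamma>_measurable:
  fixes F :: "'d::finite \<Rightarrow> real \<Rightarrow> real"
  assumes F: "\<And>j x. 0 \<le> F j x" "\<And>j x. F j x \<le> 1"
    and g [measurable]: "g \<in> borel_measurable borel" and eq: "\<And>x. 0 < x \<Longrightarrow> x < 1 \<Longrightarrow> \<gamma> F f x = g x"
  shows "\<gamma> F f \<in> borel_measurable borel"
proof -
  have low: "\<gamma> F f x = \<gamma> F f 0" if "x \<le> 0" for x
  proof -
    have "{y. x \<le> F j y} = {y. 0 \<le> F j y}" for j using F(1) that by (auto intro: order_trans)
    then show ?thesis unfolding \<gamma>_def \<psi>_def diag_def quantile_def by simp
  qed
  have high: "\<gamma> F f x = \<gamma> F f 2" if "x > 1" for x
  proof -
    have empty: "{y. z \<le> F j y} = {}" if "z > 1" for j z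
    proof -
      have "\<not> z \<le> F j y" for y using F(2)[of j y] that by linarith
      then show ?thesis by blast
    qed
    have "{y. x \<le> F j y} = {y. 2 \<le> F j y}" for j using empty[OF that] empty[of 2] by simp
    then show ?thesis unfolding \<gamma>_def \<psi>_def diag_def quantile_def by simp
  qed
  have "\<gamma> F f = (\<lambda>x. if x \<le> 0 then \<gamma> F f 0 else if x < 1 then g x else if x \<le> 1 then \<gamma> F f 1 else \<gamma> F f 2)"
  proof
    fix x :: real
    consider "x \<le> 0" | "0 < x" "x < 1" | "x = 1" | "x > 1" by linarith
    then show "\<gamma> F f x = (if x \<le> 0 then \<gamma> F f 0 else if x < 1 then g x else if x \<le> 1 then \<gamma> F f 1 else \<gamma> F f 2)"
    proof cases
      case 1 then show ?thesis using low[OF 1] by simp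
    next
      case 2 then show ?thesis using eq[OF 2] by simp
    next
      case 3 then show ?thesis by simp
    next
      case 4 then show ?thesis using high[OF 4] by simp
    qed
  qed
  moreover have "\<dots> \<in> borel_measurable borel" by measurable
  ultimately show ?thesis by simp
qed

text \<open>The constant is identified by integrating over the unit interval, where the centred
  primitives have mean 0.\<close>

lemma diagonal_centred_decomposition:
  fixes F :: "'d::finite \<Rightarrow> real \<Rightarrow> real"
  assumes "C3 F f" "C4 F f" and F: "\<And>j x. 0 \<le> F j x" "\<And>j x. F j x \<le> 1" and x: "0 < x" "x < 1"
  shows "\<psi> F f (diag x) = \<gamma>_bar F f + (\<Sum>j\<in>UNIV. centred_primitive (gradient_density F f j) x)"
proof -
  let ?V = "\<lambda>j. centred_primitive (gradient_density F f j)"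
  let ?I = "uniform_measure lborel {0<..<1::real}"
  interpret I: prob_space ?I by (rule prob_space_uniform_measure) auto
  obtain c where c: "\<And>x. 0 < x \<Longrightarrow> x < 1 \<Longrightarrow> \<psi> F f (diag x) = c + (\<Sum>j\<in>UNIV. ?V j x)"
    using diagonal_primitives.diagonal_eq_sum_primitives[OF diagonal_primitives_conditions[OF assms(1,2)]] by blast
  note V = centred_primitive_uniform_mean[OF gradient_density_supported[OF assms(1,2)]]
  have "AE u in ?I. u \<in> {0<..<1}" by (rule AE_uniform_measureI) auto
  then have ae: "AE u in ?I. \<gamma> F f u = c + (\<Sum>j\<in>UNIV. ?V j u)"
    by eventually_elim (simp add: \<gamma>_def c)
  have [measurable]: "?V j \<in> borel_measurable borel" for j
    using gradient_density_supported[OF assms(1,2), of j] unfolding unit_supported_def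
    by (intro centred_primitive_measurable) blast
  have g [measurable]: "(\<lambda>u. c + (\<Sum>j\<in>UNIV. ?V j u)) \<in> borel_measurable borel" by measurable
  have [measurable]: "\<gamma> F f \<in> borel_measurable borel"
    by (rule \<gamma>_measurable[OF F g]) (simp add: \<gamma>_def c)
  have "\<gamma>_bar F f = (LINT u|?I. c + (\<Sum>j\<in>UNIV. ?V j u))"
    unfolding \<gamma>_bar_def by (rule integral_cong_AE) (use ae in auto)
  also have "\<dots> = c" using V by (simp add: Bochner_Integration.integral_sum I.prob_space)
  finally show ?thesis using c[OF x] by simp
qed

context iid_sample
begin

lemma F_bounds: "0 \<le> F j x" "F j x \<le> 1"
  using continuous_cdf.F_range[OF coordinate_cdf] by auto

text \<open>The contribution of one observation to the linearised statistic.\<close>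

definition score :: "(real ^ 'd \<Rightarrow> real) \<Rightarrow> nat \<Rightarrow> 'a \<Rightarrow> real" where
  "score f l \<omega> = (\<Sum>j\<in>UNIV. centred_primitive (gradient_density F f j) (U j l \<omega>))"

text \<open>Order statistics of each coordinate enter the additive part separately, so that part is
  the sum of the scores; the rest is the sum of the additive remainders.\<close>

theorem T_stat_linearization:
  assumes C: "C3 F f" "C4 F f" and \<epsilon>: "\<epsilon> > 0" and \<eta>: "\<eta> > 0"
  shows "\<exists>n\<^sub>0. \<forall>n\<ge>n\<^sub>0. \<exists>A\<in>events. prob A \<le> \<epsilon> \<and>
    (AE \<omega> in M. \<omega> \<notin> A \<longrightarrow>
      \<bar>T_stat (\<lambda>i. X i \<omega>) n f - real n * \<gamma>_bar F f - (\<Sum>l<n. score f l \<omega>)\<bar> \<le> \<eta> * sqrt (real n))"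
proof -
  let ?V = "\<lambda>j. centred_primitive (gradient_density F f j)"
  define H where "H y = \<psi> F f y - \<gamma>_bar F f - (\<Sum>j\<in>UNIV. ?V j (y $ j))" for y
  interpret Q: weighted_density "curvature F f" by (rule weighted_density_curvature[OF C(1)])
  interpret V: diagonal_primitives "\<psi> F f" "\<psi>1 F f" "curvature F f" ?V by (rule diagonal_primitives_conditions[OF C])
  obtain M0 where M0: "\<forall>M'\<ge>M0. \<exists>K\<ge>0. \<exists>\<delta>>0. additive_remainder H (curvature F f) M' K \<delta>"
    using V.additive_remainder_bound[OF diagonal_centred_decomposition[OF C F_bounds]] unfolding H_def by (rule exE)
  have "\<exists>n\<^sub>0. \<forall>n\<ge>n\<^sub>0. \<exists>A\<in>events. prob A \<le> \<epsilon> \<and>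
    (\<forall>\<omega>\<in>space M - A. (\<forall>j l. 0 < U j l \<omega> \<and> U j l \<omega> < 1) \<longrightarrow>
       (\<Sum>i=1..n. \<bar>H (\<chi> j. order_stat (\<lambda>l. U j l \<omega>) n i)\<bar>) \<le> \<eta> * sqrt (real n))"
    by (rule Q.additive_remainder_negligible[OF prob_space_axioms uniform_marginals M0[rule_format] \<epsilon> \<eta>])
  then obtain n0 where n0: "\<And>n. n \<ge> n0 \<Longrightarrow> \<exists>A\<in>events. prob A \<le> \<epsilon> \<and>
    (\<forall>\<omega>\<in>space M - A. (\<forall>j l. 0 < U j l \<omega> \<and> U j l \<omega> < 1) \<longrightarrow>
       (\<Sum>i=1..n. \<bar>H (\<chi> j. order_stat (\<lambda>l. U j l \<omega>) n i)\<bar>) \<le> \<eta> * sqrt (real n))"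
    by blast
  show ?thesis
  proof (intro exI[of _ n0] allI impI)
    fix n assume "n \<ge> n0"
    from n0[OF this] obtain A where A: "A \<in> events" and A': "prob A \<le> \<epsilon> \<and>
      (\<forall>\<omega>\<in>space M - A. (\<forall>j l. 0 < U j l \<omega> \<and> U j l \<omega> < 1) \<longrightarrow>
       (\<Sum>i=1..n. \<bar>H (\<chi> j. order_stat (\<lambda>l. U j l \<omega>) n i)\<bar>) \<le> \<eta> * sqrt (real n))"
      by (rule bexE)
    note bound = A'[THEN conjunct2, rule_format]
    have "AE \<omega> in M. \<omega> \<notin> A \<longrightarrow>
      \<bar>T_stat (\<lambda>i. X i \<omega>) n f - real n * \<gamma>_bar F f - (\<Sum>l<n. score f l \<omega>)\<bar> \<le> \<eta> * sqrt (real n)"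
      using AE_regular AE_space
    proof eventually_elim
      case (elim \<omega>)
      show ?case
      proof
        assume "\<omega> \<notin> A"
        let ?y = "\<lambda>i. \<chi> j. order_stat (\<lambda>l. U j l \<omega>) n i"
        have "(\<Sum>i=1..n. \<Sum>j\<in>UNIV. ?V j (?y i $ j)) = (\<Sum>j\<in>UNIV. \<Sum>i=1..n. ?V j (order_stat (\<lambda>l. U j l \<omega>) n i))"
          by (subst sum.swap) simp
        also have "\<dots> = (\<Sum>j\<in>UNIV. \<Sum>l<n. ?V j (U j l \<omega>))"
          by (intro sum.cong refl sum_order_stat)
        also have "\<dots> = (\<Sum>l<n. score f l \<omega>)"
          unfolding score_def by (rule sum.swap)
        finally have perm: "(\<Sum>i=1..n. \<Sum>j\<in>UNIV. ?V j (?y i $ j)) = (\<Sum>l<n. score f l \<omega>)" .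
        have "T_stat (\<lambda>i. X i \<omega>) n f = (\<Sum>i=1..n. \<psi> F f (?y i))" by (rule T_stat_uniform[OF elim(1)])
        also have "\<dots> = (\<Sum>i=1..n. H (?y i) + \<gamma>_bar F f + (\<Sum>j\<in>UNIV. ?V j (?y i $ j)))"
          unfolding H_def by (intro sum.cong) simp_all
        also have "\<dots> = (\<Sum>i=1..n. H (?y i)) + real n * \<gamma>_bar F f + (\<Sum>l<n. score f l \<omega>)"
          unfolding sum.distrib perm by simp
        finally have "T_stat (\<lambda>i. X i \<omega>) n f - real n * \<gamma>_bar F f - (\<Sum>l<n. score f l \<omega>) = (\<Sum>i=1..n. H (?y i))"
          by simp
        also have "\<bar>\<dots>\<bar> \<le> (\<Sum>i=1..n. \<bar>H (?y i)\<bar>)" by (rule sum_abs)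
        also have "\<dots> \<le> \<eta> * sqrt (real n)" by (rule bound) (use elim \<open>\<omega> \<notin> A\<close> in auto)
        finally show "\<bar>T_stat (\<lambda>i. X i \<omega>) n f - real n * \<gamma>_bar F f - (\<Sum>l<n. score f l \<omega>)\<bar> \<le> \<eta> * sqrt (real n)" .
      qed
    qed
    with A A' show "\<exists>A\<in>events. prob A \<le> \<epsilon> \<and> (AE \<omega> in M. \<omega> \<notin> A \<longrightarrow>
      \<bar>T_stat (\<lambda>i. X i \<omega>) n f - real n * \<gamma>_bar F f - (\<Sum>l<n. score f l \<omega>)\<bar> \<le> \<eta> * sqrt (real n))" by blast
  qed
qed

lemma score_product:
  assumes f: "C3 F f" "C4 F f" and g: "C3 F g" "C4 F g"
  defines "c \<equiv> \<lambda>j k. expectation (\<lambda>\<omega>. centred_primitive (gradient_density F f j) (U j 0 \<omega>) * centred_primitive (gradient_density F g k) (U k 0 \<omega>))"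
  shows "integrable M (\<lambda>\<omega>. score f 0 \<omega> * score g 0 \<omega>)"
    and "expectation (\<lambda>\<omega>. score f 0 \<omega> * score g 0 \<omega>) = (\<Sum>j\<in>UNIV. \<Sum>k\<in>UNIV. c j k)"
proof -
  have i: "integrable M (\<lambda>\<omega>. centred_primitive (gradient_density F f j) (U j 0 \<omega>) * centred_primitive (gradient_density F g k) (U k 0 \<omega>))" for j k
    by (rule uniform_pair.covariance_centred_primitives(1)[OF uniform_pairs gradient_density_supported[OF f] gradient_density_supported[OF g] AE_U_unit AE_U_unit])
  have eq: "score f 0 \<omega> * score g 0 \<omega> = (\<Sum>j\<in>UNIV. \<Sum>k\<in>UNIV. centred_primitive (gradient_density F f j) (U j 0 \<omega>) * centred_primitive (gradient_density F g k) (U k 0 \<omega>))" for \<omega>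
    unfolding score_def sum_product ..
  show "integrable M (\<lambda>\<omega>. score f 0 \<omega> * score g 0 \<omega>)"
    unfolding eq using i by (intro Bochner_Integration.integrable_sum)
  show "expectation (\<lambda>\<omega>. score f 0 \<omega> * score g 0 \<omega>) = (\<Sum>j\<in>UNIV. \<Sum>k\<in>UNIV. c j k)"
    unfolding eq c_def using i by (simp add: Bochner_Integration.integral_sum Bochner_Integration.integrable_sum)
qed

lemma score_mean:
  assumes f: "C3 F f" "C4 F f"
  shows "integrable M (score f 0)" "expectation (score f 0) = 0"
proof -
  note m = uniform_pair.centred_primitive_mean[OF uniform_pairs gradient_density_supported[OF f] AE_U_unit]
  show "integrable M (score f 0)" unfolding score_def[abs_def] using m(1) by (intro Bochner_Integration.integrable_sum)
  show "expectation (score f 0) = 0" unfolding score_def[abs_def] using m by (simp add: Bochner_Integration.integral_sum)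
qed

text \<open>The events on the two sides differ by a null set, although \<open>F\<close> need not be
  injective.\<close>

lemma copula_eq_joint_cdf:
  assumes x: "0 < x" "x < 1" and y: "0 < y" "y < 1"
  shows "uniform_pair.copula M (U j 0) (U k 0) x y = joint_cdf M (X 0) j k (quantile (F j) x) (quantile (F k) y)"
  unfolding uniform_pair.copula_def[OF uniform_pairs] joint_cdf_def
proof (rule measure_eq_AE)
  show "AE \<omega> in M. (\<omega> \<in> {\<omega> \<in> space M. U j 0 \<omega> \<le> x \<and> U k 0 \<omega> \<le> y}) =
      (\<omega> \<in> {\<omega> \<in> space M. X 0 \<omega> $ j \<le> quantile (F j) x \<and> X 0 \<omega> $ k \<le> quantile (F k) y})"
    using continuous_cdf.AE_le_quantile_iff[OF coordinate_cdf[of 0 j] x] continuous_cdf.AE_le_quantile_iff[OF coordinate_cdf[of 0 k] y]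
    unfolding U_def by eventually_elim auto
qed measurable


text \<open>The two summands of the integrand are the covariances for \<open>(j, k)\<close> with
  \<open>f\<close> and \<open>g\<close> in either order.\<close>

lemma off_diagonal_covariance:
  assumes f: "C3 F f" "C4 F f" and g: "C3 F g" "C4 F g"
  shows "(LINT y:{0<..<1}|lborel. LINT x:{0<..<1}|lborel.
      (joint_cdf M (X 0) j k (quantile (F j) x) (quantile (F k) y) - x * y) * (\<psi>1 F f j x * \<psi>1 F g k y + \<psi>1 F g j x * \<psi>1 F f k y))
    = expectation (\<lambda>\<omega>. centred_primitive (gradient_density F f j) (U j 0 \<omega>) * centred_primitive (gradient_density F g k) (U k 0 \<omega>))
    + expectation (\<lambda>\<omega>. centred_primitive (gradient_density F g j) (U j 0 \<omega>) * centred_primitive (gradient_density F f k) (U k 0 \<omega>))"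
proof -
  let ?G = "\<lambda>x y. joint_cdf M (X 0) j k (quantile (F j) x) (quantile (F k) y)"
  interpret P: uniform_pair M "U j 0" "U k 0" by (rule uniform_pairs)
  have eq: "(\<lambda>(x, y). (P.copula x y - x * y) * (gradient_density F f' j x * gradient_density F g' k y)) =
      (\<lambda>(x, y). (?G x y - x * y) * ((indicator {0<..<1} x * \<psi>1 F f' j x) * (indicator {0<..<1} y * \<psi>1 F g' k y)))" for f' g'
    using copula_eq_joint_cdf[of _ _ j k] by (auto simp: fun_eq_iff gradient_density_def indicator_def)
  note fg = P.covariance_centred_primitives[OF gradient_density_supported[OF f, of j] gradient_density_supported[OF g, of k] AE_U_unit AE_U_unit, unfolded eq]
  note gf = P.covariance_centred_primitives[OF gradient_density_supported[OF g, of j] gradient_density_supported[OF f, of k] AE_U_unit AE_U_unit, unfolded eq]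
  show ?thesis unfolding fg(3) gf(3) by (rule iterated_integral_open_square[OF fg(2) gf(2)])
qed

lemma diagonal_covariance:
  assumes f: "C3 F f" "C4 F f" and g: "C3 F g" "C4 F g"
  shows "(LINT y:{0<..<1}|lborel. LINT x:{0<..<y}|lborel. x * (1 - y) * (\<psi>1 F f j x * \<psi>1 F g j y + \<psi>1 F g j x * \<psi>1 F f j y))
    = expectation (\<lambda>\<omega>. centred_primitive (gradient_density F f j) (U j 0 \<omega>) * centred_primitive (gradient_density F g j) (U j 0 \<omega>))"
proof -
  interpret P: uniform_pair M "U j 0" "U j 0" by (rule uniform_pairs)
  have cop: "P.copula x y = min x y" if "0 < x" "x < 1" "0 < y" "y < 1" for x y
  proof -
    have "{\<omega> \<in> space M. U j 0 \<omega> \<le> x \<and> U j 0 \<omega> \<le> y} = {\<omega> \<in> space M. U j 0 \<omega> \<le> min x y}" by auto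
    then show ?thesis unfolding P.copula_def using P.U_unif[of "min x y"] that by simp
  qed
  have eq: "(\<lambda>(x, y). (P.copula x y - x * y) * (gradient_density F f j x * gradient_density F g j y)) =
      (\<lambda>(x, y). (min x y - x * y) * ((indicator {0<..<1} x * \<psi>1 F f j x) * (indicator {0<..<1} y * \<psi>1 F g j y)))"
    using cop by (auto simp: fun_eq_iff gradient_density_def indicator_def)
  note fg = P.covariance_centred_primitives[OF gradient_density_supported[OF f, of j] gradient_density_supported[OF g, of j] AE_U_unit AE_U_unit, unfolded eq]
  have m: "(\<lambda>x. indicator {0<..<1} x * \<psi>1 F h j x) \<in> borel_measurable borel" if "C3 F h" "C4 F h" for h
    using gradient_density_supported[OF that, of j] unfolding unit_supported_def gradient_density_def[abs_def] by blast
  show ?thesis unfolding fg(3) by (rule iterated_integral_triangle[OF m[OF f] m[OF g] fg(2)])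
qed

end

lemma sum_pairs_ordered:
  fixes c :: "'d::{finite,linorder} \<Rightarrow> 'd \<Rightarrow> real"
  shows "(\<Sum>j\<in>UNIV. \<Sum>k\<in>UNIV. c j k) = (\<Sum>j\<in>UNIV. c j j) + (\<Sum>(j, k)\<in>{(j, k). j < k}. c j k + c k j)"
proof -
  let ?L = "{(j, k). j < k} :: ('d \<times> 'd) set" and ?G = "{(j, k). k < j} :: ('d \<times> 'd) set" and ?E = "{(j, k). j = k} :: ('d \<times> 'd) set"
  have "(\<Sum>j\<in>UNIV. \<Sum>k\<in>UNIV. c j k) = (\<Sum>(j, k)\<in>UNIV. c j k)"
    by (simp add: sum.cartesian_product)
  also have "UNIV = ?E \<union> (?L \<union> ?G)" by auto
  also have "(\<Sum>(j, k)\<in>?E \<union> (?L \<union> ?G). c j k) = (\<Sum>(j, k)\<in>?E. c j k) + ((\<Sum>(j, k)\<in>?L. c j k) + (\<Sum>(j, k)\<in>?G. c j k))"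
  proof -
    have 1: "?E \<inter> (?L \<union> ?G) = {}" "?L \<inter> ?G = {}" by auto
    show ?thesis by (subst sum.union_disjoint[OF finite finite 1(1)], subst sum.union_disjoint[OF finite finite 1(2)]) simp
  qed
  also have "(\<Sum>(j, k)\<in>?E. c j k) = (\<Sum>j\<in>UNIV. c j j)"
    by (rule sum.reindex_bij_witness[of _ "\<lambda>j. (j, j)" fst]) auto
  also have "(\<Sum>(j, k)\<in>?G. c j k) = (\<Sum>(j, k)\<in>?L. c k j)"
    by (rule sum.reindex_bij_witness[of _ prod.swap prod.swap]) auto
  also have "(\<Sum>(j, k)\<in>?L. c j k) + (\<Sum>(j, k)\<in>?L. c k j) = (\<Sum>(j, k)\<in>?L. c j k + c k j)"
    by (simp add: sum.distrib[symmetric] case_prod_beta')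
  finally show ?thesis .
qed

context iid_sample
begin

definition normalized_T :: "('m \<Rightarrow> real ^ 'd \<Rightarrow> real) \<Rightarrow> nat \<Rightarrow> 'a \<Rightarrow> real ^ 'm" where
  "normalized_T f n \<omega> = (1 / sqrt (real n)) *\<^sub>R (\<chi> r. T_stat (\<lambda>i. X i \<omega>) n (f r))
      - sqrt (real n) *\<^sub>R (\<chi> r. \<gamma>_bar F (f r))"

text \<open>The error is a vector with one component for each function, and each component is
  treated with its own exceptional event.\<close>

lemma score_vector_error:
  fixes f :: "'m::finite \<Rightarrow> real ^ 'd \<Rightarrow> real"
  assumes fm: "\<And>r. f r \<in> borel_measurable borel" and C: "\<And>r. C3 F (f r)" "\<And>r. C4 F (f r)" and \<eta>: "\<eta> > 0"
  shows "(\<lambda>n. prob {\<omega> \<in> space M. \<eta> < norm (normalized_T f n \<omega> - (1 / sqrt (real n)) *\<^sub>R (\<Sum>l<n. \<chi> r. score (f r) l \<omega>))}) \<longlonglongrightarrow> 0"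
proof (rule LIMSEQ_I)
  fix \<epsilon> :: real assume \<epsilon>: "\<epsilon> > 0"
  let ?m = "real CARD('m)"
  have m: "?m > 0" by simp
  define \<epsilon>' \<eta>' where "\<epsilon>' = \<epsilon> / (2 * ?m)" and "\<eta>' = \<eta> / ?m"
  have pos: "\<epsilon>' > 0" "\<eta>' > 0" using \<epsilon> \<eta> by (auto simp: \<epsilon>'_def \<eta>'_def)
  define E where "E r n \<omega> = T_stat (\<lambda>i. X i \<omega>) n (f r) - real n * \<gamma>_bar F (f r) - (\<Sum>l<n. score (f r) l \<omega>)" for r n \<omega>
  have "\<forall>r. \<exists>n0. \<forall>n\<ge>n0. \<exists>A\<in>events. prob A \<le> \<epsilon>' \<and> (AE \<omega> in M. \<omega> \<notin> A \<longrightarrow> \<bar>E r n \<omega>\<bar> \<le> \<eta>' * sqrt (real n))"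
    unfolding E_def using T_stat_linearization[OF C pos] by (rule allI)
  from choice[OF this] obtain nr where nr: "\<forall>r. \<forall>n\<ge>nr r. \<exists>A\<in>events. prob A \<le> \<epsilon>' \<and> (AE \<omega> in M. \<omega> \<notin> A \<longrightarrow> \<bar>E r n \<omega>\<bar> \<le> \<eta>' * sqrt (real n))"
    by (rule exE)
  define n0 where "n0 = Suc (\<Sum>r\<in>UNIV. nr r)"
  have n0: "nr r \<le> n0" for r unfolding n0_def by (rule le_SucI, rule member_le_sum) auto
  show "\<exists>no. \<forall>n\<ge>no. norm (prob {\<omega> \<in> space M. \<eta> < norm (normalized_T f n \<omega> - (1 / sqrt (real n)) *\<^sub>R (\<Sum>l<n. \<chi> r. score (f r) l \<omega>))} - 0) < \<epsilon>"
  proof (intro exI[of _ n0] allI impI)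
    fix n assume n: "n \<ge> n0"
    then have n1: "n \<ge> 1" by (simp add: n0_def)
    then have sn: "sqrt (real n) > 0" by simp
    have "\<forall>r. \<exists>A. A \<in> events \<and> prob A \<le> \<epsilon>' \<and> (AE \<omega> in M. \<omega> \<notin> A \<longrightarrow> \<bar>E r n \<omega>\<bar> \<le> \<eta>' * sqrt (real n))"
    proof
      fix r
      have "nr r \<le> n" using n0[of r] n by simp
      from nr[rule_format, OF this]
      show "\<exists>A. A \<in> events \<and> prob A \<le> \<epsilon>' \<and> (AE \<omega> in M. \<omega> \<notin> A \<longrightarrow> \<bar>E r n \<omega>\<bar> \<le> \<eta>' * sqrt (real n))"
        unfolding Bex_def .
    qed
    from choice[OF this] obtain A where A: "\<forall>r. A r \<in> events \<and> prob (A r) \<le> \<epsilon>' \<and>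
        (AE \<omega> in M. \<omega> \<notin> A r \<longrightarrow> \<bar>E r n \<omega>\<bar> \<le> \<eta>' * sqrt (real n))"
      by (rule exE)
    define D where "D \<omega> = normalized_T f n \<omega> - (1 / sqrt (real n)) *\<^sub>R (\<Sum>l<n. \<chi> r. score (f r) l \<omega>)" for \<omega>
    have comp: "D \<omega> $ r = E r n \<omega> / sqrt (real n)" for \<omega> r
    proof -
      have "sqrt (real n) = real n / sqrt (real n)" using n1 by (simp add: real_div_sqrt)
      then have "D \<omega> $ r = T_stat (\<lambda>i. X i \<omega>) n (f r) / sqrt (real n) - real n / sqrt (real n) * \<gamma>_bar F (f r) - (\<Sum>l<n. score (f r) l \<omega>) / sqrt (real n)"
        unfolding D_def normalized_T_def by simp
      also have "\<dots> = E r n \<omega> / sqrt (real n)" unfolding E_def by (simp add: diff_divide_distrib)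
      finally show ?thesis .
    qed
    have "AE \<omega> in M. \<forall>r\<in>UNIV. \<omega> \<notin> A r \<longrightarrow> \<bar>E r n \<omega>\<bar> \<le> \<eta>' * sqrt (real n)"
      using A by (intro AE_finite_allI) auto
    then have "AE \<omega> in M. \<omega> \<in> {\<omega> \<in> space M. \<eta> < norm (D \<omega>)} \<longrightarrow> \<omega> \<in> (\<Union>r. A r)"
    proof eventually_elim
      case (elim \<omega>)
      show ?case
      proof (rule impI, rule ccontr)
        assume big: "\<omega> \<in> {\<omega> \<in> space M. \<eta> < norm (D \<omega>)}" and out: "\<omega> \<notin> (\<Union>r. A r)"
        have "norm (D \<omega>) \<le> (\<Sum>r\<in>UNIV. \<bar>D \<omega> $ r\<bar>)" by (rule norm_le_l1_cart)
        also have "\<dots> \<le> (\<Sum>r\<in>(UNIV::'m set). \<eta>')"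
        proof (rule sum_mono)
          fix r
          have "\<bar>E r n \<omega>\<bar> \<le> \<eta>' * sqrt (real n)" using elim out by blast
          then show "\<bar>D \<omega> $ r\<bar> \<le> \<eta>'" unfolding comp using sn by (simp add: divide_le_eq)
        qed
        also have "\<dots> = \<eta>" by (simp add: \<eta>'_def)
        finally show False using big by simp
      qed
    qed
    then have "prob {\<omega> \<in> space M. \<eta> < norm (D \<omega>)} \<le> prob (\<Union>r. A r)"
      by (rule finite_measure_mono_AE) (use A in auto)
    also have "prob (\<Union>r\<in>UNIV. A r) \<le> (\<Sum>r\<in>UNIV. prob (A r))"
      using A by (intro finite_measure_subadditive_finite) auto
    also have "\<dots> \<le> (\<Sum>r\<in>(UNIV::'m set). \<epsilon>')" using A by (intro sum_mono) auto
    also have "\<dots> = \<epsilon> / 2" by (simp add: \<epsilon>'_def)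
    also have "\<dots> < \<epsilon>" using \<epsilon> by simp
    finally show "norm (prob {\<omega> \<in> space M. \<eta> < norm (normalized_T f n \<omega> - (1 / sqrt (real n)) *\<^sub>R (\<Sum>l<n. \<chi> r. score (f r) l \<omega>))} - 0) < \<epsilon>"
      unfolding D_def by simp
  qed
qed

theorem T_stat_clt:
  fixes f :: "'m::finite \<Rightarrow> real ^ 'd \<Rightarrow> real"
  assumes fm: "\<And>r. f r \<in> borel_measurable borel" and C: "\<And>r. C3 F (f r)" "\<And>r. C4 F (f r)"
  shows "\<exists>\<nu>. multivariate_normal 0 (\<chi> r s. expectation (\<lambda>\<omega>. score (f r) 0 \<omega> * score (f s) 0 \<omega>)) \<nu> \<and>
    converges_in_distribution M (normalized_T f) \<nu>"
proof -
  define W where "W l \<omega> = (\<chi> r. score (f r) l \<omega>)" for l \<omega>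
  define h where "h x = (\<chi> r. \<Sum>j\<in>UNIV. centred_primitive (gradient_density F (f r) j) (F j (x $ j)))" for x :: "real ^ 'd"
  have prim [measurable]: "centred_primitive (gradient_density F (f r) j) \<in> borel_measurable borel" for r j
    using gradient_density_supported[OF C, of r j] unfolding unit_supported_def
    by (intro centred_primitive_measurable) blast
  have h [measurable]: "h \<in> borel_measurable borel"
    unfolding borel_measurable_vec_lambda_iff h_def by simp
  have Wh: "W l = (\<lambda>\<omega>. h (X l \<omega>))" for l
    unfolding W_def h_def score_def U_def by (rule refl)
  have "\<exists>\<nu>. multivariate_normal 0 (\<chi> r s. expectation (\<lambda>\<omega>. W 0 \<omega> $ r * W 0 \<omega> $ s)) \<nu> \<and>
    converges_in_distribution M (normalized_T f) \<nu>"
  proof (rule multivariate_clt_with_error)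
    show "indep_vars (\<lambda>_. borel) W UNIV"
      unfolding Wh[abs_def] by (rule indep_vars_compose2[OF X_indep]) measurable
    have "distr M borel (\<lambda>\<omega>. h (X l \<omega>)) = distr (distr M borel (X l)) borel h" for l
      by (subst distr_distr) (simp_all add: comp_def)
    then show "distr M borel (W l) = distr M borel (W 0)" for l
      unfolding Wh by (simp only: X_ident[of l])
    show "integrable M (\<lambda>\<omega>. (W 0 \<omega> $ r)\<^sup>2)" for r
      using score_product(1)[OF C C, of r r] unfolding W_def by (simp add: power2_eq_square)
    show "expectation (\<lambda>\<omega>. W 0 \<omega> $ r) = 0" for r
      using score_mean(2)[OF C, of r] unfolding W_def by simp
    show "normalized_T f n \<in> borel_measurable M" for n
    proof -
      have "(\<lambda>\<omega>. \<chi> r. T_stat (\<lambda>i. X i \<omega>) n (f r)) \<in> borel_measurable M"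
        unfolding borel_measurable_vec_lambda_iff using T_stat_borel[OF fm] by simp
      then show ?thesis unfolding normalized_T_def[abs_def] by (intro borel_measurable_diff borel_measurable_scaleR borel_measurable_const)
    qed
    show "(\<lambda>n. prob {\<omega> \<in> space M. \<eta> < norm (normalized_T f n \<omega> - (1 / sqrt (real n)) *\<^sub>R (\<Sum>l<n. W l \<omega>))}) \<longlonglongrightarrow> 0" if "\<eta> > 0" for \<eta>
      unfolding W_def by (rule score_vector_error[OF fm C that])
  qed
  then show ?thesis unfolding W_def by simp
qed

end

theorem corollary1p1:
  fixes M :: "'a measure"
    and X :: "nat \<Rightarrow> 'a \<Rightarrow> real ^ ('d::{finite,linorder})"
    and F :: "'d \<Rightarrow> real \<Rightarrow> real"
    and G :: "'d \<Rightarrow> 'd \<Rightarrow> real \<Rightarrow> real \<Rightarrow> real"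
    and \<phi> :: "'m::finite \<Rightarrow> real ^ ('d::{finite,linorder}) \<Rightarrow> real"
  assumes "prob_space M"
    and indep: "prob_space.indep_vars M (\<lambda>_. borel) X UNIV"
    and ident: "\<And>i. distr M borel (X i) = distr M borel (X 0)"
    and F_def: "F = (\<lambda>j. cdf (distr M borel (\<lambda>\<omega>. X 0 \<omega> $ j)))"
    and G_def: "G = (\<lambda>j k x y. joint_cdf M (X 0) j k (quantile (F j) x) (quantile (F k) y))"
    and F_cont: "\<And>j. continuous_on UNIV (F j)"
    and \<phi>_meas: "\<And>r. \<phi> r \<in> borel_measurable borel"
    and partials: "\<And>r. diag_partials_exist F (\<phi> r)"
    and C1: "\<And>r. C1 F (\<phi> r)"
    and C2: "\<And>r. C2 F (\<phi> r)"
    and C3: "\<And>r. C3 F (\<phi> r)"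
    and C4: "\<And>r. C4 F (\<phi> r)"
    and riemann: "\<And>r. riemann_integrable_01 (\<gamma> F (\<phi> r))"
  shows "\<exists>\<nu>. multivariate_normal 0 (\<chi> r s. \<sigma> G (\<lambda>r j. \<psi>1 F (\<phi> r) j) r s) \<nu> \<and>
    converges_in_distribution M
      (\<lambda>n \<omega>. (1 / sqrt (real n)) *\<^sub>R (\<chi> r. T_stat (\<lambda>i. X i \<omega>) n (\<phi> r))
              - sqrt (real n) *\<^sub>R (\<chi> r. \<gamma>_bar F (\<phi> r))) \<nu>"
proof -
  interpret prob_space M by fact
  interpret iid_sample M X F
    by unfold_locales (fact indep ident F_def F_cont)+
  let ?c = "\<lambda>r s j k. expectation (\<lambda>\<omega>. centred_primitive (gradient_density F (\<phi> r) j) (U j 0 \<omega>) *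
      centred_primitive (gradient_density F (\<phi> s) k) (U k 0 \<omega>))"
  have "\<sigma> G (\<lambda>r j. \<psi>1 F (\<phi> r) j) r s = expectation (\<lambda>\<omega>. score (\<phi> r) 0 \<omega> * score (\<phi> s) 0 \<omega>)" for r s
  proof -
    have swap: "?c s r j k = ?c r s k j" for j k by (simp only: mult.commute)
    have "\<sigma> G (\<lambda>r j. \<psi>1 F (\<phi> r) j) r s = (\<Sum>j\<in>UNIV. ?c r s j j) + (\<Sum>(j, k)\<in>{(j, k). j < k}. ?c r s j k + ?c s r j k)"
      unfolding \<sigma>_def G_def diagonal_covariance[OF C3 C4 C3 C4] off_diagonal_covariance[OF C3 C4 C3 C4] ..
    also have "\<dots> = (\<Sum>j\<in>UNIV. \<Sum>k\<in>UNIV. ?c r s j k)"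
      unfolding swap by (rule sum_pairs_ordered[symmetric])
    also have "\<dots> = expectation (\<lambda>\<omega>. score (\<phi> r) 0 \<omega> * score (\<phi> s) 0 \<omega>)"
      by (rule score_product(2)[OF C3 C4 C3 C4, symmetric])
    finally show ?thesis .
  qed
  then show ?thesis using T_stat_clt[OF \<phi>_meas C3 C4] unfolding normalized_T_def[abs_def] by simp
qed

end
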